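(* Let $0<p<\infty$, let $\omega=\omega_1\cdots\omega_s$ on $[-1,1]$, where the function $t\mapsto\omega_i(\cos t)$ belongs to $\Omega$ for $i=1,\dots,s$, and let $u$ be a doubling weight on $[-1,1]$. Then there exists a constant $C=C(p,\omega,u)$ such that for every integer $n\ge1$ and every algebraic polynomial $P_n$ of degree at most $n$, $$\int_{-1}^1\varphi^p(x)\,|P_n'(x)|^p\,\omega(x)u(x)\,dx\le C\,n^p\int_{-1}^1|P_n(x)|^p\,\omega(x)u(x)\,dx,\qquad \varphi(x)=\sqrt{1-x^2}.$$
   Context: $\mathbb{T}=\mathbb{R}/2\pi\mathbb{Z}$. Weights on $[-1,1]$ are nonnegative integrable functions $[-1,1]\to[0,\infty)$. A weight $u$ on $[-1,1]$ is doubling if there is a constant $L$ with $\int_{2I\cap[-1,1]}u\le L\int_Iu$ for all intervals $I\subset[-1,1]$, where $2I$ is the interval with the same midpoint as $I$ and twice its length. Class $\Omega$: a function $w$ on $\mathbb{T}$ belongs to $\Omega$ if $w(t)=\exp(-F(g(t)))$, $t\in\mathbb{T}$ (with $w(t)=0$ where $g(t)=0$), where for some $A>0$: - $g:\mathbb{T}\to[-A,A]$ is real analytic, i.e. for some $D>0$, $|g^{(n)}(t)|\le D^n n!$ for all $t\in\mathbb{T}$, $n\ge 1$; each zero of $g$ has multiplicity one; and $g$ has at least one zero on $\mathbb{T}$; - $F:[-A,A]\setminus\{0\}\to(0,\infty)$ is even, $C^\infty$ on $(0,A]$, and satisfies: (F1) $F(x)\to\infty$ as $x\to0+$; (F2)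 $F$ is decreasing on $(0,A]$; (F3) for some $B>0$, $|F^{(n)}(x)|\le B^n n^n F(x)/x^n$ for $x\in(0,A]$, $n=1,2,\dots$; (F4) there exist $A_1,A_2>0$ with $A_2\le |F'(x)|x/F(x)\le A_1$ for $x\in(0,A]$. *)

theory Defs
  imports "HOL-Analysis.Analysis" "HOL-Computational_Algebra.Polynomial"
begin

text \<open>\<open>d n\<close> is the \<open>n\<close>-th derivative of \<open>f\<close> on \<open>S\<close>, one-sided at endpoints belonging to \<open>S\<close>.
  For an interval \<open>S\<close> with nonempty interior the family \<open>d\<close> is determined on \<open>S\<close> by \<open>f\<close>, and
  \<open>f\<close> is \<open>C\<close>-infinity on \<open>S\<close> iff such a family exists.\<close>

definition derivatives_on :: "real set \<Rightarrow> (real \<Rightarrow> real) \<Rightarrow> (nat \<Rightarrow> real \<Rightarrow> real) \<Rightarrow> bool" where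
  "derivatives_on S f d \<longleftrightarrow>
     (\<forall>x\<in>S. d 0 x = f x) \<and>
     (\<forall>n. \<forall>x\<in>S. (d n has_real_derivative d (Suc n) x) (at x within S))"

text \<open>Functions on the circle \<open>\<real>/2\<pi>\<int>\<close> are represented by \<open>2\<pi>\<close>-periodic functions on \<open>\<real>\<close>.\<close>

definition Omega_inner :: "real \<Rightarrow> (real \<Rightarrow> real) \<Rightarrow> bool" where
  "Omega_inner A g \<longleftrightarrow>
     (\<forall>t. g (t + 2 * pi) = g t) \<and>
     (\<forall>t. g t \<in> {-A..A}) \<and>
     (\<exists>d. derivatives_on UNIV g d \<and>
        (\<exists>D>0. \<forall>t. \<forall>n\<ge>1. \<bar>d n t\<bar> \<le> D ^ n * fact n) \<and>
        (\<forall>t. g t = 0 \<longrightarrow> d 1 t \<noteq> 0)) \<and>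
     (\<exists>t. g t = 0)"

text \<open>Only the values of \<open>F\<close> on \<open>[-A,A] - {0}\<close> matter; the derivatives at \<open>A\<close> are one-sided.\<close>

definition Omega_outer :: "real \<Rightarrow> (real \<Rightarrow> real) \<Rightarrow> bool" where
  "Omega_outer A F \<longleftrightarrow>
     (\<forall>x\<in>{-A..A} - {0}. F x > 0 \<and> F (-x) = F x) \<and>
     filterlim F at_top (at_right 0) \<and>
     antimono_on {0<..A} F \<and>
     (\<exists>d. derivatives_on {0<..A} F d \<and>
        (\<exists>B>0. \<forall>x\<in>{0<..A}. \<forall>n\<ge>1. \<bar>d n x\<bar> \<le> B ^ n * real n ^ n * F x / x ^ n) \<and>
        (\<exists>A1>0. \<exists>A2>0. \<forall>x\<in>{0<..A}. A2 \<le> \<bar>d 1 x\<bar> * x / F x \<and> \<bar>d 1 x\<bar> * x / F x \<le> A1))"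

definition Omega_class :: "(real \<Rightarrow> real) set" where
  "Omega_class = {w. \<exists>A>0. \<exists>g F. Omega_inner A g \<and> Omega_outer A F \<and>
     (\<forall>t. w t = (if g t = 0 then 0 else exp (- F (g t))))}"

text \<open>Only the values of a weight on \<open>[-1,1]\<close> matter. The interval \<open>I\<close> of the doubling condition
  is \<open>[c - r, c + r]\<close>, so that \<open>2I = [c - 2r, c + 2r]\<close>; whether its endpoints belong to \<open>I\<close> does
  not affect the integrals.\<close>

definition weight :: "(real \<Rightarrow> real) \<Rightarrow> bool" where
  "weight u \<longleftrightarrow> (\<forall>x\<in>{-1..1}. u x \<ge> 0) \<and> set_integrable lebesgue {-1..1} u"

definition doubling_weight :: "(real \<Rightarrow> real) \<Rightarrow> bool" where
  "doubling_weight u \<longleftrightarrow> weight u \<and>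
     (\<exists>L. \<forall>c r. r > 0 \<longrightarrow> {c - r..c + r} \<subseteq> {-1..1} \<longrightarrow>
        (LINT x:{c - 2 * r..c + 2 * r} \<inter> {-1..1}|lebesgue. u x)
          \<le> L * (LINT x:{c - r..c + r}|lebesgue. u x))"

definition phi :: "real \<Rightarrow> real" where
  "phi x = sqrt (1 - x\<^sup>2)"

end

theory Submission
  imports Defs "HOL-Complex_Analysis.Complex_Analysis"
    "HOL-Computational_Algebra.Fundamental_Theorem_Algebra"
begin

text \<open>
  No polynomial approximation of the weight is used. Write \<open>f z = P (cos z)\<close> and let \<open>E\<close> be the
  Poisson average at height \<open>Y\<close> around a point \<open>t\<close>. Factoring \<open>P\<close> gives
  \<open>\<bar>f\<bar> \<le> exp (2 n Y + E (ln \<bar>f\<bar>))\<close> at complex points at distance about \<open>Y\<close> from \<open>t\<close>, so by Jensen's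
  inequality \<open>\<bar>f\<bar>^p \<le> exp (2 n p Y + E \<psi>) E (\<bar>f\<bar>^p exp (- \<psi>))\<close> for every bounded \<open>\<psi>\<close>.
  This is applied to \<open>exp (- \<psi>) = (truncated \<omega>) V\<close>, where \<open>V t\<close> is the mass of \<open>u\<close> on the arc
  of radius \<open>1/n\<close> around \<open>t\<close> and where each factor \<open>exp (- F (g t))\<close> is made constant
  on \<open>\<bar>g\<bar> < y\<close>, with \<open>F y = \<Lambda> n y\<close>. At height \<open>Y \<sim> 1/n\<close> one has \<open>E \<psi> \<le> \<psi> + O(1)\<close>: doubling lets
  \<open>ln V\<close> vary only logarithmically, and the second differences of the truncated \<open>F (g t)\<close> are controlled
  by \<open>n\<close>. Cauchy's estimate then yields the inequality for the truncated and averaged weight.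

  The averaging and the truncation are undone as follows. The set where \<open>\<bar>f\<bar>^p exp (- \<psi>)\<close> is much
  smaller than its own Poisson average carries a small part of the integral and can be discarded;
  elsewhere \<open>\<bar>f\<bar>\<close> is essentially constant at scale \<open>\<kappa>/n\<close>, so \<open>V\<close> can be replaced by the measure.
  Points near a zero \<open>z\<close> of the weight are of the discarded kind with respect to a Poisson
  average at height \<open>K max y\<close>, the maximum being over the factors vanishing at \<open>z\<close>:
  there \<open>\<psi>\<close> exceeds its average by a multiple of \<open>\<Lambda> n (max y)\<close>.
\<close>

section \<open>The Poisson kernel\<close>

text \<open>The equation \<open>F y = \<Lambda> n y\<close> balances the scales. The slope of the
  truncated potential is at most a constant times \<open>F y / y = \<Lambda> n\<close>, so over
  distances of order \<open>1/n\<close> the potential changes by O(1). At height \<open>K y\<close>,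
  however, the growth \<open>2 n p K y\<close> of the polynomial and the surplus of the potential
  near a zero, a fixed fraction of \<open>F y = \<Lambda> n y\<close>, are both linear in
  \<open>n y\<close>, and a large \<Lambda> decides in favour of the potential. Moreover
  \<open>n y = F y / \<Lambda>\<close> tends to infinity, so arcs of radius \<open>1/n\<close>
  around points with \<open>\<bar>g\<bar> \<ge> 2 y\<close> do not meet the region where truncation
  alters the weight. The danger is circularity, since the constants at height \<open>2/n\<close>
  grow exponentially with \<Lambda>. The proportion of mass that may be discarded depends on the
  number of factors alone and is fixed first; then come \<open>K\<close> and \<Lambda>. The scale
  \<kappa> on which \<open>\<bar>f\<bar>\<close> is nearly constant is chosen last and may depend on
  all of these.\<close>

text \<open>
  With \<open>r = 1 / (1 + Y)\<close> the denominator is \<open>\<bar>1 - r exp (i u)\<bar>\<^sup>2 / (1 - r)\<^sup>2\<close>, and the kernel is the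
  Poisson kernel of the unit disc at radius \<open>r\<close>, normalised to have mass one.
\<close>

definition poisson_denom :: "real \<Rightarrow> real \<Rightarrow> real" where
  "poisson_denom Y u = 1 + 4 * (1 + Y) * (sin (u / 2))\<^sup>2 / Y\<^sup>2"

definition poisson_kernel :: "real \<Rightarrow> real \<Rightarrow> real" where
  "poisson_kernel Y u = (2 + Y) / (2 * pi * Y * poisson_denom Y u)"

definition poisson :: "real \<Rightarrow> real measure" where
  "poisson Y = density lborel (\<lambda>u. ennreal (indicator {-pi..pi} u * poisson_kernel Y u))"

abbreviation avg :: "real \<Rightarrow> (real \<Rightarrow> real) \<Rightarrow> real \<Rightarrow> real" where
  "avg Y f t \<equiv> (LINT u|poisson Y. f (t + u))"

abbreviation pcos :: "complex poly \<Rightarrow> real \<Rightarrow> complex" where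
  "pcos P t \<equiv> poly P (complex_of_real (cos t))"

lemma poisson_denom_ge_1: "Y > 0 \<Longrightarrow> poisson_denom Y u \<ge> 1"
  by (simp add: poisson_denom_def)

lemma poisson_kernel_pos: "Y > 0 \<Longrightarrow> poisson_kernel Y u > 0"
  using poisson_denom_ge_1[of Y u] by (simp add: poisson_kernel_def)

lemma continuous_on_poisson_denom [continuous_intros]:
  fixes f :: "real \<Rightarrow> real"
  shows "continuous_on S f \<Longrightarrow> Y > 0 \<Longrightarrow> continuous_on S (\<lambda>x. poisson_denom Y (f x))"
  unfolding poisson_denom_def
  by (intro continuous_on_add continuous_on_mult continuous_on_divide continuous_on_const
        continuous_on_power continuous_on_sin) auto

lemma continuous_on_poisson_kernel [continuous_intros]:
  fixes f :: "real \<Rightarrow> real"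
  assumes "continuous_on S f" "Y > 0"
  shows "continuous_on S (\<lambda>x. poisson_kernel Y (f x))"
proof -
  have "2 * pi * Y * poisson_denom Y (f x) \<noteq> 0" for x
    using poisson_denom_ge_1[OF assms(2), of "f x"] assms by auto
  thus ?thesis
    unfolding poisson_kernel_def using assms by (auto intro!: continuous_intros)
qed

lemma poisson_denom_measurable [measurable]: "poisson_denom Y \<in> borel_measurable borel"
  unfolding poisson_denom_def[abs_def] by measurable

lemma poisson_kernel_measurable [measurable]: "poisson_kernel Y \<in> borel_measurable borel"
  unfolding poisson_kernel_def[abs_def] by measurable

lemma sets_poisson [measurable_cong, simp]: "sets (poisson Y) = sets borel"
  by (simp add: poisson_def)

lemma space_poisson [simp]: "space (poisson Y) = UNIV"
  by (simp add: poisson_def)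

text \<open>Cauchy's integral formula at the point \<open>- r\<close>, applied to \<open>H\<close>.
  The extra factor \<open>(1 - r\<^sup>2) / (1 + r z)\<close> equals 1 at \<open>- r\<close>, and on
  the circle it turns the Cauchy kernel into the Poisson kernel.\<close>

lemma Poisson_formula:
  assumes "Y > 0" "R > 1" and h: "h holomorphic_on ball 0 R"
  shows "((\<lambda>u. complex_of_real (poisson_kernel Y u) * h (cis u)) has_integral h (of_real (1 / (1 + Y)))) {-pi..pi}"
proof -
  define r where "r = 1 / (1 + Y)"
  have r: "0 < r" "r < 1" using assms by (auto simp: r_def)
  \<comment> \<open>The reflection \<open>z \<mapsto> - z\<close> is needed because \<open>circlepath\<close> runs over the angles \<open>{0..2 * pi}\<close>.\<close>
  define H where "H = (\<lambda>z. h (- z) * of_real (1 - r\<^sup>2) / (1 + of_real r * z))"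
  have nz: "1 + of_real r * z \<noteq> 0" if "norm z \<le> 1" for z :: complex
  proof
    assume "1 + of_real r * z = 0"
    hence "norm (of_real r * z) = 1"
      by (metis add_eq_0_iff2 norm_minus_cancel norm_one)
    moreover have "norm (of_real r * z) \<le> r * 1"
      using that r by (simp add: norm_mult mult_left_le)
    ultimately show False using r by simp
  qed
  have "(\<lambda>z. h (- z)) holomorphic_on cball 0 1"
    by (rule holomorphic_on_compose_gen[OF _ h, of "\<lambda>z. -z", unfolded o_def])
       (use \<open>R > 1\<close> in \<open>auto intro!: holomorphic_intros\<close>)
  hence "H holomorphic_on cball 0 1"
    unfolding H_def using nz by (intro holomorphic_intros) auto
  moreover have "norm (- of_real r - 0 :: complex) < 1" using r by simp
  ultimately have "((\<lambda>z. H z / (z - (- of_real r))) has_contour_integral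
     (2 * of_real pi * \<i> * H (- of_real r))) (circlepath 0 1)"
    by (rule Cauchy_integral_circlepath_simple)
  hence "((\<lambda>t. H (cis t) / (cis t + of_real r) * \<i> * cis t)
          has_integral (2 * of_real pi * \<i> * H (- of_real r))) {0..2*pi}"
    unfolding circlepath_def by (subst (asm) has_contour_integral_part_circlepath_iff) auto
  hence "((\<lambda>t. H (cis (1 * t + pi)) / (cis (1 * t + pi) + of_real r) * \<i> * cis (1 * t + pi))
          has_integral (2 * of_real pi * \<i> * H (- of_real r))) {-pi..pi}"
    using has_integral_affinity'[of "\<lambda>t. H (cis t) / (cis t + of_real r) * \<i> * cis t" _ 0 "2*pi" 1 pi]
    by auto
  hence "((\<lambda>t. H (cis (1 * t + pi)) / (cis (1 * t + pi) + of_real r) * \<i> * cis (1 * t + pi)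
           * (1 / (2 * of_real pi * \<i>)))
          has_integral (2 * of_real pi * \<i> * H (- of_real r) * (1 / (2 * of_real pi * \<i>)))) {-pi..pi}"
    by (rule has_integral_mult_left)
  moreover have "H (cis (1 * t + pi)) / (cis (1 * t + pi) + of_real r) * \<i> * cis (1 * t + pi)
      * (1 / (2 * of_real pi * \<i>)) = of_real (poisson_kernel Y t) * h (cis t)" for t
  proof -
    have c: "cis (1 * t + pi) = - cis t" by (simp add: cis_mult[symmetric])
    have n1: "1 - of_real r * cis t \<noteq> 0" using nz[of "- cis t"] by simp
    have n2: "of_real r - cis t \<noteq> 0"
      using r by (metis eq_iff_diff_eq_0 norm_cis norm_of_real abs_of_pos less_irrefl)
    have "cos t = 1 - 2 * (sin (t/2))\<^sup>2" using cos_double_sin[of "t/2"] by simp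
    hence "1 - 2 * r * cos t + r\<^sup>2 = 1 - 2 * r * (1 - 2 * (sin (t/2))\<^sup>2) + r\<^sup>2"
      by simp
    also have "\<dots> = (1 - r)\<^sup>2 + 4 * r * (sin (t/2))\<^sup>2"
      by (simp add: algebra_simps power2_eq_square)
    also have "\<dots> = (1 - r)\<^sup>2 * (1 + 4 * r * (sin (t/2))\<^sup>2 / (1 - r)\<^sup>2)"
      using r by (simp add: distrib_left)
    also have "4 * r * (sin (t/2))\<^sup>2 / (1 - r)\<^sup>2 = (r / (1 - r)\<^sup>2) * (4 * (sin (t/2))\<^sup>2)"
      by simp
    also have "r / (1 - r)\<^sup>2 = (1 + Y) / Y\<^sup>2"
    proof -
      have "1 - r = Y / (1 + Y)" using assms by (simp add: r_def field_simps)
      thus ?thesis using assms by (simp add: r_def power2_eq_square)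
    qed
    finally have q: "1 - 2 * r * cos t + r\<^sup>2 = (1 - r)\<^sup>2 * poisson_denom Y t"
      by (simp add: poisson_denom_def mult_ac)
    have "poisson_denom Y t \<noteq> 0" using poisson_denom_ge_1[of Y t] assms by simp
    have "(1 - of_real r * cis t) * (of_real r - cis t) =
        - cis t * of_real (1 - 2 * r * cos t + r\<^sup>2)"
    proof -
      have "(cos t)\<^sup>2 + (sin t)\<^sup>2 = 1" by simp
      hence "r * (cos t)\<^sup>2 + r * (sin t)\<^sup>2 = r" by (metis distrib_left mult.right_neutral)
      thus ?thesis by (simp add: complex_eq_iff algebra_simps power2_eq_square)
    qed
    hence e: "(1 - of_real r * cis t) * (of_real r - cis t) = - cis t * of_real ((1 - r)\<^sup>2 * poisson_denom Y t)"
      using q by simp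
    have "H (- cis t) / (- cis t + of_real r) * \<i> * (- cis t) * (1 / (2 * of_real pi * \<i>))
       = h (cis t) * of_real (1 - r\<^sup>2) * (- cis t) / ((1 - of_real r * cis t) * (of_real r - cis t))
          / (2 * of_real pi)"
    proof -
      have "x * k / A / B * \<i> * (- c) * (1 / (2 * of_real pi * \<i>)) = x * k * (- c) / (A * B) / (2 * of_real pi)"
        for x k A B c :: complex by (simp add: mult.assoc)
      from this[of "h (cis t)" "of_real (1 - r\<^sup>2)" "1 - of_real r * cis t" "of_real r - cis t"]
      show ?thesis by (simp add: H_def)
    qed
    also have "\<dots> = h (cis t) * of_real ((1 - r\<^sup>2) / ((1 - r)\<^sup>2 * poisson_denom Y t * (2 * pi)))"
      unfolding e using r \<open>poisson_denom Y t \<noteq> 0\<close> by (simp add: field_simps)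
    also have "(1 - r\<^sup>2) / ((1 - r)\<^sup>2 * poisson_denom Y t * (2 * pi)) = poisson_kernel Y t"
    proof -
      have "1 - r\<^sup>2 = (1 + r) * (1 - r)" by (simp add: power2_eq_square algebra_simps)
      hence "(1 - r\<^sup>2) / (1 - r)\<^sup>2 = (1 + r) / (1 - r)"
        using r by (simp add: power2_eq_square)
      also have "\<dots> = (2 + Y) / Y"
      proof -
        have "1 + r = (2 + Y) / (1 + Y)" "1 - r = Y / (1 + Y)"
          using assms by (auto simp: r_def field_simps)
        thus ?thesis using assms by simp
      qed
      finally have "(1 - r\<^sup>2) / (1 - r)\<^sup>2 = (2 + Y) / Y" .
      moreover have "(1 - r\<^sup>2) / ((1 - r)\<^sup>2 * poisson_denom Y t * (2 * pi)) = (1 - r\<^sup>2) / (1 - r)\<^sup>2 / (poisson_denom Y t * (2 * pi))"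
        by simp
      ultimately show ?thesis by (simp add: poisson_kernel_def field_simps)
    qed
    finally show ?thesis using c by (simp add: mult.commute)
  qed
  moreover have "2 * of_real pi * \<i> * H (- of_real r) * (1 / (2 * of_real pi * \<i>)) = h (of_real r)"
  proof -
    have "1 - (of_real r)\<^sup>2 \<noteq> (0::complex)"
      using r by (metis abs_of_pos eq_iff_diff_eq_0 less_irrefl norm_of_real of_real_power one_power2 power2_eq_imp_eq zero_less_one_class.zero_le_one norm_one norm_power less_imp_le)
    thus ?thesis by (simp add: H_def power2_eq_square)
  qed
  ultimately show ?thesis by (simp add: r_def)
qed

lemma has_integral_poisson_kernel: "Y > 0 \<Longrightarrow> (poisson_kernel Y has_integral 1) {-pi..pi}"
  using has_integral_Re[OF Poisson_formula[of Y 2 "\<lambda>_. 1"]] by simp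

lemma nn_integral_poisson:
  "f \<in> borel_measurable borel \<Longrightarrow>
    (\<integral>\<^sup>+ u. f u \<partial>poisson Y) = (\<integral>\<^sup>+ u. ennreal (indicator {-pi..pi} u * poisson_kernel Y u) * f u \<partial>lborel)"
  unfolding poisson_def by (subst nn_integral_density) auto

lemma emeasure_poisson_UNIV:
  assumes "Y > 0" shows "emeasure (poisson Y) UNIV = 1"
proof -
  have 1: "set_integrable lborel {-pi..pi} (poisson_kernel Y)"
    unfolding set_integrable_def using assms
    by (intro borel_integrable_compact continuous_on_poisson_kernel continuous_on_id) auto
  have "emeasure (poisson Y) UNIV = (\<integral>\<^sup>+ u. ennreal (indicator {-pi..pi} u * poisson_kernel Y u) \<partial>lborel)"
    unfolding poisson_def by (subst emeasure_density) auto
  also have "\<dots> = ennreal (LINT u|lborel. indicator {-pi..pi} u * poisson_kernel Y u)"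
    using 1 poisson_kernel_pos[OF assms]
    by (intro nn_integral_eq_integral) (auto simp: set_integrable_def indicator_def less_imp_le)
  also have "(LINT u|lborel. indicator {-pi..pi} u * poisson_kernel Y u) = (LINT u:{-pi..pi}|lborel. poisson_kernel Y u)"
    by (simp add: set_lebesgue_integral_def)
  also have "\<dots> = integral {-pi..pi} (poisson_kernel Y)"
    using 1 by (rule set_borel_integral_eq_integral)
  also have "\<dots> = 1" using has_integral_poisson_kernel[OF assms] by (rule integral_unique)
  finally show ?thesis by simp
qed

lemma finite_measure_poisson: "Y > 0 \<Longrightarrow> finite_measure (poisson Y)"
  by (rule finite_measureI) (simp add: emeasure_poisson_UNIV)

lemma measure_poisson_UNIV: "Y > 0 \<Longrightarrow> measure (poisson Y) UNIV = 1"
  by (simp add: measure_def emeasure_poisson_UNIV)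

lemma integral_poisson_const [simp]: "Y > 0 \<Longrightarrow> (LINT u|poisson Y. (c::real)) = c"
  by (simp add: measure_poisson_UNIV)

lemma integrable_poisson_bounded:
  fixes f :: "real \<Rightarrow> real"
  assumes "Y > 0" "f \<in> borel_measurable borel" "\<And>u. \<bar>u\<bar> \<le> pi \<Longrightarrow> \<bar>f u\<bar> \<le> B"
  shows "integrable (poisson Y) f"
proof -
  interpret finite_measure "poisson Y" using assms(1) by (rule finite_measure_poisson)
  have "AE u in poisson Y. norm (f u) \<le> B"
    unfolding poisson_def using assms poisson_kernel_pos[OF assms(1)]
    by (subst AE_density) (auto simp: indicator_def)
  thus ?thesis using assms by (intro integrable_const_bound) auto
qed

lemma AE_poisson: "(\<And>u. \<bar>u\<bar> \<le> pi \<Longrightarrow> Q u) \<Longrightarrow> {u. Q u} \<in> sets borel \<Longrightarrow> AE u in poisson Y. Q u"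
  unfolding poisson_def by (subst AE_density) (auto simp: indicator_def)

lemma integral_poisson_continuous:
  fixes f :: "real \<Rightarrow> real"
  assumes "Y > 0" "continuous_on UNIV f"
  shows "integral\<^sup>L (poisson Y) f = integral {-pi..pi} (\<lambda>u. poisson_kernel Y u * f u)"
proof -
  have [measurable]: "f \<in> borel_measurable borel"
    using assms(2) by (rule borel_measurable_continuous_onI)
  have "integral\<^sup>L (poisson Y) f = (LINT u|lborel. (indicator {-pi..pi} u * poisson_kernel Y u) *\<^sub>R f u)"
    unfolding poisson_def using poisson_kernel_pos[OF assms(1)]
    by (intro integral_density) (auto simp: indicator_def less_imp_le)
  also have "\<dots> = (LINT u:{-pi..pi}|lborel. poisson_kernel Y u * f u)"
    by (simp add: set_lebesgue_integral_def mult.assoc)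
  also have "\<dots> = integral {-pi..pi} (\<lambda>u. poisson_kernel Y u * f u)"
    unfolding set_integrable_def using assms
    by (intro set_borel_integral_eq_integral borel_integrable_compact[folded set_integrable_def] continuous_on_mult
          continuous_on_poisson_kernel continuous_on_id continuous_on_subset[OF assms(2)]) auto
  finally show ?thesis .
qed

lemma integrable_poisson_continuous:
  fixes f :: "real \<Rightarrow> real"
  assumes "Y > 0" "continuous_on UNIV f"
  shows "integrable (poisson Y) f"
proof -
  have "bounded (f ` {-pi..pi})"
    by (intro compact_imp_bounded compact_continuous_image continuous_on_subset[OF assms(2)]) auto
  then obtain B where "\<forall>x\<in>f ` {-pi..pi}. norm x \<le> B"
    unfolding bounded_iff by blast
  thus ?thesis
    using assms by (intro integrable_poisson_bounded[of Y f B] borel_measurable_continuous_onI)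
      (auto simp: abs_le_iff minus_le_iff)
qed

text \<open>For \<open>norm a > 1\<close> the function \<open>ln \<bar>z - a\<bar>\<close> is
  harmonic beyond the closed unit disc: after rotation by \<open>t\<close> it is a constant plus the
  real part of \<open>Ln (1 - c z)\<close>. Hence its Poisson mean is its value at radius
  \<open>1 / (1 + Y)\<close>.\<close>

lemma integral_poisson_ln:
  assumes "Y > 0" "norm a > 1"
  shows "(LINT u|poisson Y. ln (norm (cis (t + u) - a))) = ln (norm (of_real (1 / (1 + Y)) * cis t - a))"
proof -
  define c where "c = cis t / a"
  have a0: "a \<noteq> 0" using assms by auto
  have c: "norm c < 1" using assms by (simp add: c_def norm_divide divide_less_eq)
  \<comment> \<open>Any radius strictly between 1 and the pole \<open>1 / \<bar>c\<bar>\<close>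
    would do; this choice also makes sense for \<open>c = 0\<close>.\<close>
  define R where "R = 2 / (1 + norm c)"
  have R: "R > 1" using c by (auto simp: R_def divide_simps add_pos_nonneg)
  have cz: "norm (c * z) < 1" if "norm z < R" for z
  proof (cases "c = 0")
    case False
    have "norm (c * z) < norm c * R" using that False by (simp add: norm_mult)
    also have "\<dots> \<le> 1" using c by (auto simp: R_def divide_simps add_pos_nonneg)
    finally show ?thesis .
  qed auto
  define r where "r = 1 / (1 + Y)"
  have r: "0 < r" "r < 1" using assms by (auto simp: r_def)
  have re: "Re (1 - c * z) > 0" if "norm z < R" for z
    using cz[OF that] abs_Re_le_cmod[of "c * z"] by simp
  have "(\<lambda>z. Ln (1 - c * z)) holomorphic_on ball 0 R"
    using re by (intro holomorphic_intros) (fastforce simp: complex_nonpos_Reals_iff)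
  from has_integral_Re[OF Poisson_formula[OF assms(1) R this]]
  have 1: "((\<lambda>u. poisson_kernel Y u * Re (Ln (1 - c * cis u))) has_integral Re (Ln (1 - c * of_real r))) {-pi..pi}"
    by (simp add: r_def)
  have Ln: "ln (norm (z * cis t - a)) = ln (norm a) + Re (Ln (1 - c * z))" if "norm z < R" for z
  proof -
    have nz: "1 - c * z \<noteq> 0" using re[OF that] by (metis less_irrefl zero_complex.simps(1))
    have "norm (z * cis t - a) = norm a * norm (1 - c * z)"
    proof -
      have "a * (1 - c * z) = - (z * cis t - a)" using a0 by (simp add: c_def algebra_simps)
      thus ?thesis by (metis norm_minus_cancel norm_mult)
    qed
    thus ?thesis using nz a0 by (simp add: ln_mult)
  qed
  have e: "cis (t + u) = cis u * cis t" for u by (simp add: cis_mult add.commute)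
  have nz: "cis (t + u) - a \<noteq> 0" for u using assms by auto
  have "(LINT u|poisson Y. ln (norm (cis (t + u) - a)))
      = integral {-pi..pi} (\<lambda>u. poisson_kernel Y u * ln (norm (cis (t + u) - a)))"
    using assms nz by (intro integral_poisson_continuous continuous_intros) auto
  also have "(\<lambda>u. poisson_kernel Y u * ln (norm (cis (t + u) - a)))
      = (\<lambda>u. poisson_kernel Y u * ln (norm a) + poisson_kernel Y u * Re (Ln (1 - c * cis u)))"
    unfolding e using Ln R by (auto simp: algebra_simps)
  also have "integral {-pi..pi} \<dots> = 1 * ln (norm a) + Re (Ln (1 - c * of_real r))"
    by (intro integral_unique has_integral_add has_integral_mult_left has_integral_poisson_kernel 1 assms)
  also have "\<dots> = ln (norm (of_real r * cis t - a))"
    using Ln[of "of_real r"] r R by simp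
  finally show ?thesis by (simp add: r_def)
qed

text \<open>The conjugate version, for the factor \<open>exp (- \<i> z) - a\<close> that occurs
  beside \<open>exp (\<i> z) - a\<close> in the factorization of \<open>cos z - x\<close>.\<close>

lemma integral_poisson_ln_minus:
  assumes "Y > 0" "norm a > 1"
  shows "(LINT u|poisson Y. ln (norm (cis (- t - u) - a))) = ln (norm (of_real (1 / (1 + Y)) * cis (-t) - a))"
proof -
  have *: "norm (cis (-x) * b - a) = norm (cis x * cnj b - cnj a)" for x b
  proof -
    have "cis (-x) * b - a = cnj (cis x * cnj b - cnj a)" by (simp add: cis_cnj)
    thus ?thesis by (metis complex_mod_cnj)
  qed
  have "norm (cis (- t - u) - a) = norm (cis (t + u) - cnj a)" for u
    using *[of "t + u" 1] by simp
  moreover have "norm (of_real (1 / (1 + Y)) * cis (-t) - a) = norm (of_real (1 / (1 + Y)) * cis t - cnj a)"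
    using *[of t "of_real (1 / (1 + Y))"] by (simp add: mult.commute)
  ultimately show ?thesis using integral_poisson_ln[of Y "cnj a" t] assms by simp
qed

text \<open>The denominator is the squared distance from \<open>cis u\<close> to the exterior point
  \<open>1 + Y\<close>, divided by \<open>Y\<^sup>2\<close>, so its logarithm is covered by
  \<open>integral_poisson_ln\<close>. The value stays below \<open>2 ln 2\<close>, which makes
  \<open>ln (poisson_denom Y u)\<close> the natural majorant for logarithmic growth in
  \<open>u / Y\<close>.\<close>

lemma integral_poisson_ln_poisson_denom:
  assumes "Y > 0"
  shows "integrable (poisson Y) (\<lambda>u. ln (poisson_denom Y u))"
    and "(LINT u|poisson Y. ln (poisson_denom Y u)) = 2 * ln ((2 + Y) / (1 + Y))"
proof -
  interpret finite_measure "poisson Y" using assms(1) by (rule finite_measure_poisson)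
  have poisson_denom: "poisson_denom Y u = (norm (cis (0 + u) - of_real (1 + Y)) / Y)\<^sup>2" for u
  proof -
    have c: "cos u = 1 - 2 * (sin (u/2))\<^sup>2" using cos_double_sin[of "u/2"] by simp
    have "(norm (cis u - of_real (1 + Y)))\<^sup>2 = (cos u)\<^sup>2 + (sin u)\<^sup>2 - 2 * (1 + Y) * cos u + (1 + Y)\<^sup>2"
      unfolding cmod_power2 by (simp add: algebra_simps power2_eq_square)
    also have "\<dots> = 1 - 2 * (1 + Y) * (1 - 2 * (sin (u/2))\<^sup>2) + (1 + Y)\<^sup>2"
      by (simp only: sin_cos_squared_add2 c[symmetric])
    finally have "(norm (cis u - of_real (1 + Y)))\<^sup>2 = Y\<^sup>2 + 4 * (1 + Y) * (sin (u/2))\<^sup>2"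
      by (simp add: algebra_simps power2_eq_square)
    thus ?thesis using assms by (simp add: poisson_denom_def power_divide field_simps)
  qed
  have nz: "cis (0 + u) - of_real (1 + Y) \<noteq> 0" for u
    using assms by (metis abs_of_pos add_pos_pos eq_iff_diff_eq_0 less_add_same_cancel1 less_irrefl norm_cis norm_of_real zero_less_one)
  have ln_poisson_denom: "ln (poisson_denom Y u) = 2 * ln (norm (cis (0 + u) - of_real (1 + Y))) - 2 * ln Y" for u
    unfolding poisson_denom using nz[of u] assms by (simp add: ln_realpow ln_div)
  have int: "integrable (poisson Y) (\<lambda>u. ln (norm (cis (0 + u) - of_real (1 + Y))))"
    using nz by (intro integrable_poisson_continuous assms continuous_intros) auto
  show "integrable (poisson Y) (\<lambda>u. ln (poisson_denom Y u))"
    unfolding ln_poisson_denom using int by simp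
  have "(LINT u|poisson Y. ln (poisson_denom Y u)) = 2 * ln (norm (of_real (1 / (1 + Y)) * cis 0 - of_real (1 + Y))) - 2 * ln Y"
  proof -
    have "norm (complex_of_real (1 + Y)) > 1" using assms by (simp only: norm_of_real)
    thus ?thesis unfolding ln_poisson_denom
      using int integral_poisson_ln[of Y "of_real (1 + Y)" 0] assms by (simp add: measure_poisson_UNIV)
  qed
  also have "norm (of_real (1 / (1 + Y)) * cis 0 - complex_of_real (1 + Y)) = (2 + Y) / (1 + Y) * Y"
  proof -
    have "of_real (1 / (1 + Y)) * cis 0 - complex_of_real (1 + Y) = of_real (1 / (1 + Y) - (1 + Y))"
      by simp
    hence "norm (of_real (1 / (1 + Y)) * cis 0 - complex_of_real (1 + Y)) = \<bar>1 / (1 + Y) - (1 + Y)\<bar>"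
      by (metis norm_of_real)
    also have "1 / (1 + Y) - (1 + Y) = - ((2 + Y) / (1 + Y) * Y)"
      using assms by (simp add: field_simps)
    also have "\<bar>\<dots>\<bar> = (2 + Y) / (1 + Y) * Y" using assms by (simp only: abs_minus_cancel) simp
    finally show ?thesis .
  qed
  also have "2 * ln ((2 + Y) / (1 + Y) * Y) - 2 * ln Y = 2 * ln ((2 + Y) / (1 + Y))"
    using assms by (subst ln_mult_pos) auto
  finally show "(LINT u|poisson Y. ln (poisson_denom Y u)) = 2 * ln ((2 + Y) / (1 + Y))" .
qed

section \<open>Weighted subharmonicity\<close>

text \<open>Moves a point of the annulus \<open>1/R \<le> \<rho> \<le> R\<close> radially to the
  inner radius \<open>1/R\<close>, where the Poisson formula evaluates
  \<open>ln \<bar>z - a\<bar>\<close>. The price is one factor \<open>R\<close>, because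
  \<open>a\<close> lies outside the open disc.\<close>

lemma norm_diff_dilate:
  fixes a w :: complex
  assumes "norm a \<ge> 1" "norm w = 1" "1 / R \<le> \<rho>" "\<rho> \<le> R" "R > 1"
  shows "norm (of_real \<rho> * w - a) \<le> R * norm (of_real (1 / R) * w - a)"
proof -
  define b where "b = a * cnj w"
  define A where "A = norm a"
  define x where "x = Re b"
  have A: "A \<ge> 1" "norm b = A" using assms by (auto simp: A_def b_def norm_mult)
  have x: "x \<le> A" using complex_Re_le_cmod[of b] A by (simp add: x_def)
  have sq: "(norm (of_real s * w - a))\<^sup>2 = s\<^sup>2 - 2 * s * x + A\<^sup>2" for s :: real
  proof -
    have ww: "w * cnj w = 1" using assms(2) complex_norm_square[of w] by simp
    have "norm (of_real s * w - a) = norm ((of_real s * w - a) * cnj w)"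
      using assms by (simp add: norm_mult)
    also have "(of_real s * w - a) * cnj w = of_real s - b"
      using ww by (simp add: b_def algebra_simps)
    finally have "norm (of_real s * w - a) = norm (of_real s - b)" .
    moreover have "(norm b)\<^sup>2 = (Re b)\<^sup>2 + (Im b)\<^sup>2" by (rule cmod_power2)
    moreover have "(norm (of_real s - b))\<^sup>2 = (s - Re b)\<^sup>2 + (Im b)\<^sup>2"
      by (simp add: cmod_power2)
    ultimately show ?thesis using A by (simp add: x_def algebra_simps power2_eq_square)
  qed
  have 1: "A * (R - 1) - 1 + \<rho> \<ge> 0"
  proof -
    have "1 * (R - 1) \<le> A * (R - 1)" using assms A by (intro mult_right_mono) auto
    moreover have "R + 1 / R \<ge> 2"
      using assms(5) sum_squares_ge_zero[of "R - 1" 0] by (simp add: field_simps power2_eq_square)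
    ultimately have "1 - 1 / R \<le> A * (R - 1)" by simp
    thus ?thesis using assms(3) by simp
  qed
  have 2: "A * (R + 1) - 1 - \<rho> \<ge> 0"
  proof -
    have "1 * (R + 1) \<le> A * (R + 1)" using assms A by (intro mult_right_mono) auto
    hence "1 + R \<le> A * (R + 1)" by simp
    thus ?thesis using assms(4) by simp
  qed
  \<comment> \<open>If \<open>a\<close> is a positive multiple of \<open>w\<close>, the claim
    compares \<open>(R A - 1)\<^sup>2\<close> with \<open>(A - \<rho>)\<^sup>2\<close>, and the
    product is this difference of squares. The second summand accounts for the other
    directions.\<close>
  have "0 \<le> (A * (R - 1) - 1 + \<rho>) * (A * (R + 1) - 1 - \<rho>) + 2 * (A - x) * (R - \<rho>)"
    using mult_nonneg_nonneg[OF 1 2] mult_nonneg_nonneg[of "A - x" "R - \<rho>"] x assms(4)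
    by (simp add: mult.assoc)
  also have "\<dots> = R\<^sup>2 * A\<^sup>2 - A\<^sup>2 - 2 * x * (R - \<rho>) + 1 - \<rho>\<^sup>2"
    by (simp add: algebra_simps power2_eq_square)
  also have "\<dots> = (1 - 2 * R * x + R\<^sup>2 * A\<^sup>2) - (norm (of_real \<rho> * w - a))\<^sup>2"
    unfolding sq by (simp add: algebra_simps power2_eq_square)
  also have "1 - 2 * R * x + R\<^sup>2 * A\<^sup>2 = R\<^sup>2 * (norm (of_real (1 / R) * w - a))\<^sup>2"
    unfolding sq using assms(5) by (simp add: field_simps power2_eq_square)
  finally have "(norm (of_real \<rho> * w - a))\<^sup>2 \<le> (R * norm (of_real (1 / R) * w - a))\<^sup>2"
    by (simp add: power_mult_distrib)
  thus ?thesis by (rule power2_le_imp_le) (use assms in auto)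
qed

text \<open>The Joukowski map: \<open>x = (a + 1/a) / 2\<close> with \<open>a\<close> the preimage
  outside the unit disc. Choosing the same exterior \<open>a\<close> for both exponentials lets the
  exterior Poisson formula handle both factors.\<close>

lemma cos_minus_factorization:
  assumes "Im x \<noteq> 0"
  obtains a where "norm a > 1" "\<And>z. cos z - x = - (exp (\<i> * z) - a) * (exp (- \<i> * z) - a) / (2 * a)"
proof -
  define d where "d = csqrt (x\<^sup>2 - 1)"
  have d2: "d\<^sup>2 = x\<^sup>2 - 1" by (simp add: d_def)
  have prod: "(x + d) * (x - d) = 1" using d2 by (simp add: algebra_simps power2_eq_square)
  \<comment> \<open>On the unit circle the reciprocal is the conjugate, so \<open>2 x\<close>, the
    sum of \<open>x + d\<close> and its reciprocal, would be real.\<close>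
  have n1: "norm (x + d) \<noteq> 1"
  proof
    assume *: "norm (x + d) = 1"
    have "cnj (x + d) * (x + d) = 1"
      using * complex_norm_square[of "x + d"] by (simp add: mult.commute)
    hence "x - d = cnj (x + d)"
      using prod by (metis mult.commute mult_cancel_left mult_zero_right zero_neq_one)
    moreover have "2 * x = (x + d) + (x - d)" by simp
    ultimately have "2 * x = (x + d) + cnj (x + d)" by simp
    hence "Im (2 * x) = 0" by (metis complex_add_cnj Im_complex_of_real)
    thus False using assms by simp
  qed
  have n: "norm (x + d) * norm (x - d) = 1" using prod by (metis norm_mult norm_one)
  have "norm (x + d) > 1 \<or> norm (x - d) > 1"
  proof (rule ccontr)
    assume "\<not> (norm (x + d) > 1 \<or> norm (x - d) > 1)"
    hence "norm (x + d) < 1" "norm (x - d) \<le> 1" using n1 by auto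
    hence "norm (x + d) * norm (x - d) < 1 * 1"
      by (metis mult.right_neutral mult_left_le norm_ge_zero order_le_less_trans)
    thus False using n by simp
  qed
  then obtain a where a: "norm a > 1" "a = x + d \<or> a = x - d" by auto
  hence q: "a\<^sup>2 + 1 = 2 * x * a" using d2 by (auto simp: algebra_simps power2_eq_square)
  have a0: "a \<noteq> 0" using a by auto
  show ?thesis
  proof (rule that[OF a(1)])
    fix z
    have e: "exp (\<i> * z) * exp (- \<i> * z) = 1" by (simp add: exp_minus_inverse)
    have "- (exp (\<i> * z) - a) * (exp (- \<i> * z) - a)
       = a * (exp (\<i> * z) + exp (- \<i> * z)) - (a\<^sup>2 + exp (\<i> * z) * exp (- \<i> * z))"
      by (simp add: algebra_simps power2_eq_square)
    also have "\<dots> = a * (2 * cos z) - 2 * x * a"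
      unfolding e q by (simp add: cos_exp_eq)
    finally show "cos z - x = - (exp (\<i> * z) - a) * (exp (- \<i> * z) - a) / (2 * a)"
      using a0 by (simp add: field_simps)
  qed
qed

text \<open>Both exponentials have modulus between \<open>1 / (1 + Y)\<close> and
  \<open>1 + Y\<close>. Moving each to radius \<open>1 / (1 + Y)\<close> costs a factor
  \<open>1 + Y\<close>, and there the logarithm is exactly a Poisson mean along the real
  axis.\<close>

lemma norm_cos_minus_le:
  assumes "Y > 0" "\<bar>Im z\<bar> \<le> ln (1 + Y)" "Im x \<noteq> 0"
  shows "norm (cos z - x) \<le> (1 + Y)\<^sup>2
           * exp (LINT u|poisson Y. ln (norm (of_real (cos (Re z + u)) - x)))"
proof -
  obtain a where a: "norm a > 1"
    and f: "\<And>z. cos z - x = - (exp (\<i> * z) - a) * (exp (- \<i> * z) - a) / (2 * a)"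
    using cos_minus_factorization[OF assms(3)] by metis
  define t where "t = Re z"
  define r where "r = 1 / (1 + Y)"
  have c: "exp (\<i> * of_real s) = cis s" for s :: real by (simp add: cis_conv_exp)
  have c': "exp (- \<i> * of_real s) = cis (- s)" for s :: real by (simp add: cis_conv_exp)
  have real: "norm (of_real (cos s) - x) = norm (cis s - a) * norm (cis (-s) - a) / (2 * norm a)"
    for s :: real
    using f[of "of_real s"] unfolding c c' by (simp add: norm_mult norm_divide cos_of_real norm_minus_commute)
  have nz: "cis s - a \<noteq> 0" for s using a by auto
  have nz': "of_real r * cis s - a \<noteq> 0" for s
  proof
    assume "of_real r * cis s - a = 0"
    hence "a = of_real r * cis s" by simp
    hence "norm a = r" using assms(1) by (simp only: norm_mult norm_of_real norm_cis) (simp add: r_def)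
    thus False using a assms by (simp add: r_def)
  qed
  have ez: "exp (\<i> * z) = of_real (exp (- Im z)) * cis t"
    by (simp add: complex_eq_iff t_def exp_eq_polar cis.ctr)
  have ez': "exp (- \<i> * z) = of_real (exp (Im z)) * cis (-t)"
    by (simp add: complex_eq_iff t_def exp_eq_polar cis.ctr)
  have rho: "1 / (1 + Y) \<le> exp s" "exp s \<le> 1 + Y" if "\<bar>s\<bar> \<le> ln (1 + Y)" for s
  proof -
    have "exp s \<le> exp (ln (1 + Y))" "exp (- ln (1 + Y)) \<le> exp s" using that by auto
    thus "1 / (1 + Y) \<le> exp s" "exp s \<le> 1 + Y"
      using assms by (auto simp: exp_minus inverse_eq_divide)
  qed
  have b1: "norm (exp (\<i> * z) - a) \<le> (1 + Y) * norm (of_real r * cis t - a)"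
    unfolding ez r_def using a rho[of "- Im z"] assms by (intro norm_diff_dilate) auto
  have b2: "norm (exp (- \<i> * z) - a) \<le> (1 + Y) * norm (of_real r * cis (-t) - a)"
    unfolding ez' r_def using a rho[of "Im z"] assms by (intro norm_diff_dilate) auto
  have i1: "integrable (poisson Y) (\<lambda>u. ln (norm (cis (t + u) - a)))"
    and i2: "integrable (poisson Y) (\<lambda>u. ln (norm (cis (- t - u) - a)))"
    using nz by (auto intro!: integrable_poisson_continuous continuous_intros assms)
  have a0: "norm a > 0" using a by linarith
  interpret finite_measure "poisson Y" using assms(1) by (rule finite_measure_poisson)
  have "(LINT u|poisson Y. ln (norm (of_real (cos (t + u)) - x)))
     = (LINT u|poisson Y. ln (norm (cis (t + u) - a)) + ln (norm (cis (- t - u) - a)) - ln (2 * norm a))"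
  proof (intro Bochner_Integration.integral_cong refl)
    fix u
    have e: "- (t + u) = - t - u" by simp
    show "ln (norm (of_real (cos (t + u)) - x)) =
       ln (norm (cis (t + u) - a)) + ln (norm (cis (- t - u) - a)) - ln (2 * norm a)"
      unfolding real e using nz[of "t+u"] nz[of "-t-u"] a0
      by (subst ln_divide_pos, auto simp: ln_mult_pos)
  qed
  also have "\<dots> = ln (norm (of_real r * cis t - a)) + ln (norm (of_real r * cis (-t) - a)) - ln (2 * norm a)"
    using i1 i2 integral_poisson_ln[OF assms(1) a, of t] integral_poisson_ln_minus[OF assms(1) a, of t] assms(1)
    by (simp add: measure_poisson_UNIV r_def)
  also have "\<dots> = ln (norm (of_real r * cis t - a) * norm (of_real r * cis (-t) - a) / (2 * norm a))"
    using nz'[of t] nz'[of "-t"] a0 by (subst ln_divide_pos, auto simp: ln_mult_pos)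
  finally have E: "(LINT u|poisson Y. ln (norm (of_real (cos (t + u)) - x)))
     = ln (norm (of_real r * cis t - a) * norm (of_real r * cis (-t) - a) / (2 * norm a))"
    (is "_ = ln ?Q") .
  have Q: "?Q > 0" using nz'[of t] nz'[of "-t"] a0 by simp
  have "norm (cos z - x) \<le> (1 + Y)\<^sup>2 * ?Q"
  proof -
    have "norm (cos z - x) = norm (exp (\<i> * z) - a) * norm (exp (- \<i> * z) - a) / (2 * norm a)"
      unfolding f by (simp add: norm_mult norm_divide norm_minus_commute)
    also have "\<dots> \<le> ((1 + Y) * norm (of_real r * cis t - a)) *
       ((1 + Y) * norm (of_real r * cis (-t) - a)) / (2 * norm a)"
      using a0 assms by (intro divide_right_mono mult_mono b1 b2) auto
    finally show ?thesis by (simp add: power2_eq_square mult_ac)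
  qed
  thus ?thesis using E Q by (simp add: t_def)
qed

text \<open>The bound for a single root is multiplicative, since \<open>exp\<close> of a mean
  logarithm turns products into products. Real roots are excluded here because the logarithms must
  be bounded.\<close>

lemma norm_poly_cos_le:
  fixes P :: "complex poly"
  assumes "Y > 0" "\<bar>Im z\<bar> \<le> ln (1 + Y)" "P \<noteq> 0" and nz: "\<And>x. Im x = 0 \<Longrightarrow> poly P x \<noteq> 0"
  shows "norm (poly P (cos z)) \<le> (1 + Y) ^ (2 * degree P)
           * exp (LINT u|poisson Y. ln (norm (pcos P (Re z + u))))"
proof -
  interpret finite_measure "poisson Y" using assms(1) by (rule finite_measure_poisson)
  obtain A where A: "size A = degree P" "P = smult (lead_coeff P) (\<Prod>x\<in>#A. [:-x, 1:])"
    using alg_closed_imp_factorization[OF assms(3)] by metis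
  have cont: "continuous_on UNIV (\<lambda>u. pcos Q (t + u))" for Q :: "complex poly" and t
    by (intro continuous_intros)
  define Pr where "Pr = (\<lambda>A. \<Prod>x\<in>#A. [:-x, 1::complex:])"
  have main: "norm (poly (Pr B) (cos z)) \<le> (1 + Y) ^ (2 * size B)
           * exp (LINT u|poisson Y. ln (norm (poly (Pr B) (of_real (cos (Re z + u))))))"
      and nzB: "\<And>x. Im x = 0 \<Longrightarrow> poly (Pr B) x \<noteq> 0"
    if "\<forall>x\<in>#B. Im x \<noteq> 0" for B
  proof -
    show "\<And>x. Im x = 0 \<Longrightarrow> poly (Pr B) x \<noteq> 0"
      using that by (induction B) (auto simp: Pr_def)
    show "norm (poly (Pr B) (cos z)) \<le> (1 + Y) ^ (2 * size B)
           * exp (LINT u|poisson Y. ln (norm (poly (Pr B) (of_real (cos (Re z + u))))))"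
      using that
    proof (induction B)
      case empty
      thus ?case by (simp add: Pr_def)
    next
      case (add x B)
      have nzB: "\<And>x. Im x = 0 \<Longrightarrow> poly (Pr B) x \<noteq> 0"
        using add.prems by (induction B) (auto simp: Pr_def)
      have p: "poly (Pr (add_mset x B)) y = (y - x) * poly (Pr B) y" for y
        by (simp add: Pr_def algebra_simps)
      have x: "of_real s - x \<noteq> 0" for s using add.prems by auto
      have i1: "integrable (poisson Y) (\<lambda>u. ln (norm (of_real (cos (Re z + u)) - x)))"
       and i2: "integrable (poisson Y) (\<lambda>u. ln (norm (poly (Pr B) (of_real (cos (Re z + u))))))"
        using x nzB by (auto intro!: integrable_poisson_continuous assms continuous_intros)
      have "(LINT u|poisson Y. ln (norm (poly (Pr (add_mset x B)) (of_real (cos (Re z + u))))))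
         = (LINT u|poisson Y. ln (norm (of_real (cos (Re z + u)) - x)) + ln (norm (poly (Pr B) (of_real (cos (Re z + u))))))"
        unfolding p norm_mult using x nzB by (subst ln_mult_pos) auto
      also have "\<dots> = (LINT u|poisson Y. ln (norm (of_real (cos (Re z + u)) - x)))
          + (LINT u|poisson Y. ln (norm (poly (Pr B) (of_real (cos (Re z + u))))))"
        using i1 i2 by simp
      finally have E: "exp (LINT u|poisson Y. ln (norm (poly (Pr (add_mset x B)) (of_real (cos (Re z + u))))))
          = exp (LINT u|poisson Y. ln (norm (of_real (cos (Re z + u)) - x)))
          * exp (LINT u|poisson Y. ln (norm (poly (Pr B) (of_real (cos (Re z + u))))))"
        by (simp add: exp_add)
      have "norm (poly (Pr (add_mset x B)) (cos z)) \<le>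
         ((1 + Y)\<^sup>2 * exp (LINT u|poisson Y. ln (norm (of_real (cos (Re z + u)) - x)))) *
         ((1 + Y) ^ (2 * size B) * exp (LINT u|poisson Y. ln (norm (poly (Pr B) (of_real (cos (Re z + u)))))))"
        unfolding p norm_mult using add assms by (intro mult_mono norm_cos_minus_le) auto
      thus ?case unfolding E by (simp add: power_add mult_ac power2_eq_square)
    qed
  qed
  have im: "\<forall>x\<in>#A. Im x \<noteq> 0"
  proof
    fix x assume "x \<in># A"
    then obtain B where "A = add_mset x B" by (metis mset_add)
    hence "poly (\<Prod>x\<in>#A. [:-x, 1:]) x = 0" by simp
    hence "poly P x = 0" using A(2) by (metis mult_zero_right poly_smult)
    thus "Im x \<noteq> 0" using nz by blast
  qed
  have p: "poly P y = lead_coeff P * poly (Pr A) y" for y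
    using A(2) unfolding Pr_def by (metis poly_smult)
  have lc: "norm (lead_coeff P) > 0" using assms by simp
  have i2: "integrable (poisson Y) (\<lambda>u. ln (norm (poly (Pr A) (of_real (cos (Re z + u))))))"
    using nzB[OF im] by (auto intro!: integrable_poisson_continuous assms continuous_intros)
  have "(LINT u|poisson Y. ln (norm (pcos P (Re z + u))))
     = (LINT u|poisson Y. ln (norm (lead_coeff P)) + ln (norm (poly (Pr A) (of_real (cos (Re z + u))))))"
    unfolding p norm_mult using nzB[OF im] lc by (subst ln_mult_pos) auto
  also have "\<dots> = ln (norm (lead_coeff P)) + (LINT u|poisson Y. ln (norm (poly (Pr A) (of_real (cos (Re z + u))))))"
    using i2 assms(1) by (simp add: measure_poisson_UNIV)
  finally have E: "exp (LINT u|poisson Y. ln (norm (pcos P (Re z + u))))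
     = norm (lead_coeff P) * exp (LINT u|poisson Y. ln (norm (poly (Pr A) (of_real (cos (Re z + u))))))"
    using lc by (simp add: exp_add)
  show ?thesis
    unfolding E using main[OF im] lc A(1) by (simp add: p norm_mult mult_ac)
qed

lemma weighted_subharmonic_nonreal_roots:
  fixes P :: "complex poly"
  assumes "Y > 0" "\<bar>Im z\<bar> \<le> ln (1 + Y)" "p > 0" "degree P \<le> n"
    and nz: "\<And>x. Im x = 0 \<Longrightarrow> poly P x \<noteq> 0"
    and psi: "\<psi> \<in> borel_measurable borel" "\<And>u. \<bar>\<psi> u\<bar> \<le> B"
  shows "norm (poly P (cos z)) powr p \<le> exp (2 * real n * p * Y) *
           exp (LINT u|poisson Y. \<psi> (Re z + u)) *
           (LINT u|poisson Y. norm (pcos P (Re z + u)) powr p * exp (- \<psi> (Re z + u)))"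
proof -
  interpret finite_measure "poisson Y" using assms(1) by (rule finite_measure_poisson)
  note [measurable] = psi(1)
  define f where "f = (\<lambda>u. norm (pcos P (Re z + u)))"
  have f: "f u > 0" for u unfolding f_def using nz by simp
  have cf: "continuous_on UNIV f"
    unfolding f_def by (intro continuous_intros)
  have [measurable]: "f \<in> borel_measurable borel" using cf by (rule borel_measurable_continuous_onI)
  have "P \<noteq> 0" using nz[of 0] by auto
  have cl: "continuous_on UNIV (\<lambda>u. ln (f u))" using f by (auto intro!: continuous_intros cf simp: less_imp_neq[symmetric])
  have il: "integrable (poisson Y) (\<lambda>u. ln (f u))"
    using cl assms(1) by (intro integrable_poisson_continuous) auto
  have ipsi: "integrable (poisson Y) (\<lambda>u. \<psi> (Re z + u))"
    using assms by (intro integrable_poisson_bounded[where B=B]) auto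
  have ig: "integrable (poisson Y) (\<lambda>u. f u powr p * exp (- \<psi> (Re z + u)))"
  proof (rule Bochner_Integration.integrable_bound)
    show "integrable (poisson Y) (\<lambda>u. f u powr p * exp B)"
      using assms(1) f by (intro integrable_poisson_continuous continuous_intros cf) (auto simp: less_imp_neq[symmetric])
    have "f u powr p * exp (- \<psi> (Re z + u)) \<le> f u powr p * exp B" for u
      using psi(2)[of "Re z + u"] by (intro mult_left_mono) auto
    thus "AE x in poisson Y. norm (f x powr p * exp (- \<psi> (Re z + x))) \<le> norm (f x powr p * exp B)"
      by simp
  qed measurable
  \<comment> \<open>\<open>m\<close> is the mean of the exponent \<open>p ln f - \<psi>\<close>.
    Jensen's inequality for \<open>exp\<close> is proved by integrating its tangent line at
    \<open>m\<close>.\<close>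
  define m where "m = p * (LINT u|poisson Y. ln (f u)) - (LINT u|poisson Y. \<psi> (Re z + u))"
  have "exp m = (LINT u|poisson Y. exp m * (1 + ((p * ln (f u) - \<psi> (Re z + u)) - m)))"
    using il ipsi assms(1) by (simp add: measure_poisson_UNIV m_def)
  also have "\<dots> \<le> (LINT u|poisson Y. f u powr p * exp (- \<psi> (Re z + u)))"
  proof (rule integral_mono)
    fix u
    have "exp m * (1 + ((p * ln (f u) - \<psi> (Re z + u)) - m)) \<le> exp m * exp ((p * ln (f u) - \<psi> (Re z + u)) - m)"
      by (intro mult_left_mono exp_ge_add_one_self) auto
    also have "\<dots> = f u powr p * exp (- \<psi> (Re z + u))"
      using f[of u] by (simp add: powr_def exp_add[symmetric])
    finally show "exp m * (1 + ((p * ln (f u) - \<psi> (Re z + u)) - m)) \<le> f u powr p * exp (- \<psi> (Re z + u))" .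
  qed (use il ipsi ig in auto)
  finally have m: "exp m \<le> (LINT u|poisson Y. f u powr p * exp (- \<psi> (Re z + u)))" .
  have "norm (poly P (cos z)) \<le> (1 + Y) ^ (2 * degree P) * exp (LINT u|poisson Y. ln (f u))"
    unfolding f_def using assms \<open>P \<noteq> 0\<close> by (intro norm_poly_cos_le) auto
  also have "(1 + Y) ^ (2 * degree P) \<le> (exp Y) ^ (2 * n)"
  proof -
    have "(1 + Y) ^ (2 * degree P) \<le> (1 + Y) ^ (2 * n)"
      using assms by (intro power_increasing) auto
    also have "\<dots> \<le> (exp Y) ^ (2 * n)" using assms by (intro power_mono exp_ge_add_one_self) auto
    finally show ?thesis .
  qed
  also have "(exp Y) ^ (2 * n) = exp (2 * n * Y)" by (simp add: exp_of_nat_mult[symmetric])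
  finally have "norm (poly P (cos z)) \<le> exp (2 * n * Y + (LINT u|poisson Y. ln (f u)))"
    by (simp add: exp_add)
  hence "norm (poly P (cos z)) powr p \<le> exp (2 * n * Y + (LINT u|poisson Y. ln (f u))) powr p"
    using assms by (intro powr_mono2) auto
  also have "\<dots> = exp (2 * n * p * Y) * exp (LINT u|poisson Y. \<psi> (Re z + u)) * exp m"
    by (simp add: powr_def exp_add[symmetric] m_def algebra_simps)
  also have "\<dots> \<le> exp (2 * n * p * Y) * exp (LINT u|poisson Y. \<psi> (Re z + u)) *
      (LINT u|poisson Y. f u powr p * exp (- \<psi> (Re z + u)))"
    by (intro mult_left_mono m) auto
  finally show ?thesis by (simp add: f_def)
qed

text \<open>The bound is uniform in the shift so that it can dominate the limit that moves real
  roots back; with \<open>e = 0\<close> it serves as the plain bound for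
  \<open>\<bar>P (cos t)\<bar>\<close>.\<close>

lemma bounded_poly_cos_shift:
  fixes P :: "complex poly"
  obtains M where "M \<ge> 0" "\<And>u e. 0 \<le> e \<Longrightarrow> e \<le> 1 \<Longrightarrow> norm (poly P (of_real (cos u) + \<i> * of_real e)) \<le> M"
proof -
  have "bounded (poly P ` cball 0 2)"
    by (intro compact_imp_bounded compact_continuous_image continuous_intros) auto
  then obtain M where M: "\<forall>x\<in>poly P ` cball 0 2. norm x \<le> M" unfolding bounded_iff by blast
  have "norm (poly P (of_real (cos u) + \<i> * of_real e)) \<le> M" if "0 \<le> e" "e \<le> 1" for u e
  proof -
    have "norm (of_real (cos u) + \<i> * of_real e :: complex) \<le> norm (of_real (cos u) :: complex) + norm (\<i> * of_real e :: complex)"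
      by (rule norm_triangle_ineq)
    also have "\<dots> \<le> 2" using that abs_cos_le_one[of u] by (simp only: norm_mult norm_of_real norm_ii)
    finally show ?thesis using M by simp
  qed
  moreover from this[of 0 0] have "M \<ge> 0" by (meson norm_ge_zero order_trans zero_le_one order_refl)
  ultimately show ?thesis using that by blast
qed

lemma weighted_subharmonic:
  fixes P :: "complex poly"
  assumes "Y > 0" "\<bar>Im z\<bar> \<le> ln (1 + Y)" "p > 0" "degree P \<le> n"
    and psi: "\<psi> \<in> borel_measurable borel" "\<And>u. \<bar>\<psi> u\<bar> \<le> B"
  shows "norm (poly P (cos z)) powr p \<le> exp (2 * real n * p * Y) *
           exp (LINT u|poisson Y. \<psi> (Re z + u)) *
           (LINT u|poisson Y. norm (pcos P (Re z + u)) powr p * exp (- \<psi> (Re z + u)))"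
proof (cases "P = 0")
  case False
  interpret finite_measure "poisson Y" using assms(1) by (rule finite_measure_poisson)
  note [measurable] = psi(1)
  \<comment> \<open>Real roots of \<open>P\<close> make \<open>ln \<bar>f\<bar>\<close> unbounded; they are moved off the axis by a shift \<open>\<i> * e k\<close>.\<close>
  define e where "e = (\<lambda>k. 1 / real (Suc k))"
  have e: "0 \<le> e k" "e k \<le> 1" "e k > 0" for k by (auto simp: e_def)
  have e0: "e \<longlonglongrightarrow> 0" unfolding e_def using LIMSEQ_inverse_real_of_nat by (simp add: inverse_eq_divide)
  define Q where "Q = (\<lambda>k. pcompose P [:\<i> * of_real (e k), 1:])"
  have pQ: "poly (Q k) x = poly P (x + \<i> * of_real (e k))" for k x
    by (simp add: Q_def poly_pcompose add.commute)
  \<comment> \<open>A real root of \<open>Q k\<close> would be a root of \<open>P\<close> with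
    imaginary part \<open>e k\<close>. Only finitely many imaginary parts occur, and the positive
    null sequence \<open>e\<close> eventually avoids them.\<close>
  have "eventually (\<lambda>k. e k \<notin> Im ` {x. poly P x = 0}) sequentially"
  proof -
    define S where "S = Im ` {x. poly P x = 0} - {0}"
    have "finite S" using poly_roots_finite[OF False] by (simp add: S_def)
    hence "open (- S)" by (intro open_Compl finite_imp_closed)
    moreover have "0 \<in> - S" by (simp add: S_def)
    ultimately have "eventually (\<lambda>k. e k \<in> - S) sequentially" using e0 by (metis topological_tendstoD)
    thus ?thesis by eventually_elim (use e(3) in \<open>auto simp: S_def less_le\<close>)
  qed
  hence "eventually (\<lambda>k. norm (poly (Q k) (cos z)) powr p \<le> exp (2 * real n * p * Y) *
           exp (LINT u|poisson Y. \<psi> (Re z + u)) *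
           (LINT u|poisson Y. norm (poly (Q k) (of_real (cos (Re z + u)))) powr p * exp (- \<psi> (Re z + u)))) sequentially"
  proof eventually_elim
    case (elim k)
    have "poly (Q k) x \<noteq> 0" if "Im x = 0" for x
    proof
      assume "poly (Q k) x = 0"
      hence "Im (x + \<i> * of_real (e k)) \<in> Im ` {x. poly P x = 0}" unfolding pQ by blast
      thus False using elim that by simp
    qed
    moreover have "degree (Q k) \<le> n" using assms by (simp add: Q_def degree_pcompose)
    ultimately show ?case using assms by (intro weighted_subharmonic_nonreal_roots) auto
  qed
  moreover have lim: "(\<lambda>k. norm (poly (Q k) x) powr p) \<longlonglongrightarrow> norm (poly P x) powr p" for x
  proof -
    have "(\<lambda>k. poly P (x + \<i> * of_real (e k))) \<longlonglongrightarrow> poly P (x + \<i> * of_real 0)"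
      by (intro tendsto_intros isCont_tendsto_compose[of _ "poly P"] e0) auto
    thus ?thesis unfolding pQ using assms(3) by (intro tendsto_powr') (auto intro!: tendsto_norm)
  qed
  moreover have "(\<lambda>k. LINT u|poisson Y. norm (poly (Q k) (of_real (cos (Re z + u)))) powr p * exp (- \<psi> (Re z + u)))
     \<longlonglongrightarrow> (LINT u|poisson Y. norm (pcos P (Re z + u)) powr p * exp (- \<psi> (Re z + u)))"
  proof -
    obtain M where M: "M \<ge> 0"
      "\<And>u e. 0 \<le> e \<Longrightarrow> e \<le> 1 \<Longrightarrow> norm (poly P (of_real (cos u) + \<i> * of_real e)) \<le> M"
      using bounded_poly_cos_shift[of P] by blast
    have [measurable]: "(\<lambda>u. poly R (complex_of_real (cos (Re z + u)))) \<in> borel_measurable borel" for R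
      by (intro borel_measurable_continuous_onI continuous_intros)
    show ?thesis
    proof (rule integral_dominated_convergence[where w = "\<lambda>_. M powr p * exp B"])
      show "AE u in poisson Y. norm (norm (poly (Q k) (of_real (cos (Re z + u)))) powr p * exp (- \<psi> (Re z + u))) \<le> M powr p * exp B" for k
      proof (rule AE_I2)
        fix u
        have "norm (poly (Q k) (of_real (cos (Re z + u)))) powr p * exp (- \<psi> (Re z + u)) \<le> M powr p * exp B"
          using psi(2)[of "Re z + u"] M(2)[of "e k" "Re z + u"] e[of k] assms(3) unfolding pQ
          by (intro mult_mono powr_mono2) auto
        thus "norm (norm (poly (Q k) (of_real (cos (Re z + u)))) powr p * exp (- \<psi> (Re z + u))) \<le> M powr p * exp B"
          by simp
      qed
    qed (auto intro!: tendsto_intros lim)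
  qed
  hence "(\<lambda>k. exp (2 * real n * p * Y) * exp (LINT u|poisson Y. \<psi> (Re z + u)) *
      (LINT u|poisson Y. norm (poly (Q k) (of_real (cos (Re z + u)))) powr p * exp (- \<psi> (Re z + u))))
     \<longlonglongrightarrow> exp (2 * real n * p * Y) * exp (LINT u|poisson Y. \<psi> (Re z + u)) *
      (LINT u|poisson Y. norm (pcos P (Re z + u)) powr p * exp (- \<psi> (Re z + u)))"
    by (intro tendsto_intros)
  ultimately show ?thesis by (intro tendsto_le[OF sequentially_bot _ lim])
qed auto

section \<open>Size, symmetry and Harnack bounds for the Poisson kernel\<close>

lemma sin_ge_half:
  assumes "0 \<le> x" "x \<le> pi / 2"
  shows "sin x \<ge> x / 2"
proof (cases "x \<le> pi / 3")
  case True
  show ?thesis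
  proof (cases "x = 0")
    case False
    hence "0 < x" using assms by simp
    then obtain z where z: "0 < z" "z < x" "sin x - sin 0 = (x - 0) * cos z"
      using MVT2[of 0 x sin cos] by (auto intro: DERIV_sin)
    have "cos z \<ge> cos (pi / 3)"
      using z True pi_gt_zero by (intro cos_monotone_0_pi_le) auto
    hence "cos z \<ge> 1 / 2" by (simp add: cos_60)
    hence "x * cos z \<ge> x * (1 / 2)" using \<open>0 < x\<close> by (intro mult_left_mono) auto
    thus ?thesis using z by simp
  qed auto
next
  case False
  have "sin x \<ge> sin (pi / 3)"
    using False assms pi_gt_zero by (intro sin_monotone_2pi_le) auto
  moreover have "sqrt 3 / 2 \<ge> (1.7::real) / 2"
    by (intro divide_right_mono real_le_rsqrt) (auto simp: power2_eq_square)
  moreover have "x / 2 \<le> 0.8" using assms pi_less_4 pi_approx by simp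
  ultimately show ?thesis by (simp add: sin_60)
qed

lemma poisson_denom_ge:
  assumes "Y > 0" "\<bar>u\<bar> \<le> pi"
  shows "poisson_denom Y u \<ge> 1 + u\<^sup>2 / (4 * Y\<^sup>2)"
proof -
  have "\<bar>u\<bar> / 2 / 2 \<le> sin (\<bar>u\<bar> / 2)" using assms by (intro sin_ge_half) auto
  hence "(\<bar>u\<bar> / 2 / 2)\<^sup>2 \<le> (sin (\<bar>u\<bar> / 2))\<^sup>2" by (intro power_mono) auto
  also have "(sin (\<bar>u\<bar> / 2))\<^sup>2 = (sin (u / 2))\<^sup>2" by (cases "u \<ge> 0") auto
  finally have s: "u\<^sup>2 / 16 \<le> (sin (u / 2))\<^sup>2" by (simp add: power_divide)
  have "u\<^sup>2 / 4 \<le> 4 * 1 * (sin (u / 2))\<^sup>2" using s by simp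
  also have "\<dots> \<le> 4 * (1 + Y) * (sin (u / 2))\<^sup>2" using assms by (intro mult_right_mono) auto
  finally have "u\<^sup>2 / 4 / Y\<^sup>2 \<le> 4 * (1 + Y) * (sin (u / 2))\<^sup>2 / Y\<^sup>2"
    by (intro divide_right_mono) auto
  thus ?thesis by (simp add: poisson_denom_def)
qed

lemma poisson_kernel_le_poisson_denom:
  assumes "Y > 0" "Y \<le> 1"
  shows "poisson_kernel Y u \<le> 1 / (2 * Y) / poisson_denom Y u"
proof -
  have "poisson_kernel Y u = (2 + Y) / pi * (1 / (2 * Y * poisson_denom Y u))" by (simp add: poisson_kernel_def)
  also have "\<dots> \<le> 1 * (1 / (2 * Y * poisson_denom Y u))"
    using assms poisson_denom_ge_1[of Y u] pi_gt3 by (intro mult_right_mono) auto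
  finally show ?thesis by simp
qed

lemma poisson_kernel_le:
  assumes "Y > 0" "Y \<le> 1"
  shows "poisson_kernel Y u \<le> 1 / Y"
proof -
  have "1 / (2 * Y) / poisson_denom Y u \<le> 1 / (2 * Y) / 1"
    using poisson_denom_ge_1[OF assms(1), of u] assms by (intro divide_left_mono) auto
  also have "\<dots> \<le> 1 / Y" using assms by (simp add: field_simps)
  finally show ?thesis using poisson_kernel_le_poisson_denom[OF assms, of u] by simp
qed

lemma poisson_kernel_le_square:
  assumes "Y > 0" "Y \<le> 1" "\<bar>u\<bar> \<le> pi" "u \<noteq> 0"
  shows "poisson_kernel Y u \<le> 2 * Y / u\<^sup>2"
proof -
  have "u\<^sup>2 / (4 * Y\<^sup>2) \<le> poisson_denom Y u" using poisson_denom_ge[OF assms(1,3)] by simp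
  hence "1 / (2 * Y) / poisson_denom Y u \<le> 1 / (2 * Y) / (u\<^sup>2 / (4 * Y\<^sup>2))"
    using assms poisson_denom_ge_1[OF assms(1), of u] by (intro divide_left_mono mult_pos_pos) auto
  also have "\<dots> = 2 * Y / u\<^sup>2" using assms by (simp add: power2_eq_square)
  finally show ?thesis using poisson_kernel_le_poisson_denom[OF assms(1,2), of u] by simp
qed

lemma emeasure_poisson:
  "S \<in> sets borel \<Longrightarrow> emeasure (poisson Y) S
     = (\<integral>\<^sup>+ u. ennreal (indicator {-pi..pi} u * poisson_kernel Y u) * indicator S u \<partial>lborel)"
  unfolding poisson_def by (subst emeasure_density) auto

lemma measure_poisson_le_bound:
  assumes "Y > 0" and [measurable]: "S \<in> sets borel" and b: "\<And>u. \<bar>u\<bar> \<le> pi \<Longrightarrow> u \<in> S \<Longrightarrow> poisson_kernel Y u \<le> b" and "b \<ge> 0"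
  shows "measure (poisson Y) S \<le> b * measure lborel (S \<inter> {-pi..pi})"
proof -
  interpret finite_measure "poisson Y" using assms(1) by (rule finite_measure_poisson)
  have fin: "emeasure lborel (S \<inter> {-pi..pi}) < \<infinity>"
    by (rule le_less_trans[OF emeasure_mono[of _ "{-pi..pi}"]]) auto
  have "emeasure (poisson Y) S \<le> (\<integral>\<^sup>+ u. ennreal b * indicator (S \<inter> {-pi..pi}) u \<partial>lborel)"
    unfolding emeasure_poisson[OF assms(2)] using b
    by (intro nn_integral_mono) (auto simp: indicator_def abs_le_iff intro!: ennreal_leI)
  also have "\<dots> = ennreal b * emeasure lborel (S \<inter> {-pi..pi})"
    by (subst nn_integral_cmult_indicator) auto
  also have "\<dots> = ennreal (b * measure lborel (S \<inter> {-pi..pi}))"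
    using fin \<open>b \<ge> 0\<close> by (simp add: emeasure_eq_ennreal_measure ennreal_mult)
  finally show ?thesis
    using \<open>b \<ge> 0\<close> by (simp add: emeasure_eq_measure)
qed

lemma measure_poisson_le:
  assumes "0 < Y" "Y \<le> 1" "S \<in> sets borel"
  shows "measure (poisson Y) S \<le> measure lborel (S \<inter> {-pi..pi}) / Y"
  using measure_poisson_le_bound[OF assms(1,3), of "1 / Y"] poisson_kernel_le[OF assms(1,2)] assms by simp

lemma measure_poisson_le_far:
  assumes "0 < Y" "Y \<le> 1" "S \<in> sets borel" "\<sigma> > 0" "\<And>u. u \<in> S \<Longrightarrow> \<bar>u\<bar> \<ge> \<sigma>"
  shows "measure (poisson Y) S \<le> 2 * Y / \<sigma>\<^sup>2 * measure lborel (S \<inter> {-pi..pi})"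
proof (rule measure_poisson_le_bound)
  fix u assume u: "\<bar>u\<bar> \<le> pi" "u \<in> S"
  hence s: "\<sigma> \<le> \<bar>u\<bar>" using assms by auto
  hence "u \<noteq> 0" using assms(4) by auto
  have "poisson_kernel Y u \<le> 2 * Y / u\<^sup>2" using s u assms \<open>u \<noteq> 0\<close> by (intro poisson_kernel_le_square) auto
  also have "\<dots> \<le> 2 * Y / \<sigma>\<^sup>2"
    using s assms \<open>u \<noteq> 0\<close> by (intro divide_left_mono mult_pos_pos) (auto simp: abs_le_square_iff[symmetric])
  finally show "poisson_kernel Y u \<le> 2 * Y / \<sigma>\<^sup>2" .
qed (use assms in auto)

lemma nn_integral_poisson_symmetric:
  assumes [measurable]: "f \<in> borel_measurable borel"
  shows "(\<integral>\<^sup>+ u. f (- u) \<partial>poisson Y) = (\<integral>\<^sup>+ u. f u \<partial>poisson Y)"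
proof -
  have "poisson_kernel Y (-u) = poisson_kernel Y u" for u by (simp add: poisson_kernel_def poisson_denom_def)
  hence "(\<integral>\<^sup>+ u. f (- u) \<partial>poisson Y)
      = (\<integral>\<^sup>+ u. ennreal (indicator {-pi..pi} (-u) * poisson_kernel Y (-u)) * f (-u) \<partial>lborel)"
    by (subst nn_integral_poisson) (auto intro!: nn_integral_cong simp: indicator_def)
  also have "\<dots> = (\<integral>\<^sup>+ u. ennreal (indicator {-pi..pi} u * poisson_kernel Y u) * f u \<partial>lborel)"
    by (subst (2) nn_integral_real_affine[where c="-1" and t=0]) auto
  finally show ?thesis by (simp add: nn_integral_poisson)
qed

lemma distr_poisson_uminus: "distr (poisson Y) borel uminus = poisson Y"
proof (rule measure_eqI)
  fix S assume "S \<in> sets (distr (poisson Y) borel uminus)"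
  hence [measurable]: "S \<in> sets borel" by simp
  have "emeasure (distr (poisson Y) borel uminus) S = (\<integral>\<^sup>+ u. indicator S (- u) \<partial>poisson Y)"
    by (subst nn_integral_indicator[symmetric], simp, subst nn_integral_distr) auto
  also have "\<dots> = emeasure (poisson Y) S"
    by (subst nn_integral_poisson_symmetric) auto
  finally show "emeasure (distr (poisson Y) borel uminus) S = emeasure (poisson Y) S" .
qed simp

lemma integral_poisson_symmetric:
  fixes f :: "real \<Rightarrow> real"
  assumes [measurable]: "f \<in> borel_measurable borel"
  shows "(LINT u|poisson Y. f (- u)) = (LINT u|poisson Y. f u)"
  by (subst (2) distr_poisson_uminus[symmetric], subst integral_distr) auto

text \<open>The majorant \<open>2 Y / u\<^sup>2\<close> integrates to at most
  \<open>2 Y / \<sigma>\<close> on each side.\<close>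

lemma measure_poisson_tail:
  assumes "0 < Y" "Y \<le> 1" "\<sigma> > 0"
  shows "measure (poisson Y) {u. \<bar>u\<bar> \<ge> \<sigma>} \<le> 4 * Y / \<sigma>"
proof -
  interpret finite_measure "poisson Y" using assms(1) by (rule finite_measure_poisson)
  have half: "emeasure (poisson Y) {\<sigma>..} \<le> ennreal (2 * Y / \<sigma>)"
  proof (cases "\<sigma> \<le> pi")
    case True
    have "emeasure (poisson Y) {\<sigma>..} = (\<integral>\<^sup>+ u. ennreal (indicator {-pi..pi} u * poisson_kernel Y u) * indicator {\<sigma>..} u \<partial>lborel)"
      by (intro emeasure_poisson) auto
    also have "\<dots> \<le> (\<integral>\<^sup>+ u. ennreal (2 * Y / u\<^sup>2) * indicator {\<sigma>..pi} u \<partial>lborel)"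
      using assms by (intro nn_integral_mono) (auto simp: indicator_def intro!: ennreal_leI poisson_kernel_le_square)
    also have "\<dots> = ennreal ((- 2 * Y / pi) - (- 2 * Y / \<sigma>))"
    proof (rule nn_integral_FTC_Icc)
      show "((\<lambda>u. - 2 * Y / u) has_real_derivative 2 * Y / x\<^sup>2) (at x)" if "x \<in> {\<sigma>..pi}" for x
        using that assms by (auto intro!: derivative_eq_intros simp: power2_eq_square)
    qed (use True assms in auto)
    also have "\<dots> \<le> ennreal (2 * Y / \<sigma>)"
      using assms by (intro ennreal_leI) simp
    finally show ?thesis .
  next
    case False
    have "emeasure (poisson Y) {\<sigma>..} = (\<integral>\<^sup>+ u. ennreal (indicator {-pi..pi} u * poisson_kernel Y u) * indicator {\<sigma>..} u \<partial>lborel)"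
      by (intro emeasure_poisson) auto
    also have "\<dots> = (\<integral>\<^sup>+ (u::real). 0 \<partial>lborel)"
      using False by (intro nn_integral_cong) (auto simp: indicator_def)
    finally show ?thesis by simp
  qed
  have "emeasure (poisson Y) {..-\<sigma>} = emeasure (distr (poisson Y) borel uminus) {..-\<sigma>}"
    by (simp only: distr_poisson_uminus)
  also have "\<dots> = emeasure (poisson Y) {\<sigma>..}"
    by (subst emeasure_distr) (auto intro!: arg_cong[where f="emeasure _"])
  finally have half': "emeasure (poisson Y) {..-\<sigma>} \<le> ennreal (2 * Y / \<sigma>)" using half by simp
  have "{u. \<bar>u\<bar> \<ge> \<sigma>} = {..-\<sigma>} \<union> {\<sigma>..}" using assms by auto
  hence "emeasure (poisson Y) {u. \<bar>u\<bar> \<ge> \<sigma>} \<le> emeasure (poisson Y) {..-\<sigma>} + emeasure (poisson Y) {\<sigma>..}"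
    by (simp add: emeasure_subadditive)
  also have "\<dots> \<le> ennreal (2 * Y / \<sigma>) + ennreal (2 * Y / \<sigma>)" using half half' by (intro add_mono)
  also have "\<dots> = ennreal (4 * Y / \<sigma>)" using assms by (simp flip: ennreal_plus)
  finally show ?thesis using assms by (simp add: emeasure_eq_measure)
qed

text \<open>The factor \<open>u\<^sup>2\<close> cancels the decay \<open>2 Y / u\<^sup>2\<close> of
  the kernel and leaves \<open>2 Y\<close> on an interval of length
  \<open>2 \<sigma>\<close>.\<close>

lemma integral_poisson_square_le:
  assumes "0 < Y" "Y \<le> 1" "\<sigma> > 0"
  shows "(LINT u|poisson Y. u\<^sup>2 * indicator {u. \<bar>u\<bar> < \<sigma>} u) \<le> 4 * Y * \<sigma>"
proof -
  have 0: "integrable (poisson Y) (\<lambda>u. u\<^sup>2 * indicator {u. \<bar>u\<bar> < \<sigma>} u)"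
    using assms by (intro integrable_poisson_bounded[where B="pi\<^sup>2"])
      (auto simp: indicator_def abs_le_square_iff[symmetric])
  have "ennreal (LINT u|poisson Y. u\<^sup>2 * indicator {u. \<bar>u\<bar> < \<sigma>} u)
     = (\<integral>\<^sup>+ u. ennreal (u\<^sup>2 * indicator {u. \<bar>u\<bar> < \<sigma>} u) \<partial>poisson Y)"
    by (rule nn_integral_eq_integral[symmetric, OF 0]) auto
  also have "\<dots> = (\<integral>\<^sup>+ u. ennreal (indicator {-pi..pi} u * poisson_kernel Y u) * ennreal (u\<^sup>2 * indicator {u. \<bar>u\<bar> < \<sigma>} u) \<partial>lborel)"
    by (intro nn_integral_poisson) auto
  also have "\<dots> \<le> (\<integral>\<^sup>+ u. ennreal (2 * Y) * indicator {-\<sigma>..\<sigma>} u \<partial>lborel)"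
  proof (rule nn_integral_mono)
    fix u
    show "ennreal (indicator {-pi..pi} u * poisson_kernel Y u) * ennreal (u\<^sup>2 * indicator {u. \<bar>u\<bar> < \<sigma>} u)
        \<le> ennreal (2 * Y) * indicator {-\<sigma>..\<sigma>} u"
    proof (cases "\<bar>u\<bar> \<le> pi \<and> \<bar>u\<bar> < \<sigma> \<and> u \<noteq> 0")
      case True
      have "poisson_kernel Y u * u\<^sup>2 \<le> 2 * Y / u\<^sup>2 * u\<^sup>2"
        using True assms by (intro mult_right_mono poisson_kernel_le_square) auto
      hence "ennreal (poisson_kernel Y u * u\<^sup>2) \<le> ennreal (2 * Y)" using True by (intro ennreal_leI) auto
      thus ?thesis using True poisson_kernel_pos[OF assms(1), of u]
        by (auto simp: indicator_def ennreal_mult[symmetric])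
    qed (auto simp: indicator_def abs_le_iff)
  qed
  also have "\<dots> = ennreal (2 * Y) * ennreal (2 * \<sigma>)"
    using assms by (subst nn_integral_cmult_indicator) auto
  also have "\<dots> = ennreal (4 * Y * \<sigma>)" using assms by (simp add: ennreal_mult[symmetric])
  finally show ?thesis using assms by simp
qed

text \<open>The part of the shifted interval that sticks out beyond \<open>pi\<close> is moved back
  by one period and fills the gap on the left; only endpoints are counted wrongly.\<close>

lemma nn_integral_periodic_shift:
  fixes G :: "real \<Rightarrow> ennreal"
  assumes [measurable]: "G \<in> borel_measurable borel" and per: "\<And>x. G (x + 2 * pi) = G x"
    and c: "\<bar>c\<bar> \<le> 2 * pi"
  shows "(\<integral>\<^sup>+ u. indicator {-pi..pi} u * G (u + c) \<partial>lborel) = (\<integral>\<^sup>+ u. indicator {-pi..pi} u * G u \<partial>lborel)"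
proof -
  have main: "(\<integral>\<^sup>+ u. indicator {-pi..pi} u * G (u + c) \<partial>lborel) = (\<integral>\<^sup>+ u. indicator {-pi..pi} u * G u \<partial>lborel)"
    if c: "0 \<le> c" "c \<le> 2 * pi" for c
  proof -
    have "(\<integral>\<^sup>+ u. indicator {-pi..pi} u * G (u + c) \<partial>lborel) = (\<integral>\<^sup>+ u. indicator {-pi+c..pi+c} u * G u \<partial>lborel)"
      by (subst (2) nn_integral_real_affine[where c=1 and t=c])
         (auto intro!: nn_integral_cong simp: indicator_def add.commute)
    also have "\<dots> = (\<integral>\<^sup>+ u. indicator {-pi+c..pi} u * G u + indicator {pi<..pi+c} u * G u \<partial>lborel)"
      using c by (intro nn_integral_cong) (auto simp: indicator_def)
    also have "\<dots> = (\<integral>\<^sup>+ u. indicator {-pi+c..pi} u * G u \<partial>lborel) + (\<integral>\<^sup>+ u. indicator {pi<..pi+c} u * G u \<partial>lborel)"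
      by (intro nn_integral_add) auto
    also have "(\<integral>\<^sup>+ u. indicator {pi<..pi+c} u * G u \<partial>lborel) = (\<integral>\<^sup>+ u. indicator {-pi<..-pi+c} u * G u \<partial>lborel)"
      by (subst nn_integral_real_affine[where c=1 and t="2*pi"])
         (auto intro!: nn_integral_cong simp: indicator_def add.commute[of "2*pi"] per)
    also have "(\<integral>\<^sup>+ u. indicator {-pi+c..pi} u * G u \<partial>lborel) + (\<integral>\<^sup>+ u. indicator {-pi<..-pi+c} u * G u \<partial>lborel)
       = (\<integral>\<^sup>+ u. indicator {-pi+c..pi} u * G u + indicator {-pi<..-pi+c} u * G u \<partial>lborel)"
      by (intro nn_integral_add[symmetric]) auto
    also have "\<dots> = (\<integral>\<^sup>+ u. indicator {-pi..pi} u * G u \<partial>lborel)"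
    proof (rule nn_integral_cong_AE)
      have "AE u in lborel. u \<noteq> -pi \<and> u \<noteq> -pi + c"
        by (intro AE_conjI AE_lborel_singleton)
      thus "AE u in lborel. indicator {-pi+c..pi} u * G u + indicator {-pi<..-pi+c} u * G u = indicator {-pi..pi} u * G u"
        by (rule AE_mp) (intro AE_I2 impI, use c in \<open>auto simp: indicator_def\<close>)
    qed
    finally show ?thesis .
  qed
  show ?thesis
  proof (cases "c \<ge> 0")
    case True thus ?thesis using main c by auto
  next
    case False
    have "G (u + c) = G (u + (c + 2 * pi))" for u using per[of "u + c"] by (simp add: add.assoc)
    thus ?thesis using main[of "c + 2 * pi"] False c by simp
  qed
qed

text \<open>By the addition formula a shift by \<open>c\<close> changes \<open>sin (u / 2)\<close>
  by at most \<open>\<bar>sin (c / 2)\<bar> \<le> Y / 2\<close>, which after division by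
  \<open>Y\<^sup>2\<close> is of the order of the summand 1 in the denominator.\<close>

lemma poisson_denom_Harnack:
  assumes "0 < Y" "Y \<le> 1" "\<bar>c\<bar> \<le> Y"
  shows "poisson_denom Y u \<le> 5 * poisson_denom Y (u - c)"
proof -
  define a where "a = sin ((u - c) / 2)"
  define b where "b = cos ((u - c) / 2)"
  define d where "d = sin (c / 2)"
  have "u / 2 = (u - c) / 2 + c / 2" by (simp add: field_simps)
  hence "sin (u / 2) = a * cos (c / 2) + b * d"
    unfolding a_def b_def d_def by (metis sin_add)
  hence "\<bar>sin (u / 2)\<bar> \<le> \<bar>a * cos (c / 2)\<bar> + \<bar>b * d\<bar>" by simp
  also have "\<dots> \<le> \<bar>a\<bar> + \<bar>d\<bar>"
    by (intro add_mono) (auto simp: abs_mult b_def mult_left_le mult_left_le_one_le)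
  finally have "(sin (u / 2))\<^sup>2 \<le> (\<bar>a\<bar> + \<bar>d\<bar>)\<^sup>2"
    by (metis abs_ge_zero power2_abs power_mono)
  also have "\<dots> \<le> 2 * a\<^sup>2 + 2 * d\<^sup>2"
    using sum_squares_ge_zero[of "\<bar>a\<bar> - \<bar>d\<bar>" 0] by (simp add: power2_eq_square algebra_simps)
  also have "d\<^sup>2 \<le> (Y / 2)\<^sup>2"
  proof -
    have "\<bar>d\<bar> \<le> \<bar>c / 2\<bar>" unfolding d_def by (rule abs_sin_x_le_abs_x)
    also have "\<dots> \<le> Y / 2" using assms by simp
    finally show ?thesis using assms by (intro power2_le_iff_abs_le[THEN iffD2]) auto
  qed
  finally have s: "(sin (u / 2))\<^sup>2 \<le> 2 * a\<^sup>2 + Y\<^sup>2 / 2" by (simp add: power_divide)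
  have "4 * (1 + Y) * (sin (u / 2))\<^sup>2 / Y\<^sup>2 \<le> 4 * (1 + Y) * (2 * a\<^sup>2 + Y\<^sup>2 / 2) / Y\<^sup>2"
    using assms s by (intro divide_right_mono mult_left_mono) auto
  also have "\<dots> = 2 * (4 * (1 + Y) * a\<^sup>2 / Y\<^sup>2) + 2 * (1 + Y)"
    using assms by (simp add: field_simps)
  finally have "poisson_denom Y u \<le> 1 + 2 * (poisson_denom Y (u - c) - 1) + 4"
    using assms by (simp add: poisson_denom_def a_def)
  also have "\<dots> \<le> 5 * poisson_denom Y (u - c)" using poisson_denom_ge_1[OF assms(1), of "u - c"] by simp
  finally show ?thesis .
qed

lemma poisson_kernel_Harnack:
  assumes "0 < Y" "Y \<le> 1" "\<bar>c\<bar> \<le> Y"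
  shows "poisson_kernel Y (u - c) \<le> 5 * poisson_kernel Y u"
proof -
  have "1 / poisson_denom Y (u - c) \<le> 5 / poisson_denom Y u"
    using poisson_denom_Harnack[OF assms, of u] poisson_denom_ge_1[OF assms(1), of u] poisson_denom_ge_1[OF assms(1), of "u - c"]
    by (simp add: field_simps)
  hence "(2 + Y) / (2 * pi * Y) * (1 / poisson_denom Y (u - c)) \<le> (2 + Y) / (2 * pi * Y) * (5 / poisson_denom Y u)"
    using assms by (intro mult_left_mono) auto
  thus ?thesis by (simp add: poisson_kernel_def mult.commute)
qed

text \<open>Moving the centre by \<open>c\<close> amounts to moving the kernel; periodicity of
  \<open>h\<close> and of the kernel restores the interval of integration, and the pointwise Harnack
  bound applies.\<close>

lemma integral_poisson_Harnack:
  fixes h :: "real \<Rightarrow> real"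
  assumes Y: "0 < Y" "Y \<le> 1" "\<bar>c\<bar> \<le> Y"
    and [measurable]: "h \<in> borel_measurable borel" and per: "\<And>x. h (x + 2 * pi) = h x"
    and h: "\<And>x. 0 \<le> h x" "\<And>x. h x \<le> B"
  shows "avg Y h (t + c) \<le> 5 * avg Y h t"
proof -
  interpret finite_measure "poisson Y" using assms(1) by (rule finite_measure_poisson)
  have i: "integrable (poisson Y) (\<lambda>u. h (t + u))" for t
    using Y h by (intro integrable_poisson_bounded[where B=B]) auto
  have e: "ennreal (avg Y h t) = (\<integral>\<^sup>+ u. indicator {-pi..pi} u * (ennreal (poisson_kernel Y u) * ennreal (h (t + u))) \<partial>lborel)" for t
  proof -
    have "ennreal (avg Y h t) = (\<integral>\<^sup>+ u. ennreal (h (t + u)) \<partial>poisson Y)"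
      using h by (intro nn_integral_eq_integral[symmetric] i) auto
    also have "\<dots> = (\<integral>\<^sup>+ u. indicator {-pi..pi} u * (ennreal (poisson_kernel Y u) * ennreal (h (t + u))) \<partial>lborel)"
      by (subst nn_integral_poisson) (auto intro!: nn_integral_cong simp: indicator_def)
    finally show ?thesis .
  qed
  define G where "G = (\<lambda>u. ennreal (poisson_kernel Y (u - c)) * ennreal (h (t + u)))"
  have "sin ((u + 2 * pi) / 2) = - sin (u / 2)" for u by (simp add: add_divide_distrib)
  hence pkper: "poisson_kernel Y (u + 2 * pi) = poisson_kernel Y u" for u by (simp add: poisson_kernel_def poisson_denom_def)
  have "G (u + 2 * pi) = G u" for u
    using pkper[of "u - c"] per[of "t + u"] unfolding G_def by (simp add: algebra_simps)
  hence "(\<integral>\<^sup>+ u. indicator {-pi..pi} u * G (u + c) \<partial>lborel) = (\<integral>\<^sup>+ u. indicator {-pi..pi} u * G u \<partial>lborel)"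
    using Y pi_gt3 by (intro nn_integral_periodic_shift) (auto simp: G_def)
  moreover have "ennreal (avg Y h (t + c)) = (\<integral>\<^sup>+ u. indicator {-pi..pi} u * G (u + c) \<partial>lborel)"
    unfolding e G_def by (simp add: add_ac)
  ultimately have "ennreal (avg Y h (t + c)) = (\<integral>\<^sup>+ u. indicator {-pi..pi} u * G u \<partial>lborel)"
    by simp
  also have "\<dots> \<le> (\<integral>\<^sup>+ u. ennreal 5 * (indicator {-pi..pi} u * (ennreal (poisson_kernel Y u) * ennreal (h (t + u)))) \<partial>lborel)"
  proof (rule nn_integral_mono)
    fix u
    have "ennreal (poisson_kernel Y (u - c)) \<le> ennreal 5 * ennreal (poisson_kernel Y u)"
      using poisson_kernel_Harnack[OF Y, of u] poisson_kernel_pos[OF Y(1), of u]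
      by (subst ennreal_mult[symmetric]) (auto intro!: ennreal_leI)
    hence "ennreal (poisson_kernel Y (u - c)) * ennreal (h (t + u)) \<le> ennreal 5 * ennreal (poisson_kernel Y u) * ennreal (h (t + u))"
      by (rule mult_right_mono) simp
    thus "indicator {-pi..pi} u * G u \<le> ennreal 5 * (indicator {-pi..pi} u * (ennreal (poisson_kernel Y u) * ennreal (h (t + u))))"
      unfolding G_def by (auto simp: indicator_def mult.assoc)
  qed
  also have "\<dots> = ennreal 5 * ennreal (avg Y h t)"
    unfolding e by (rule nn_integral_cmult) auto
  also have "\<dots> = ennreal (5 * avg Y h t)"
    by (simp only: ennreal_mult'[symmetric])
  finally show ?thesis
    using h by (simp add: integral_nonneg_AE)
qed

section \<open>Truncated weights\<close>

text \<open>The mean value theorem twice: for \<open>h'\<close> on a symmetric interval, then for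
  \<open>h (t + v) + h (t - v) - K v\<^sup>2\<close> as a function of \<open>v\<close>.\<close>

lemma second_difference_le:
  fixes h h' h'' :: "real \<Rightarrow> real"
  assumes d1: "\<And>s. \<bar>s - t\<bar> < \<sigma> \<Longrightarrow> (h has_real_derivative h' s) (at s)"
    and d2: "\<And>s. \<bar>s - t\<bar> < \<sigma> \<Longrightarrow> (h' has_real_derivative h'' s) (at s)"
    and K: "\<And>s. \<bar>s - t\<bar> < \<sigma> \<Longrightarrow> \<bar>h'' s\<bar> \<le> K"
    and u: "\<bar>u\<bar> < \<sigma>"
  shows "h (t + u) + h (t - u) - 2 * h t \<le> K * u\<^sup>2"
proof -
  have main: "h (t + u) + h (t - u) - 2 * h t \<le> K * u\<^sup>2" if u: "0 < u" "u < \<sigma>" for u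
  proof -
    have h': "h' (t + v) - h' (t - v) \<le> 2 * K * v" if v: "0 < v" "v < \<sigma>" for v
    proof -
      have "\<exists>z. t - v < z \<and> z < t + v \<and> h' (t + v) - h' (t - v) = ((t + v) - (t - v)) * h'' z"
        using v by (intro MVT2 d2) auto
      then obtain z where z: "t - v < z" "z < t + v" "h' (t + v) - h' (t - v) = 2 * v * h'' z" by auto
      have "\<bar>z - t\<bar> < \<sigma>" using z v by (simp add: abs_less_iff)
      hence "h'' z \<le> K" using K[of z] by simp
      hence "2 * v * h'' z \<le> 2 * v * K" using v by (intro mult_left_mono) auto
      thus ?thesis using z by (simp add: mult_ac)
    qed
    define k where "k = (\<lambda>v. h (t + v) + h (t - v) - K * v\<^sup>2)"
    have k: "(k has_real_derivative (h' (t + v) - h' (t - v) - 2 * K * v)) (at v)" if v: "0 \<le> v" "v \<le> u" for v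
    proof -
      have 1: "((\<lambda>v. h (t + v)) has_real_derivative h' (t + v) * 1) (at v)"
        using v u by (intro DERIV_chain2[OF d1]) (auto intro!: derivative_eq_intros)
      have 2: "((\<lambda>v. h (t - v)) has_real_derivative h' (t - v) * (-1)) (at v)"
        using v u by (intro DERIV_chain2[OF d1]) (auto intro!: derivative_eq_intros)
      show ?thesis unfolding k_def
        by (rule derivative_eq_intros 1 2 refl)+ simp
    qed
    have "\<exists>z. 0 < z \<and> z < u \<and> k u - k 0 = (u - 0) * (h' (t + z) - h' (t - z) - 2 * K * z)"
      using u k by (intro MVT2) auto
    then obtain z where z: "0 < z" "z < u" "k u - k 0 = u * (h' (t + z) - h' (t - z) - 2 * K * z)" by auto
    have "u * (h' (t + z) - h' (t - z) - 2 * K * z) \<le> 0"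
      using h'[of z] z u by (intro mult_nonneg_nonpos) auto
    thus ?thesis using z(3) by (simp add: k_def)
  qed
  show ?thesis
  proof (cases u "0::real" rule: linorder_cases)
    case less thus ?thesis using main[of "-u"] u by simp
  next
    case equal thus ?thesis by simp
  next
    case greater thus ?thesis using main[of u] u by simp
  qed
qed

lemma integrable_poisson_indicator:
  "Y > 0 \<Longrightarrow> S \<in> sets borel \<Longrightarrow> integrable (poisson Y) (indicator S :: real \<Rightarrow> real)"
  by (rule integrable_poisson_bounded[where B=1]) (auto simp: indicator_def)

lemma integral_poisson_affine_indicator:
  fixes a b :: real
  assumes "Y > 0" "S \<in> sets borel"
  shows "(LINT u|poisson Y. a + b * indicator S u) = a + b * measure (poisson Y) S"
proof -
  have "integrable (poisson Y) (\<lambda>u. a)" using assms by (intro integrable_poisson_bounded[where B="\<bar>a\<bar>"]) auto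
  moreover have "integrable (poisson Y) (\<lambda>u. b * indicator S u)"
    using assms by (intro integrable_mult_right integrable_poisson_indicator) auto
  ultimately show ?thesis using assms by (simp add: measure_poisson_UNIV)
qed

text \<open>The quantitative content of membership in the class. The conditions on \<open>F'\<close>
  and \<open>F''\<close> are cleared of denominators and carry the sign of \<open>F'\<close>.
  \<open>g_small\<close> is the trace of the simple zeros: sublevel sets have measure proportional
  to the level, uniformly under translation.\<close>

locale weight_factor =
  fixes A a1 a2 b D c :: real and F F' F'' g g' g'' :: "real \<Rightarrow> real"
  assumes params: "A > 0" "a1 > 0" "a2 > 0" "b \<ge> 0" "D \<ge> 1" "c \<ge> 0"
    and F_pos: "\<And>x. 0 < x \<Longrightarrow> x \<le> A \<Longrightarrow> F x > 0"
    and F_deriv: "\<And>x. 0 < x \<Longrightarrow> x \<le> A \<Longrightarrow> (F has_real_derivative F' x) (at x within {0<..A})"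
    and F'_deriv: "\<And>x. 0 < x \<Longrightarrow> x \<le> A \<Longrightarrow> (F' has_real_derivative F'' x) (at x within {0<..A})"
    and F'_lower: "\<And>x. 0 < x \<Longrightarrow> x \<le> A \<Longrightarrow> a2 * F x \<le> - F' x * x"
    and F'_upper: "\<And>x. 0 < x \<Longrightarrow> x \<le> A \<Longrightarrow> - F' x * x \<le> a1 * F x"
    and F''_bound: "\<And>x. 0 < x \<Longrightarrow> x \<le> A \<Longrightarrow> \<bar>F'' x\<bar> * x\<^sup>2 \<le> b * F x"
    and g_deriv: "\<And>t. (g has_real_derivative g' t) (at t)"
    and g'_deriv: "\<And>t. (g' has_real_derivative g'' t) (at t)"
    and g'_bound: "\<And>t. \<bar>g' t\<bar> \<le> D"
    and g''_bound: "\<And>t. \<bar>g'' t\<bar> \<le> D"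
    and g_bound: "\<And>t. \<bar>g t\<bar> \<le> A"
    and g_small: "\<And>t l. l > 0 \<Longrightarrow> measure lborel {u \<in> {-pi..pi}. \<bar>g (t + u)\<bar> < l} \<le> c * l"
begin

definition \<Phi> :: "real \<Rightarrow> real \<Rightarrow> real" where
  "\<Phi> y t = F (max \<bar>g t\<bar> y)"

lemma F_deriv_at: "0 < x \<Longrightarrow> x < A \<Longrightarrow> (F has_real_derivative F' x) (at x)"
  using F_deriv[of x] at_within_open_subset[of x "{0<..<A}" "{0<..A}"] by fastforce

lemma F_cont: "continuous_on {0<..A} F"
  by (rule DERIV_continuous_on) (use F_deriv in auto)

lemma F_antimono:
  assumes x: "0 < x" "x \<le> x'" "x' \<le> A"
  shows "F x' \<le> F x"
proof (rule DERIV_nonpos_imp_decreasing_open[OF x(2)])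
    show "\<exists>y. (F has_real_derivative y) (at z) \<and> y \<le> 0" if z: "x < z" "z < x'" for z
    proof -
      have "0 \<le> a2 * F z" using F_pos[of z] params x z by simp
      hence "0 \<le> - F' z * z" using F'_lower[of z] x z by linarith
      hence "F' z \<le> 0" using x z by (simp add: mult_le_0_iff)
      thus ?thesis using F_deriv_at[of z] x z by auto
    qed
  show "continuous_on {x..x'} F" using x by (intro continuous_on_subset[OF F_cont]) auto
qed

text \<open>\<open>ln F + a ln x\<close> is increasing for \<open>a = a1\<close> and decreasing for
  \<open>a = a2\<close>, so \<open>F\<close> lies between two negative power laws. The upper power
  controls \<open>F\<close> at comparable arguments, the lower one provides decay away from the
  truncation level.\<close>

lemma F_scale:
  assumes x: "0 < x" "x \<le> x'" "x' \<le> A"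
  shows "F x \<le> (x' / x) powr a1 * F x'" and "F x' \<le> (x / x') powr a2 * F x"
proof -
  define h where "h = (\<lambda>a x. ln (F x) + a * ln x)"
  have F0: "F z > 0" if "x \<le> z" "z \<le> x'" for z using F_pos[of z] x that by auto
  have cont: "continuous_on {x..x'} (h a)" for a
    unfolding h_def using x F0
    by (intro continuous_intros continuous_on_subset[OF F_cont]) (auto simp: less_imp_neq[symmetric])
  have der: "(h a has_real_derivative (F' z / F z + a / z)) (at z)" if z: "x < z" "z < x'" for z a
    unfolding h_def using F0[of z] x z
    by (auto intro!: derivative_eq_intros F_deriv_at simp: divide_inverse mult.commute)
  have "h a1 x \<le> h a1 x'"
  proof (rule DERIV_nonneg_imp_increasing_open[OF x(2) _ cont])
    fix z assume z: "x < z" "z < x'"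
    have "- F' z * z \<le> a1 * F z" using F'_upper[of z] x z by auto
    hence "0 \<le> F' z / F z + a1 / z" using F0[of z] x z by (simp add: field_simps)
    thus "\<exists>y. (h a1 has_real_derivative y) (at z) \<and> 0 \<le> y" using der[OF z] by blast
  qed
  hence "ln (F x) \<le> ln (F x') + a1 * (ln x' - ln x)" by (simp add: h_def algebra_simps)
  hence "exp (ln (F x)) \<le> exp (ln (F x') + a1 * (ln x' - ln x))" by simp
  thus "F x \<le> (x' / x) powr a1 * F x'"
    using F0[of x] F0[of x'] x by (simp add: exp_add powr_def ln_div mult.commute)
  have "h a2 x' \<le> h a2 x"
  proof (rule DERIV_nonpos_imp_decreasing_open[OF x(2) _ cont])
    fix z assume z: "x < z" "z < x'"
    have "a2 * F z \<le> - F' z * z" using F'_lower[of z] x z by auto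
    hence "F' z / F z + a2 / z \<le> 0" using F0[of z] x z by (simp add: field_simps)
    thus "\<exists>y. (h a2 has_real_derivative y) (at z) \<and> y \<le> 0" using der[OF z] by blast
  qed
  hence "ln (F x') \<le> ln (F x) + a2 * (ln x - ln x')" by (simp add: h_def algebra_simps)
  hence "exp (ln (F x')) \<le> exp (ln (F x) + a2 * (ln x - ln x'))" by simp
  thus "F x' \<le> (x / x') powr a2 * F x"
    using F0[of x] F0[of x'] x by (simp add: exp_add powr_def ln_div mult.commute)
qed

lemma F_div_antimono: "0 < x \<Longrightarrow> x \<le> x' \<Longrightarrow> x' \<le> A \<Longrightarrow> F x' / x' \<le> F x / x"
  using F_antimono[of x x'] F_pos[of x'] by (intro frac_le) auto

text \<open>\<open>- F' z \<le> a1 F z / z\<close>, and \<open>F z / z\<close> decreases, so the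
  left end \<open>y\<close> governs the slope. At a truncation level with
  \<open>F y = \<Lambda> n y\<close> this slope is \<open>a1 \<Lambda> n\<close>.\<close>

lemma F_lipschitz:
  assumes "0 < y" "y \<le> x" "x \<le> x'" "x' \<le> A"
  shows "\<bar>F x - F x'\<bar> \<le> a1 * (F y / y) * (x' - x)"
proof (cases "x = x'")
  case False
  hence lt: "x < x'" using assms by simp
  have "continuous_on {x..x'} F" using assms by (intro continuous_on_subset[OF F_cont]) auto
  moreover have "\<And>z. x < z \<Longrightarrow> z < x' \<Longrightarrow> (F has_derivative (\<lambda>h. h * F' z)) (at z)"
    using assms F_deriv_at by (auto simp: has_field_derivative_def mult_commute_abs)
  ultimately obtain z where z: "x < z" "z < x'" "F x' - F x = (x' - x) * F' z"
    using mvt[OF lt, of F "\<lambda>z h. h * F' z"] by auto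
  have "- F' z * z \<le> a1 * F z" using F'_upper[of z] assms z by auto
  hence "- F' z \<le> a1 * (F z / z)" using assms z by (simp add: field_simps)
  also have "\<dots> \<le> a1 * (F y / y)"
    using assms z params by (intro mult_left_mono F_div_antimono) auto
  finally have *: "- F' z \<le> a1 * (F y / y)" .
  have "F x - F x' = (x' - x) * (- F' z)" using z by (simp add: algebra_simps)
  also have "\<dots> \<le> (x' - x) * (a1 * (F y / y))" using * lt by (intro mult_left_mono) auto
  finally show ?thesis using F_antimono[of x x'] assms by (simp add: mult_ac)
qed auto

lemma g_cont: "continuous_on UNIV g"
  using g_deriv by (intro DERIV_continuous_on) auto

lemma g_lipschitz: "\<bar>g s - g t\<bar> \<le> D * \<bar>s - t\<bar>"
proof -
  have *: "\<bar>g s - g t\<bar> \<le> D * \<bar>s - t\<bar>" if less: "t < s" for s t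
  proof -
    obtain z where "g s - g t = (s - t) * g' z"
      using MVT2[OF less, of g g'] g_deriv by auto
    thus ?thesis using g'_bound[of z] by (simp add: abs_mult mult.commute mult_right_mono)
  qed
  show ?thesis
    by (cases s t rule: linorder_cases) (use *[of s t] *[of t s] in \<open>auto simp: abs_minus_commute\<close>)
qed

lemma \<Phi>_nonneg: "0 < y \<Longrightarrow> y \<le> A \<Longrightarrow> 0 \<le> \<Phi> y t"
  using F_pos[of "max \<bar>g t\<bar> y"] g_bound[of t] by (auto simp: \<Phi>_def max_def less_imp_le)

lemma \<Phi>_le: "0 < y \<Longrightarrow> y \<le> A \<Longrightarrow> \<Phi> y t \<le> F y"
  unfolding \<Phi>_def using g_bound[of t] by (intro F_antimono) auto

lemma \<Phi>_le_at: "0 < y \<Longrightarrow> y \<le> A \<Longrightarrow> 0 < l \<Longrightarrow> l \<le> \<bar>g t\<bar> \<Longrightarrow> \<Phi> y t \<le> F l"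
  unfolding \<Phi>_def using g_bound[of t] by (intro F_antimono) auto

lemma \<Phi>_ge:
  assumes "0 < y" "y \<le> A" "1 \<le> k" "\<bar>g t\<bar> \<le> k * y"
  shows "\<Phi> y t \<ge> k powr - a1 * F y"
proof -
  define m where "m = max \<bar>g t\<bar> y"
  have m: "y \<le> m" "m \<le> A" "m \<le> k * y"
    using assms g_bound[of t] by (auto simp: m_def mult_le_cancel_right1)
  have "F y \<le> (m / y) powr a1 * F m" using m assms by (intro F_scale) auto
  also have "\<dots> \<le> k powr a1 * F m"
    using m assms params F_pos[of m] by (intro mult_right_mono powr_mono2) (auto simp: field_simps)
  finally have "k powr - a1 * F y \<le> k powr - a1 * (k powr a1 * F m)"
    by (intro mult_left_mono) auto
  thus ?thesis using assms by (simp add: \<Phi>_def m_def powr_minus field_simps)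
qed

lemma \<Phi>_lipschitz:
  assumes "0 < y" "y \<le> A"
  shows "\<bar>\<Phi> y s - \<Phi> y t\<bar> \<le> a1 * D * (F y / y) * \<bar>s - t\<bar>"
proof -
  have Fy: "F y / y > 0" using F_pos assms by simp
  have *: "\<bar>\<Phi> y s - \<Phi> y t\<bar> \<le> a1 * (F y / y) * \<bar>max \<bar>g s\<bar> y - max \<bar>g t\<bar> y\<bar>"
    if "max \<bar>g s\<bar> y \<le> max \<bar>g t\<bar> y" for s t
    using F_lipschitz[of y "max \<bar>g s\<bar> y" "max \<bar>g t\<bar> y"] g_bound[of t] that assms by (simp add: \<Phi>_def)
  have "\<bar>\<Phi> y s - \<Phi> y t\<bar> \<le> a1 * (F y / y) * \<bar>max \<bar>g s\<bar> y - max \<bar>g t\<bar> y\<bar>"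
    using *[of s t] *[of t s] by (metis abs_minus_commute linear)
  also have "\<dots> \<le> a1 * (F y / y) * (D * \<bar>s - t\<bar>)"
  proof (rule mult_left_mono)
    have "\<bar>max \<bar>g s\<bar> y - max \<bar>g t\<bar> y\<bar> \<le> \<bar>g s - g t\<bar>" by (auto simp: max_def abs_if)
    also have "\<dots> \<le> D * \<bar>s - t\<bar>" by (rule g_lipschitz)
    finally show "\<bar>max \<bar>g s\<bar> y - max \<bar>g t\<bar> y\<bar> \<le> D * \<bar>s - t\<bar>" .
    show "0 \<le> a1 * (F y / y)" using Fy params by (intro mult_nonneg_nonneg) auto
  qed
  finally show ?thesis by (simp add: mult_ac)
qed

lemma \<Phi>_cont: "0 < y \<Longrightarrow> y \<le> A \<Longrightarrow> continuous_on UNIV (\<Phi> y)"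
  unfolding \<Phi>_def
  by (rule continuous_on_compose2[OF F_cont])
     (auto intro!: continuous_intros g_cont simp: g_bound)

lemma \<Phi>_measurable [measurable]: "0 < y \<Longrightarrow> y \<le> A \<Longrightarrow> \<Phi> y \<in> borel_measurable borel"
  by (intro borel_measurable_continuous_onI \<Phi>_cont)

lemma g_measurable [measurable]: "g \<in> borel_measurable borel"
  by (intro borel_measurable_continuous_onI g_cont)

lemma \<Phi>_integrable:
  assumes "0 < y" "y \<le> A" "0 < Y"
  shows "integrable (poisson Y) (\<lambda>u. \<Phi> y (t + u))" "integrable (poisson Y) (\<lambda>u. \<Phi> y (t - u))"
  using \<Phi>_nonneg[OF assms(1,2)] \<Phi>_le[OF assms(1,2)] assms
  by (auto intro!: integrable_poisson_bounded[where B="F y"])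

text \<open>The gain for heights far above the truncation level. Split at the geometric mean
  \<open>l\<close> of \<open>y\<close> and \<open>Y\<close>: the set
  \<open>\<bar>g\<bar> < l\<close> has Poisson mass at most \<open>c l / Y\<close>, and off it the
  potential is at most \<open>(y / l) powr a2\<close> times \<open>F y\<close>. The choice of
  \<open>l\<close> makes both ratios equal to \<open>sqrt (y / Y)\<close>.\<close>

lemma integral_poisson_\<Phi>_le_scale:
  assumes "0 < y" "y \<le> A" "y \<le> Y" "Y \<le> 1"
  shows "avg Y (\<Phi> y) t \<le> F y * (c * sqrt (y / Y) + sqrt (y / Y) powr a2)"
proof -
  have Y: "Y > 0" using assms by simp
  interpret finite_measure "poisson Y" using Y by (rule finite_measure_poisson)
  define l where "l = sqrt (y * Y)"
  have l: "y \<le> l" unfolding l_def using assms by (intro real_le_rsqrt) (simp add: power2_eq_square)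
  have yl: "y / l = sqrt (y / Y)" "l / Y = sqrt (y / Y)"
    using assms Y unfolding l_def by (simp_all add: real_sqrt_mult real_sqrt_divide real_div_sqrt field_simps)
  define S where "S = {u. \<bar>g (t + u)\<bar> < l}"
  have [measurable]: "S \<in> sets borel" unfolding S_def by measurable
  have mS: "measure (poisson Y) S \<le> c * sqrt (y / Y)"
  proof -
    have "measure (poisson Y) S \<le> measure lborel (S \<inter> {-pi..pi}) / Y"
      using Y assms by (intro measure_poisson_le) auto
    also have "S \<inter> {-pi..pi} = {u \<in> {-pi..pi}. \<bar>g (t + u)\<bar> < l}" by (auto simp: S_def)
    also have "measure lborel {u \<in> {-pi..pi}. \<bar>g (t + u)\<bar> < l} / Y \<le> c * l / Y"
      using l assms Y by (intro divide_right_mono g_small) auto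
    also have "\<dots> = c * (l / Y)" by simp
    finally show ?thesis by (simp only: yl)
  qed
  have Fy: "F y > 0" using F_pos assms by simp
  have "avg Y (\<Phi> y) t \<le> (LINT u|poisson Y. F y * sqrt (y / Y) powr a2 + F y * indicator S u)"
  proof (rule integral_mono[OF \<Phi>_integrable(1)])
    show "integrable (poisson Y) (\<lambda>u. F y * sqrt (y / Y) powr a2 + F y * indicator S u)"
      using Y by (intro Bochner_Integration.integrable_add integrable_mult_right integrable_poisson_indicator) auto
    fix u
    show "\<Phi> y (t + u) \<le> F y * sqrt (y / Y) powr a2 + F y * indicator S u"
    proof (cases "u \<in> S")
      case True
      have "\<Phi> y (t + u) \<le> F y + 0" using \<Phi>_le assms by simp
      also have "\<dots> \<le> F y + F y * sqrt (y / Y) powr a2" using Fy by (intro add_left_mono) auto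
      finally show ?thesis using True by simp
    next
      case False
      hence lg: "l \<le> \<bar>g (t + u)\<bar>" by (simp add: S_def)
      hence lA: "l \<le> A" using g_bound[of "t + u"] by simp
      have "\<Phi> y (t + u) \<le> F l" using \<Phi>_le_at assms l lg by auto
      also have "\<dots> \<le> (y / l) powr a2 * F y" using assms l lA by (intro F_scale) auto
      finally show ?thesis using False by (simp add: yl mult.commute)
    qed
  qed (use assms Y in auto)
  also have "\<dots> = F y * sqrt (y / Y) powr a2 + F y * measure (poisson Y) S"
    using Y by (intro integral_poisson_affine_indicator) auto
  also have "\<dots> \<le> F y * sqrt (y / Y) powr a2 + F y * (c * sqrt (y / Y))"
    using mS Fy by (intro add_left_mono mult_left_mono) auto
  finally show ?thesis by (simp add: algebra_simps)
qed

text \<open>For a factor without a zero near \<open>t\<close>: the value \<open>F l\<close> is used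
  near \<open>t\<close>, and the maximum \<open>F y\<close> only on the Poisson tail beyond
  \<eta>.\<close>

lemma integral_poisson_\<Phi>_le_away:
  assumes "0 < y" "y \<le> A" "0 < Y" "Y \<le> 1" "0 < l" "l \<le> A" "0 < \<eta>"
    and l: "\<And>s. \<bar>s - t\<bar> < \<eta> \<Longrightarrow> l \<le> \<bar>g s\<bar>"
  shows "avg Y (\<Phi> y) t \<le> F l + F y * (4 * Y / \<eta>)"
proof -
  interpret finite_measure "poisson Y" using assms(3) by (rule finite_measure_poisson)
  have Fy: "F y > 0" "F l > 0" using F_pos assms by auto
  have "avg Y (\<Phi> y) t \<le> (LINT u|poisson Y. F l + F y * indicator {u. \<eta> \<le> \<bar>u\<bar>} u)"
  proof (rule integral_mono[OF \<Phi>_integrable(1)])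
    fix u
    show "\<Phi> y (t + u) \<le> F l + F y * indicator {u. \<eta> \<le> \<bar>u\<bar>} u"
    proof (cases "\<eta> \<le> \<bar>u\<bar>")
      case True
      have "\<Phi> y (t + u) \<le> F y" using \<Phi>_le assms by simp
      thus ?thesis using Fy True by simp
    next
      case False
      have "\<Phi> y (t + u) \<le> F l" using assms False by (intro \<Phi>_le_at l) auto
      thus ?thesis using False by simp
    qed
    show "integrable (poisson Y) (\<lambda>u. F l + F y * indicator {u. \<eta> \<le> \<bar>u\<bar>} u)"
      using assms by (intro Bochner_Integration.integrable_add integrable_mult_right integrable_poisson_indicator) auto
  qed (use assms in auto)
  also have "\<dots> = F l + F y * measure (poisson Y) {u. \<eta> \<le> \<bar>u\<bar>}"
    using assms by (intro integral_poisson_affine_indicator) auto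
  also have "\<dots> \<le> F l + F y * (4 * Y / \<eta>)"
    using measure_poisson_tail[of Y \<eta>] assms Fy by (intro add_left_mono mult_left_mono) auto
  finally show ?thesis .
qed

text \<open>The three summands bound, in this order, the contribution of second differences near
  \<open>t\<close>, of distant points where \<open>\<bar>g\<bar>\<close> is at least half of
  \<open>\<bar>g t\<bar>\<close>, and of distant points where it is smaller.\<close>

definition CP :: real where
  "CP = 4 * (2 powr a1 * (4 * b * D\<^sup>2 + 2 * a1 * D * A)) / D + 8 * D * 2 powr a1 + 4 * D\<^sup>2 * c"

lemma CP_nonneg: "CP \<ge> 0"
  using params unfolding CP_def by (intro add_nonneg_nonneg mult_nonneg_nonneg divide_nonneg_nonneg) auto

text \<open>Within \<open>\<bar>g t\<bar> / (2 D)\<close> of \<open>t\<close> the function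
  \<open>g\<close> keeps its sign and at least half its size, so the untruncated
  \<open>F \<bar>g\<bar>\<close> is twice differentiable there with controlled second
  derivative.\<close>

lemma \<Phi>_second_difference:
  assumes y: "0 < y" "y \<le> A" and x: "y < \<bar>g t\<bar>" and u: "\<bar>u\<bar> < \<bar>g t\<bar> / (2 * D)"
  shows "\<Phi> y (t + u) + \<Phi> y (t - u) - 2 * \<Phi> y t
     \<le> 2 powr a1 * (4 * b * D\<^sup>2 + 2 * a1 * D * A) * (F \<bar>g t\<bar> / \<bar>g t\<bar>\<^sup>2) * u\<^sup>2"
proof -
  define x where "x = \<bar>g t\<bar>"
  have x: "0 < x" "y < x" "x \<le> A" using y x g_bound[of t] by (auto simp: x_def)
  define e where "e = sgn (g t)"
  have e: "\<bar>e\<bar> = 1" "e * e = 1" using x by (auto simp: e_def x_def sgn_if)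
  define \<sigma> where "\<sigma> = x / (2 * D)"
  have near: "e * g s = \<bar>g s\<bar>" "x / 2 < \<bar>g s\<bar>" if s: "\<bar>s - t\<bar> < \<sigma>" for s
  proof -
    have "\<bar>g s - g t\<bar> \<le> D * \<bar>s - t\<bar>" by (rule g_lipschitz)
    also have "\<dots> < D * \<sigma>" using s params by simp
    also have "\<dots> = x / 2" using params by (simp add: \<sigma>_def)
    finally have *: "\<bar>g s - g t\<bar> < x / 2" .
    show "x / 2 < \<bar>g s\<bar>" using * unfolding x_def by linarith
    show "e * g s = \<bar>g s\<bar>" using * x(1) by (auto simp: x_def e_def sgn_if abs_if split: if_splits)
  qed
  define h where "h = (\<lambda>s. F (e * g s))"
  define h' where "h' = (\<lambda>s. F' (e * g s) * (e * g' s))"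
  define h'' where "h'' = (\<lambda>s. F'' (e * g s) * (e * g' s)\<^sup>2 + F' (e * g s) * (e * g'' s))"
  define K where "K = 2 powr a1 * (4 * b * D\<^sup>2 + 2 * a1 * D * A) * (F x / x\<^sup>2)"
  have img: "(\<lambda>s. e * g s) ` ball t \<sigma> \<subseteq> {0<..A}"
    using near g_bound x by (fastforce simp: dist_real_def abs_minus_commute)
  have open_ball: "at s within ball t \<sigma> = at s" if "\<bar>s - t\<bar> < \<sigma>" for s
    using that by (intro at_within_open) (auto simp: dist_real_def abs_minus_commute)
  have eg: "((\<lambda>s. e * g s) has_real_derivative e * g' s) (at s within ball t \<sigma>)" for s
    using g_deriv[of s] by (intro DERIV_cmult) (auto intro: has_field_derivative_at_within)
  have rng: "0 < e * g s" "e * g s \<le> A" if "\<bar>s - t\<bar> < \<sigma>" for s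
    using near[OF that] x g_bound[of s] by auto
  have d1: "(h has_real_derivative h' s) (at s)" if s: "\<bar>s - t\<bar> < \<sigma>" for s
  proof -
    have "(F has_real_derivative F' (e * g s)) (at (e * g s) within (\<lambda>s. e * g s) ` ball t \<sigma>)"
      using F_deriv[of "e * g s"] rng[OF s] img by (blast intro: DERIV_subset)
    from DERIV_image_chain[OF this eg] show ?thesis
      by (simp add: h_def h'_def o_def open_ball[OF s])
  qed
  have F'g: "((\<lambda>s. F' (e * g s)) has_real_derivative F'' (e * g s) * (e * g' s)) (at s)"
    if s: "\<bar>s - t\<bar> < \<sigma>" for s
  proof -
    have "(F' has_real_derivative F'' (e * g s)) (at (e * g s) within (\<lambda>s. e * g s) ` ball t \<sigma>)"
      using F'_deriv[of "e * g s"] rng[OF s] img by (blast intro: DERIV_subset)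
    from DERIV_image_chain[OF this eg] show ?thesis by (simp add: o_def open_ball[OF s])
  qed
  have d2: "(h' has_real_derivative h'' s) (at s)" if s: "\<bar>s - t\<bar> < \<sigma>" for s
    unfolding h'_def h''_def
    by (rule derivative_eq_intros F'g[OF s] g'_deriv refl)+ (simp add: power2_eq_square mult_ac)
  have K: "\<bar>h'' s\<bar> \<le> K" if s: "\<bar>s - t\<bar> < \<sigma>" for s
  proof -
    define z where "z = e * g s"
    have z: "x / 2 < z" "z \<le> A" "0 < z" using near[OF s] rng[OF s] x by (auto simp: z_def)
    have Fz: "F z \<le> 2 powr a1 * F x"
    proof -
      have "F z \<le> F (x / 2)" using z x by (intro F_antimono) auto
      also have "\<dots> \<le> (x / (x / 2)) powr a1 * F x" using x by (intro F_scale) auto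
      finally show ?thesis using x by simp
    qed
    have Fz0: "F z > 0" "F x > 0" using F_pos z x by auto
    have g1: "\<bar>e * g' s\<bar> \<le> D" "\<bar>e * g'' s\<bar> \<le> D"
      using g'_bound[of s] g''_bound[of s] e by (auto simp: abs_mult)
    have "\<bar>F'' z\<bar> \<le> b * F z / z\<^sup>2" using F''_bound[of z] z by (simp add: field_simps)
    also have "\<dots> \<le> b * (2 powr a1 * F x) / (x / 2)\<^sup>2"
      using Fz Fz0 z x params by (intro frac_le mult_left_mono power_mono) auto
    finally have 1: "\<bar>F'' z\<bar> \<le> 4 * b * 2 powr a1 * (F x / x\<^sup>2)" by (simp add: power_divide mult_ac)
    have F'0: "- F' z \<ge> 0"
    proof -
      have "0 \<le> a2 * F z" using Fz0 params by simp
      hence "0 \<le> - F' z * z" using F'_lower[of z] z by linarith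
      thus ?thesis using z by (simp add: mult_le_0_iff)
    qed
    have "- F' z \<le> a1 * F z / z" using F'_upper[of z] z by (simp add: field_simps)
    also have "\<dots> \<le> a1 * (2 powr a1 * F x) / (x / 2)"
      using Fz Fz0 z x params by (intro frac_le mult_left_mono) auto
    also have "\<dots> = 2 * a1 * 2 powr a1 * (F x / x\<^sup>2) * x" using x by (simp add: power2_eq_square)
    also have "\<dots> \<le> 2 * a1 * 2 powr a1 * (F x / x\<^sup>2) * A"
      using x Fz0 params by (intro mult_left_mono) auto
    finally have 2: "\<bar>F' z\<bar> \<le> 2 * a1 * 2 powr a1 * (F x / x\<^sup>2) * A" using F'0 by simp
    have "\<bar>h'' s\<bar> \<le> \<bar>F'' z\<bar> * \<bar>e * g' s\<bar>\<^sup>2 + \<bar>F' z\<bar> * \<bar>e * g'' s\<bar>"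
      unfolding h''_def z_def[symmetric] using abs_triangle_ineq[of "F'' z * (e * g' s)\<^sup>2" "F' z * (e * g'' s)"]
      by (simp add: abs_mult power_mult_distrib)
    also have "\<dots> \<le> (4 * b * 2 powr a1 * (F x / x\<^sup>2)) * D\<^sup>2 + (2 * a1 * 2 powr a1 * (F x / x\<^sup>2) * A) * D"
    proof (intro add_mono mult_mono 1 2 g1 power_mono)
      show "0 \<le> 4 * b * 2 powr a1 * (F x / x\<^sup>2)" "0 \<le> 2 * a1 * 2 powr a1 * (F x / x\<^sup>2) * A"
        using Fz0 params by auto
    qed auto
    also have "\<dots> = K" by (simp add: K_def algebra_simps)
    finally show ?thesis .
  qed
  have us: "\<bar>u\<bar> < \<sigma>" using u by (simp add: \<sigma>_def x_def)
  have "h (t + u) + h (t - u) - 2 * h t \<le> K * u\<^sup>2"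
    by (rule second_difference_le[OF d1 d2 K us])
  \<comment> \<open>Truncation only lowers the potential and has no effect at \<open>t\<close>
    itself, so the second difference at \<open>t\<close> can only become smaller.\<close>
  moreover have "\<Phi> y s \<le> h s" if s: "\<bar>s - t\<bar> < \<sigma>" for s
    unfolding \<Phi>_def h_def near(1)[OF s] using near[OF s] x y g_bound[of s] by (intro F_antimono) auto
  hence "\<Phi> y (t + u) \<le> h (t + u)" "\<Phi> y (t - u) \<le> h (t - u)" using us by auto
  moreover have "\<Phi> y t = h t"
    using near(1)[of t] us x by (simp add: \<Phi>_def h_def x_def max_def)
  ultimately show ?thesis by (simp add: K_def x_def)
qed

text \<open>If \<open>\<bar>g t\<bar> \<le> y\<close>, the potential is maximal at \<open>t\<close>.
  Otherwise the symmetric kernel turns the claim into a bound for second differences: quadratic in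
  \<open>u\<close> near \<open>t\<close>, crude elsewhere. Each contribution is a multiple of
  \<open>F x / x\<close> or of \<open>F y / y\<close>, times \<open>Y\<close>, where
  \<open>x = \<bar>g t\<bar>\<close>; the monotonicity of \<open>F x / x\<close> unifies
  them.\<close>

lemma integral_poisson_\<Phi>_le:
  assumes y: "0 < y" "y \<le> A" and Y: "0 < Y" "Y \<le> 1"
  shows "avg Y (\<Phi> y) t \<le> \<Phi> y t + CP * (F y / y) * Y"
proof (cases "\<bar>g t\<bar> \<le> y")
  case True
  interpret finite_measure "poisson Y" using Y(1) by (rule finite_measure_poisson)
  have N: "F y / y > 0" using F_pos y by simp
  have "avg Y (\<Phi> y) t \<le> (LINT u|poisson Y. F y)"
    using y Y by (intro integral_mono \<Phi>_integrable \<Phi>_le) auto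
  also have "\<dots> = \<Phi> y t" using True Y(1) by (simp add: \<Phi>_def max_def measure_poisson_UNIV)
  finally have "avg Y (\<Phi> y) t \<le> \<Phi> y t" .
  moreover have "0 \<le> CP * (F y / y) * Y" using CP_nonneg N Y by (intro mult_nonneg_nonneg) auto
  ultimately show ?thesis by linarith
next
  case False
  interpret finite_measure "poisson Y" using Y(1) by (rule finite_measure_poisson)
  define x where "x = \<bar>g t\<bar>"
  have x: "0 < x" "y < x" "x \<le> A" using y False g_bound[of t] by (auto simp: x_def)
  define N where "N = F y / y"
  have Fx: "F x > 0" "F y > 0" using F_pos x y by auto
  have FxN: "F x / x \<le> N" unfolding N_def using x y by (intro F_div_antimono) auto
  define \<sigma> where "\<sigma> = x / (2 * D)"
  have \<sigma>: "\<sigma> > 0" using x params by (simp add: \<sigma>_def)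
  define K where "K = 2 powr a1 * (4 * b * D\<^sup>2 + 2 * a1 * D * A)"
  have K0: "K \<ge> 0" using params by (simp add: K_def)
  define S where "S = (\<lambda>v::real. {u. \<bar>u\<bar> \<ge> \<sigma> \<and> \<bar>g (t + v * u)\<bar> < x / 2})"
  have [measurable]: "S v \<in> sets borel" for v unfolding S_def by measurable
  \<comment> \<open>Where \<open>\<bar>g\<bar> < x / 2\<close> the potential can be much larger than
    \<open>F x\<close>, but is at most \<open>N x\<close>, because \<open>F m / m \<le> N\<close>
    for \<open>m \<ge> y\<close>. The set of such points has Poisson mass of order
    \<open>Y / x\<close>, so it costs \<open>N Y\<close>.\<close>
  have far: "\<Phi> y (t + v * u) \<le> 2 powr a1 * F x + N * x * indicator (S v) u" if u: "\<bar>u\<bar> \<ge> \<sigma>" for u v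
  proof (cases "\<bar>g (t + v * u)\<bar> < x / 2")
    case True
    define m where "m = max \<bar>g (t + v * u)\<bar> y"
    have m: "y \<le> m" "m \<le> x" "0 < m" "m \<le> A" using True x y by (auto simp: m_def)
    have "F m / m \<le> N" unfolding N_def using m y by (intro F_div_antimono) auto
    hence "F m \<le> N * m" using m by (simp add: field_simps)
    also have "\<dots> \<le> N * x" using m Fx y by (intro mult_left_mono) (auto simp: N_def)
    finally have "\<Phi> y (t + v * u) \<le> 0 + N * x" by (simp add: \<Phi>_def m_def)
    also have "\<dots> \<le> 2 powr a1 * F x + N * x" using Fx by (intro add_right_mono) auto
    finally show ?thesis using u True by (simp add: S_def)
  next
    case False
    have "\<Phi> y (t + v * u) \<le> F (x / 2)" using False x y by (intro \<Phi>_le_at) auto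
    also have "\<dots> \<le> (x / (x / 2)) powr a1 * F x" using x by (intro F_scale) auto
    finally show ?thesis using False x by (simp add: S_def)
  qed
  define \<beta> where "\<beta> = (\<lambda>u. K * (F x / x\<^sup>2) / 2 * (u\<^sup>2 * indicator {u. \<bar>u\<bar> < \<sigma>} u)
       + 2 powr a1 * F x * indicator {u. \<bar>u\<bar> \<ge> \<sigma>} u
       + N * x / 2 * indicator (S 1) u + N * x / 2 * indicator (S (-1)) u)"
  have pt: "(\<Phi> y (t + u) + \<Phi> y (t - u)) / 2 - \<Phi> y t \<le> \<beta> u" for u
  proof (cases "\<bar>u\<bar> < \<sigma>")
    case True
    hence "\<Phi> y (t + u) + \<Phi> y (t - u) - 2 * \<Phi> y t \<le> K * (F x / x\<^sup>2) * u\<^sup>2"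
      using \<Phi>_second_difference[of y t u] y x unfolding K_def \<sigma>_def x_def by auto
    moreover have "\<beta> u = K * (F x / x\<^sup>2) / 2 * u\<^sup>2" using True by (simp add: \<beta>_def S_def)
    ultimately show ?thesis by (simp add: field_simps)
  next
    case False
    have avg: "(q + r) / 2 - p \<le> w" if "0 \<le> p" "q \<le> k + l" "r \<le> k + m" "w = k + l / 2 + m / 2"
      for k l m p q r w :: real using that by (simp add: field_simps)
    have "\<Phi> y t \<ge> 0" using \<Phi>_nonneg y by auto
    moreover have "\<Phi> y (t + u) \<le> 2 powr a1 * F x + N * x * indicator (S 1) u"
      using far[of u 1] False by simp
    moreover have "\<Phi> y (t - u) \<le> 2 powr a1 * F x + N * x * indicator (S (-1)) u"
      using far[of u "-1"] False by simp
    moreover have "\<beta> u = 2 powr a1 * F x + N * x * indicator (S 1) u / 2 + N * x * indicator (S (-1)) u / 2"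
      using False by (simp add: \<beta>_def)
    ultimately show ?thesis by (rule avg)
  qed
  have i2: "integrable (poisson Y) (\<lambda>u. u\<^sup>2 * indicator {u. \<bar>u\<bar> < \<sigma>} u)"
    using Y by (intro integrable_poisson_bounded[where B="pi\<^sup>2"])
      (auto simp: indicator_def abs_le_square_iff[symmetric])
  have i\<beta>: "integrable (poisson Y) \<beta>" unfolding \<beta>_def using i2 Y
    by (intro Bochner_Integration.integrable_add integrable_mult_right integrable_poisson_indicator) auto
  have mS: "measure (poisson Y) (S v) \<le> 2 * Y / \<sigma>\<^sup>2 * (c * (x / 2))" if v: "v = 1 \<or> v = -1" for v
  proof -
    have 1: "measure (poisson Y) (S 1) \<le> 2 * Y / \<sigma>\<^sup>2 * (c * (x / 2))"
    proof -
      have "measure (poisson Y) (S 1) \<le> 2 * Y / \<sigma>\<^sup>2 * measure lborel (S 1 \<inter> {-pi..pi})"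
        using Y \<sigma> by (intro measure_poisson_le_far) (auto simp: S_def)
      also have "\<dots> \<le> 2 * Y / \<sigma>\<^sup>2 * (c * (x / 2))"
      proof (rule mult_left_mono)
        have "measure lborel (S 1 \<inter> {-pi..pi}) \<le> measure lborel {u \<in> {-pi..pi}. \<bar>g (t + u)\<bar> < x / 2}"
          proof (rule measure_mono_fmeasurable)
            have *: "{-pi..pi} \<in> fmeasurable lborel" by (intro fmeasurableI) auto
            show "{u \<in> {-pi..pi}. \<bar>g (t + u)\<bar> < x / 2} \<in> fmeasurable lborel"
              by (rule fmeasurableI2[OF *]) auto
          qed (auto simp: S_def)
        also have "\<dots> \<le> c * (x / 2)" using x by (intro g_small) auto
        finally show "measure lborel (S 1 \<inter> {-pi..pi}) \<le> c * (x / 2)" .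
      qed (use Y in simp)
      finally show ?thesis .
    qed
    have "measure (poisson Y) (S (-1)) = measure (distr (poisson Y) borel uminus) (S (-1))"
      by (simp only: distr_poisson_uminus)
    also have "\<dots> = measure (poisson Y) (S 1)"
      by (subst measure_distr) (auto simp: S_def intro!: arg_cong[where f="measure _"])
    finally show ?thesis using v 1 by auto
  qed
  have "avg Y (\<Phi> y) t = (LINT u|poisson Y. \<Phi> y (t - u))"
    using integral_poisson_symmetric[of "\<lambda>u. \<Phi> y (t + u)" Y] y by simp
  hence "avg Y (\<Phi> y) t - \<Phi> y t
      = (LINT u|poisson Y. (\<Phi> y (t + u) + \<Phi> y (t - u)) / 2 - \<Phi> y t)"
    using \<Phi>_integrable[OF y Y(1), of t] Y by (simp add: measure_poisson_UNIV)
  also have "\<dots> \<le> (LINT u|poisson Y. \<beta> u)"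
    using \<Phi>_integrable[OF y Y(1), of t] i\<beta> by (intro integral_mono pt) auto
  also have "\<dots> = K * (F x / x\<^sup>2) / 2 * (LINT u|poisson Y. u\<^sup>2 * indicator {u. \<bar>u\<bar> < \<sigma>} u)
       + 2 powr a1 * F x * measure (poisson Y) {u. \<bar>u\<bar> \<ge> \<sigma>}
       + N * x / 2 * measure (poisson Y) (S 1) + N * x / 2 * measure (poisson Y) (S (-1))"
  proof -
    have "(LINT u|poisson Y. k1 * (u\<^sup>2 * indicator {u. \<bar>u\<bar> < \<sigma>} u) + k2 * indicator {u. \<bar>u\<bar> \<ge> \<sigma>} u
       + k3 * indicator (S 1) u + k3 * indicator (S (-1)) u)
      = k1 * (LINT u|poisson Y. u\<^sup>2 * indicator {u. \<bar>u\<bar> < \<sigma>} u) + k2 * measure (poisson Y) {u. \<bar>u\<bar> \<ge> \<sigma>}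
       + k3 * measure (poisson Y) (S 1) + k3 * measure (poisson Y) (S (-1))" for k1 k2 k3
      using i2 Y integrable_poisson_indicator[of Y "S 1"] integrable_poisson_indicator[of Y "S (-1)"]
        integrable_poisson_indicator[of Y "{u. \<bar>u\<bar> \<ge> \<sigma>}"] by simp
    thus ?thesis unfolding \<beta>_def .
  qed
  also have "\<dots> \<le> K * (F x / x\<^sup>2) / 2 * (4 * Y * \<sigma>) + 2 powr a1 * F x * (4 * Y / \<sigma>)
       + N * x / 2 * (2 * Y / \<sigma>\<^sup>2 * (c * (x / 2))) + N * x / 2 * (2 * Y / \<sigma>\<^sup>2 * (c * (x / 2)))"
  proof -
    have "0 \<le> K * (F x / x\<^sup>2) / 2" "0 \<le> 2 powr a1 * F x" "0 \<le> N * x / 2"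
      using K0 Fx x y by (auto simp: N_def)
    thus ?thesis
      using integral_poisson_square_le[OF Y \<sigma>] measure_poisson_tail[OF Y \<sigma>] mS
      by (intro add_mono mult_left_mono) auto
  qed
  also have "\<dots> = K / D * (F x / x) * Y + 8 * D * 2 powr a1 * (F x / x) * Y + 4 * D\<^sup>2 * c * N * Y"
    using x params by (simp add: \<sigma>_def field_simps power2_eq_square)
  also have "\<dots> \<le> 4 * K / D * N * Y + 8 * D * 2 powr a1 * N * Y + 4 * D\<^sup>2 * c * N * Y"
  proof (intro add_mono mult_right_mono order_refl)
    have "K / D * (F x / x) \<le> 4 * K / D * (F x / x)"
      using K0 params Fx x by (intro mult_right_mono divide_right_mono) auto
    also have "\<dots> \<le> 4 * K / D * N" using FxN K0 params by (intro mult_left_mono) auto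
    finally show "K / D * (F x / x) \<le> 4 * K / D * N" .
    show "8 * D * 2 powr a1 * (F x / x) \<le> 8 * D * 2 powr a1 * N"
      using FxN params by (intro mult_left_mono) auto
  qed (use Y params Fx y in \<open>auto simp: N_def\<close>)
  also have "\<dots> = CP * N * Y" by (simp add: CP_def K_def algebra_simps)
  finally show ?thesis by (simp add: N_def)
qed

end

section \<open>Local structure of the zeros and extraction of the constants\<close>

lemma simple_zero_local:
  fixes g :: "real \<Rightarrow> real"
  assumes "(g has_real_derivative d) (at t)" "g t = 0 \<Longrightarrow> d \<noteq> 0"
  shows "\<exists>e>0. (g t = 0 \<and> (\<forall>s. \<bar>s - t\<bar> < e \<longrightarrow> e * \<bar>s - t\<bar> \<le> \<bar>g s\<bar>)) \<or> (\<forall>s. \<bar>s - t\<bar> < e \<longrightarrow> e \<le> \<bar>g s\<bar>)"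
proof (cases "g t = 0")
  case True
  hence d: "d \<noteq> 0" using assms by simp
  have "((\<lambda>s. \<bar>(g s - g t) / (s - t)\<bar>) \<longlongrightarrow> \<bar>d\<bar>) (at t)"
    using assms(1) unfolding has_field_derivative_iff by (intro tendsto_rabs)
  hence "eventually (\<lambda>s. \<bar>(g s - g t) / (s - t)\<bar> > \<bar>d\<bar> / 2) (at t)"
    using d by (intro order_tendstoD) auto
  then obtain r where r: "r > 0" "\<And>s. s \<noteq> t \<Longrightarrow> dist s t < r \<Longrightarrow> \<bar>(g s - g t) / (s - t)\<bar> > \<bar>d\<bar> / 2"
    unfolding eventually_at by auto
  define e where "e = min r (\<bar>d\<bar> / 2)"
  have "e * \<bar>s - t\<bar> \<le> \<bar>g s\<bar>" if "\<bar>s - t\<bar> < e" for s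
  proof (cases "s = t")
    case False
    have "\<bar>g s / (s - t)\<bar> > \<bar>d\<bar> / 2" using r(2)[of s] False that True by (simp add: e_def dist_real_def)
    hence "\<bar>d\<bar> / 2 < \<bar>g s\<bar> / \<bar>s - t\<bar>" by (simp only: abs_divide)
    moreover have "e \<le> \<bar>d\<bar> / 2" by (simp add: e_def)
    ultimately have "e \<le> \<bar>g s\<bar> / \<bar>s - t\<bar>" by (meson less_imp_le order_trans)
    thus ?thesis using False by (simp add: pos_le_divide_eq)
  qed auto
  moreover have "e > 0" using r d by (simp add: e_def)
  ultimately show ?thesis using True by blast
next
  case False
  have "isCont g t" using assms(1) by (rule DERIV_isCont)
  hence "((\<lambda>s. \<bar>g s\<bar>) \<longlongrightarrow> \<bar>g t\<bar>) (at t)" unfolding isCont_def by (intro tendsto_rabs)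
  hence "eventually (\<lambda>s. \<bar>g s\<bar> > \<bar>g t\<bar> / 2) (at t)" using False by (intro order_tendstoD) auto
  then obtain r where r: "r > 0" "\<And>s. s \<noteq> t \<Longrightarrow> dist s t < r \<Longrightarrow> \<bar>g s\<bar> > \<bar>g t\<bar> / 2"
    unfolding eventually_at by auto
  define e where "e = min r (\<bar>g t\<bar> / 2)"
  have "e \<le> \<bar>g s\<bar>" if "\<bar>s - t\<bar> < e" for s
    using r(2)[of s] that False by (cases "s = t") (auto simp: e_def dist_real_def)
  moreover have "e > 0" using r False by (simp add: e_def)
  ultimately show ?thesis by blast
qed

text \<open>A Lebesgue number argument. A single centre \<open>z\<close> serves all indices: factors
  that get small near \<open>t\<close> vanish at one common point, and the remaining ones stay
  bounded away from zero. This is what makes a comparison between several factors possible near a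
  zero of the product.\<close>

lemma zero_structure:
  fixes g d :: "'i \<Rightarrow> real \<Rightarrow> real"
  assumes I: "finite I" and K: "compact K"
    and der: "\<And>i t. i \<in> I \<Longrightarrow> (g i has_real_derivative d i t) (at t)"
    and simple: "\<And>i t. i \<in> I \<Longrightarrow> g i t = 0 \<Longrightarrow> d i t \<noteq> 0"
  obtains e where "e > 0" "\<And>t. t \<in> K \<Longrightarrow> \<exists>z. \<forall>i\<in>I.
     (g i z = 0 \<and> (\<forall>s. \<bar>s - t\<bar> < e \<longrightarrow> e * \<bar>s - z\<bar> \<le> \<bar>g i s\<bar>)) \<or> (\<forall>s. \<bar>s - t\<bar> < e \<longrightarrow> e \<le> \<bar>g i s\<bar>)"
proof -
  define Q where "Q = (\<lambda>e i z. (g i z = 0 \<and> (\<forall>s. \<bar>s - z\<bar> < e \<longrightarrow> e * \<bar>s - z\<bar> \<le> \<bar>g i s\<bar>))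
      \<or> (\<forall>s. \<bar>s - z\<bar> < e \<longrightarrow> e \<le> \<bar>g i s\<bar>))"
  have Q_mono: "Q e' i z" if "Q e i z" "0 < e'" "e' \<le> e" for e e' i z
  proof -
    have "e' * \<bar>s - z\<bar> \<le> e * \<bar>s - z\<bar>" for s using that by (intro mult_right_mono) auto
    thus ?thesis using that unfolding Q_def by (meson less_le_trans order_trans)
  qed
  have "\<exists>e>0. \<forall>i\<in>I. Q e i z" for z
  proof -
    have "\<forall>i\<in>I. \<exists>e>0. Q e i z"
      unfolding Q_def using simple_zero_local[OF der simple] by blast
    then obtain f where f: "\<And>i. i \<in> I \<Longrightarrow> f i > 0 \<and> Q (f i) i z" by metis
    define e where "e = Min (insert 1 (f ` I))"
    have "e > 0" using I f by (simp add: e_def)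
    moreover have "e \<le> f i" if "i \<in> I" for i unfolding e_def using I that by (intro Min_le) auto
    ultimately show ?thesis using f Q_mono by blast
  qed
  then obtain r where r: "\<And>z. r z > 0" "\<And>z i. i \<in> I \<Longrightarrow> Q (r z) i z" by metis
  have "K \<subseteq> (\<Union>z\<in>K. ball z (r z / 2))" using r by force
  then obtain T where T: "T \<subseteq> K" "finite T" "K \<subseteq> (\<Union>z\<in>T. ball z (r z / 2))"
    using compactE_image[OF K, of K "\<lambda>z. ball z (r z / 2)"] by auto
  define e where "e = Min (insert 1 ((\<lambda>z. r z / 2) ` T))"
  have e: "e > 0" using T r by (simp add: e_def)
  have le: "e \<le> r z / 2" if "z \<in> T" for z unfolding e_def using T that by (intro Min_le) auto
  show ?thesis
  proof (rule that[OF e])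
    fix t assume "t \<in> K"
    then obtain z where z: "z \<in> T" "\<bar>t - z\<bar> < r z / 2"
      using T by (auto simp: dist_real_def abs_minus_commute)
    have near: "\<bar>s - z\<bar> < r z" if "\<bar>s - t\<bar> < e" for s using le[OF z(1)] z(2) that by (simp add: abs_if split: if_splits)
    have "e \<le> r z" using le[OF z(1)] r(1)[of z] by simp
    hence "e * \<bar>s - z\<bar> \<le> r z * \<bar>s - z\<bar>" for s by (intro mult_right_mono) auto
    thus "\<exists>z. \<forall>i\<in>I. (g i z = 0 \<and> (\<forall>s. \<bar>s - t\<bar> < e \<longrightarrow> e * \<bar>s - z\<bar> \<le> \<bar>g i s\<bar>))
        \<or> (\<forall>s. \<bar>s - t\<bar> < e \<longrightarrow> e \<le> \<bar>g i s\<bar>)"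
      using r(2)[of _ z] near \<open>e \<le> r z\<close> unfolding Q_def
      by (intro exI[of _ z]) (meson order_trans)
  qed
qed

lemma periodic_int_shift:
  fixes g :: "real \<Rightarrow> 'a"
  assumes "\<And>t. g (t + 2 * pi) = g t"
  shows "g (t + 2 * pi * of_int k) = g t"
proof -
  have n: "g (t + 2 * pi * real n) = g t" for t n
  proof (induction n)
    case (Suc n)
    have "t + 2 * pi * real (Suc n) = (t + 2 * pi * real n) + 2 * pi" by (simp add: algebra_simps)
    thus ?case using assms Suc by metis
  qed auto
  show ?thesis
  proof (cases "k \<ge> 0")
    case True
    thus ?thesis using n[of t "nat k"] by simp
  next
    case False
    have "t = (t + 2 * pi * of_int k) + 2 * pi * real (nat (- k))" using False by simp
    thus ?thesis using n by metis
  qed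
qed

text \<open>Near a simple zero \<open>\<bar>g\<bar> < l\<close> confines the point to an interval of
  length proportional to \<open>l\<close>; compactness bounds the number of local pieces, and
  periodicity reduces all translates to one compact set.\<close>

lemma measure_small_values:
  fixes g d :: "real \<Rightarrow> real"
  assumes der: "\<And>t. (g has_real_derivative d t) (at t)"
    and simple: "\<And>t. g t = 0 \<Longrightarrow> d t \<noteq> 0" and per: "\<And>t. g (t + 2 * pi) = g t"
  obtains c where "c \<ge> 0" "\<And>t l. l > 0 \<Longrightarrow> measure lborel {u \<in> {-pi..pi}. \<bar>g (t + u)\<bar> < l} \<le> c * l"
proof -
  have cont: "continuous_on UNIV g" using der by (intro DERIV_continuous_on) auto
  hence [measurable]: "g \<in> borel_measurable borel" by (rule borel_measurable_continuous_onI)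
  \<comment> \<open>Contains every interval of radius \<open>pi\<close> whose centre has been
    reduced to \<open>{-pi..pi}\<close>.\<close>
  define K where "K = {-2*pi..2*pi}"
  have K: "compact K" by (simp add: K_def)
  obtain e where e: "e > 0" "\<And>t. t \<in> K \<Longrightarrow> \<exists>z. \<forall>i\<in>{()}.
     (g z = 0 \<and> (\<forall>s. \<bar>s - t\<bar> < e \<longrightarrow> e * \<bar>s - z\<bar> \<le> \<bar>g s\<bar>)) \<or> (\<forall>s. \<bar>s - t\<bar> < e \<longrightarrow> e \<le> \<bar>g s\<bar>)"
    using zero_structure[of "{()}" K "\<lambda>_. g" "\<lambda>_. d"] K der simple by auto
  have "K \<subseteq> (\<Union>t\<in>K. ball t e)" using e by force
  then obtain T where T: "T \<subseteq> K" "finite T" "K \<subseteq> (\<Union>t\<in>T. ball t e)"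
    using compactE_image[OF K, of K "\<lambda>t. ball t e"] by auto
  \<comment> \<open>\<open>2 / e\<close> is the length factor near a zero. The summand 2 covers
    balls without zeros: there the set is empty unless \<open>l > e\<close>, and then the full
    length \<open>2 e\<close> is at most \<open>2 l\<close>.\<close>
  define c where "c = real (card T) * (2 / e + 2)"
  have ballf: "ball t e \<in> fmeasurable lborel" for t
    by (rule fmeasurableI) (use emeasure_lborel_ball_finite[of t e] in auto)
  have loc: "measure lborel {s \<in> ball t e. \<bar>g s\<bar> < l} \<le> (2 / e + 2) * l" if t: "t \<in> T" and l: "l > 0" for t l
  proof -
    obtain z where "(\<forall>s. \<bar>s - t\<bar> < e \<longrightarrow> e * \<bar>s - z\<bar> \<le> \<bar>g s\<bar>) \<or> (\<forall>s. \<bar>s - t\<bar> < e \<longrightarrow> e \<le> \<bar>g s\<bar>)"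
      using e(2)[of t] t T by auto
    thus ?thesis
    proof
      assume *: "\<forall>s. \<bar>s - t\<bar> < e \<longrightarrow> e * \<bar>s - z\<bar> \<le> \<bar>g s\<bar>"
      have "\<bar>s - z\<bar> \<le> l / e" if "s \<in> ball t e" "\<bar>g s\<bar> < l" for s
      proof -
        have "e * \<bar>s - z\<bar> \<le> l" using * that by (auto simp: dist_real_def abs_minus_commute)
        thus ?thesis using e by (simp add: field_simps)
      qed
      hence "{s \<in> ball t e. \<bar>g s\<bar> < l} \<subseteq> {z - l / e..z + l / e}" by (auto simp: abs_le_iff) (smt (verit))+
      hence "measure lborel {s \<in> ball t e. \<bar>g s\<bar> < l} \<le> measure lborel {z - l / e..z + l / e}"
        by (intro measure_mono_fmeasurable fmeasurableI) (auto simp: emeasure_lborel_Icc_eq)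
      also have "\<dots> = 2 / e * l" using l e by simp
      also have "\<dots> \<le> (2 / e + 2) * l" using l by (intro mult_right_mono) auto
      finally show ?thesis .
    next
      assume *: "\<forall>s. \<bar>s - t\<bar> < e \<longrightarrow> e \<le> \<bar>g s\<bar>"
      show ?thesis
      proof (cases "l \<le> e")
        case True
        hence "{s \<in> ball t e. \<bar>g s\<bar> < l} = {}" using * by (force simp: dist_real_def abs_minus_commute)
        thus ?thesis using l e(1) by (simp only:) simp
      next
        case False
        have "measure lborel {s \<in> ball t e. \<bar>g s\<bar> < l} \<le> measure lborel (ball t e)"
          by (intro measure_mono_fmeasurable ballf) auto
        also have "\<dots> = 2 * e" using e by (simp add: ball_eq_greaterThanLessThan)
        also have "\<dots> \<le> (2 / e + 2) * l" using False l e by (intro mult_mono) auto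
        finally show ?thesis .
      qed
    qed
  qed
  have small: "measure lborel {s \<in> K. \<bar>g s\<bar> < l} \<le> c * l" if l: "l > 0" for l
  proof -
    have "measure lborel {s \<in> K. \<bar>g s\<bar> < l} \<le> measure lborel (\<Union>t\<in>T. {s \<in> ball t e. \<bar>g s\<bar> < l})"
    proof (rule measure_mono_fmeasurable)
      show "(\<Union>t\<in>T. {s \<in> ball t e. \<bar>g s\<bar> < l}) \<in> fmeasurable lborel"
        using T(2)
      proof (intro fmeasurable.finite_UN)
        fix t
        show "{s \<in> ball t e. \<bar>g s\<bar> < l} \<in> fmeasurable lborel" by (rule fmeasurableI2[OF ballf]) auto
      qed auto
      show "{s \<in> K. \<bar>g s\<bar> < l} \<in> sets lborel" by (simp add: K_def)
      show "{s \<in> K. \<bar>g s\<bar> < l} \<subseteq> (\<Union>t\<in>T. {s \<in> ball t e. \<bar>g s\<bar> < l})" using T(3) by blast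
    qed
    also have "\<dots> \<le> (\<Sum>t\<in>T. measure lborel {s \<in> ball t e. \<bar>g s\<bar> < l})"
      using T by (intro measure_UNION_le) auto
    also have "\<dots> \<le> (\<Sum>t\<in>T. (2 / e + 2) * l)" by (intro sum_mono loc l)
    also have "\<dots> = c * l" by (simp add: c_def)
    finally show ?thesis .
  qed
  show ?thesis
  proof (rule that)
    show "c \<ge> 0" using e by (simp add: c_def)
    fix t l :: real assume l: "l > 0"
    define k where "k = \<lfloor>(t + pi) / (2 * pi)\<rfloor>"
    define t' where "t' = t - 2 * pi * of_int k"
    have "of_int k \<le> (t + pi) / (2 * pi)" "(t + pi) / (2 * pi) < of_int k + 1" unfolding k_def by linarith+
    hence "of_int k * (2 * pi) \<le> t + pi" "t + pi < (of_int k + 1) * (2 * pi)"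
      by (simp_all add: pos_le_divide_eq pos_divide_less_eq)
    hence t': "-pi \<le> t'" "t' \<le> pi" by (auto simp: t'_def algebra_simps)
    have "g (t + u) = g (t' + u)" for u
      using periodic_int_shift[of g "t' + u" k] per by (simp add: t'_def algebra_simps)
    hence "measure lborel {u \<in> {-pi..pi}. \<bar>g (t + u)\<bar> < l} = measure lborel {u \<in> {-pi..pi}. \<bar>g (t' + u)\<bar> < l}"
      by simp
    also have "\<dots> = measure lborel ((\<lambda>u. t' + u) -` {s \<in> {t' - pi..t' + pi}. \<bar>g s\<bar> < l} \<inter> space lborel)"
      by (intro arg_cong[where f="measure lborel"]) auto
    also have "\<dots> = measure (distr lborel borel ((+) t')) {s \<in> {t' - pi..t' + pi}. \<bar>g s\<bar> < l}"
      by (subst measure_distr) auto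
    also have "\<dots> = measure lborel {s \<in> {t' - pi..t' + pi}. \<bar>g s\<bar> < l}"
      by (simp add: lborel_distr_plus)
    also have "\<dots> \<le> measure lborel {s \<in> K. \<bar>g s\<bar> < l}"
    proof (rule measure_mono_fmeasurable)
      have "K \<in> fmeasurable lborel" by (intro fmeasurableI) (auto simp: K_def)
      thus "{s \<in> K. \<bar>g s\<bar> < l} \<in> fmeasurable lborel" by (rule fmeasurableI2) (auto simp: K_def)
    qed (use t' in \<open>auto simp: K_def\<close>)
    also have "\<dots> \<le> c * l" by (rule small[OF l])
    finally show "measure lborel {u \<in> {-pi..pi}. \<bar>g (t + u)\<bar> < l} \<le> c * l" .
  qed
qed

lemma Omega_class_weight_factor:
  assumes "w \<in> Omega_class"
  obtains A a1 a2 b D c F F' F'' g g' g'' where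
    "weight_factor A a1 a2 b D c F F' F'' g g' g''"
    "\<And>t. g (t + 2 * pi) = g t" "\<And>t. g t = 0 \<Longrightarrow> g' t \<noteq> 0"
    "filterlim F at_top (at_right 0)"
    "\<And>t. w t = (if g t = 0 then 0 else exp (- F \<bar>g t\<bar>))"
proof -
  obtain A g F where A: "A > 0" and gi: "Omega_inner A g" and Fo: "Omega_outer A F"
    and w: "\<And>t. w t = (if g t = 0 then 0 else exp (- F (g t)))"
    using assms unfolding Omega_class_def by auto
  obtain d D where per: "\<And>t. g (t + 2 * pi) = g t" and gA: "\<And>t. g t \<in> {-A..A}"
    and d: "derivatives_on UNIV g d" and D: "D > 0" "\<And>t n. n \<ge> 1 \<Longrightarrow> \<bar>d n t\<bar> \<le> D ^ n * fact n"
    and simple: "\<And>t. g t = 0 \<Longrightarrow> d 1 t \<noteq> 0"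
    using gi unfolding Omega_inner_def by blast
  obtain f B a1 a2 where pos: "\<And>x. x \<in> {-A..A} - {0} \<Longrightarrow> F x > 0 \<and> F (-x) = F x"
    and lim: "filterlim F at_top (at_right 0)" and anti: "antimono_on {0<..A} F"
    and f: "derivatives_on {0<..A} F f"
    and B: "B > 0" "\<And>x n. x \<in> {0<..A} \<Longrightarrow> n \<ge> 1 \<Longrightarrow> \<bar>f n x\<bar> \<le> B ^ n * real n ^ n * F x / x ^ n"
    and a: "a1 > 0" "a2 > 0" "\<And>x. x \<in> {0<..A} \<Longrightarrow> a2 \<le> \<bar>f 1 x\<bar> * x / F x \<and> \<bar>f 1 x\<bar> * x / F x \<le> a1"
    using Fo unfolding Omega_outer_def by blast
  have g1: "(g has_real_derivative d 1 t) (at t)" for t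
  proof -
    have "d 0 = g" using d by (auto simp: derivatives_on_def)
    thus ?thesis using d unfolding derivatives_on_def by (metis One_nat_def UNIV_I)
  qed
  have g2: "(d 1 has_real_derivative d 2 t) (at t)" for t
    using d unfolding derivatives_on_def by (metis Suc_1 UNIV_I)
  have f1: "(F has_real_derivative f 1 x) (at x within {0<..A})" if x: "0 < x" "x \<le> A" for x
  proof -
    have "(f 0 has_real_derivative f 1 x) (at x within {0<..A})"
      using f x unfolding derivatives_on_def by (metis One_nat_def greaterThanAtMost_iff)
    thus ?thesis
      by (rule has_field_derivative_transform_within[of _ _ _ _ 1])
         (use f x in \<open>auto simp: derivatives_on_def\<close>)
  qed
  have f2: "(f 1 has_real_derivative f 2 x) (at x within {0<..A})" if "0 < x" "x \<le> A" for x
    using f that unfolding derivatives_on_def by (metis Suc_1 greaterThanAtMost_iff)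
  \<comment> \<open>The sign of the derivative replaces \<open>\<bar>F'\<bar>\<close> by
    \<open>- F'\<close>. The argument compares with points to the left of \<open>x\<close>, which
    lie in the domain also for \<open>x = A\<close>.\<close>
  have f1neg: "f 1 x \<le> 0" if x: "0 < x" "x \<le> A" for x
  proof (rule ccontr)
    assume "\<not> f 1 x \<le> 0"
    hence p: "f 1 x > 0" by simp
    obtain r where r: "r > 0" "\<And>h. h > 0 \<Longrightarrow> x - h \<in> {0<..A} \<Longrightarrow> h < r \<Longrightarrow> F (x - h) < F x"
      using has_real_derivative_pos_inc_left[OF f1[OF x] p] by auto
    define h where "h = min (r / 2) (x / 2)"
    have h: "h > 0" "h < r" "x - h \<in> {0<..A}" using r x by (auto simp: h_def min_def)
    have "F (x - h) < F x" using r h by auto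
    moreover have "F x \<le> F (x - h)" using anti h x by (auto simp: monotone_on_def)
    ultimately show False by simp
  qed
  obtain c where c: "c \<ge> 0" "\<And>t l. l > 0 \<Longrightarrow> measure lborel {u \<in> {-pi..pi}. \<bar>g (t + u)\<bar> < l} \<le> c * l"
    using measure_small_values[of g "d 1"] g1 simple per by blast
  \<comment> \<open>\<open>D\<close> and \<open>2 D\<^sup>2\<close> are the analyticity bounds for
    the first and second derivative. Likewise \<open>4 * B\<^sup>2\<close> below is
    \<open>B ^ n * n ^ n\<close> at \<open>n = 2\<close>.\<close>
  define D' where "D' = max 1 (max D (2 * D\<^sup>2))"
  have "weight_factor A a1 a2 (4 * B\<^sup>2) D' c F (f 1) (f 2) g (d 1) (d 2)"
  proof
    show "0 < A" "0 < a1" "0 < a2" "0 \<le> 4 * B\<^sup>2" "1 \<le> D'" "0 \<le> c" using A a c by (auto simp: D'_def)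
    show "\<bar>d 1 t\<bar> \<le> D'" for t using D(2)[of 1 t] by (simp add: D'_def)
    show "\<bar>d 2 t\<bar> \<le> D'" for t using D(2)[of 2 t] by (simp add: D'_def mult.commute)
    show "\<bar>g t\<bar> \<le> A" for t using gA[of t] by (auto simp: abs_le_iff)
    fix x assume x: "0 < x" "x \<le> A"
    show Fx: "0 < F x" using pos x by auto
    have f1a: "\<bar>f 1 x\<bar> = - f 1 x" using f1neg[OF x] by simp
    have 1: "a2 \<le> - f 1 x * x / F x" "- f 1 x * x / F x \<le> a1" using a(3)[of x] x unfolding f1a by auto
    show "a2 * F x \<le> - f 1 x * x" using 1(1) Fx by (simp only: pos_le_divide_eq)
    show "- f 1 x * x \<le> a1 * F x" using 1(2) Fx by (simp only: pos_divide_le_eq)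
    have "\<bar>f 2 x\<bar> \<le> B\<^sup>2 * 4 * F x / x\<^sup>2" using B(2)[of x 2] x by simp
    thus "\<bar>f 2 x\<bar> * x\<^sup>2 \<le> 4 * B\<^sup>2 * F x" using x by (simp add: field_simps)
  qed (use f1 f2 g1 g2 c in auto)
  moreover have "w t = (if g t = 0 then 0 else exp (- F \<bar>g t\<bar>))" for t
    using w[of t] gA[of t] pos[of "g t"] by (auto simp: abs_if)
  ultimately show ?thesis using that per simple lim by blast
qed

section \<open>Doubling measures\<close>

text \<open>The distance from \<open>t\<close> to the multiples of \<open>2 pi\<close>, a triangle
  wave. It extends functions on \<open>{0..pi}\<close> to even periodic functions on the
  line.\<close>

definition fold_angle :: "real \<Rightarrow> real" where
  "fold_angle t = arccos (cos t)"

lemma fold_angle_bounds: "0 \<le> fold_angle t" "fold_angle t \<le> pi"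
  unfolding fold_angle_def by (auto intro!: arccos_lbound arccos_ubound)

lemma fold_angle_ident: "0 \<le> t \<Longrightarrow> t \<le> pi \<Longrightarrow> fold_angle t = t"
  unfolding fold_angle_def by (rule arccos_cos)

lemma fold_angle_uminus [simp]: "fold_angle (- t) = fold_angle t"
  by (simp add: fold_angle_def)

lemma fold_angle_periodic [simp]: "fold_angle (t + 2 * pi) = fold_angle t"
  by (simp add: fold_angle_def)

text \<open>\<open>fold_angle s\<close> is at most every \<open>\<bar>s - 2 pi k\<bar>\<close>, with
  equality for some \<open>k\<close>; a distance function is 1-Lipschitz.\<close>

lemma fold_angle_lipschitz: "\<bar>fold_angle s - fold_angle t\<bar> \<le> \<bar>s - t\<bar>"
proof -
  have le: "fold_angle s \<le> \<bar>s - of_int k * (2 * pi)\<bar>" for s k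
  proof -
    have e: "cos s = cos (s - of_int k * (2 * pi))"
    proof -
      have "of_int k * (2 * pi) = (2 * pi) * of_int k" by simp
      thus ?thesis by (simp only: cos_diff cos_int_2pin sin_int_2pin mult_zero_right mult_1_right add_0_right)
    qed
    show ?thesis
    proof (cases "\<bar>s - of_int k * (2 * pi)\<bar> \<le> pi")
      case True thus ?thesis unfolding fold_angle_def e by (simp add: arccos_cos_eq_abs)
    next
      case False thus ?thesis using fold_angle_bounds(2)[of s] by simp
    qed
  qed
  have "fold_angle s - fold_angle t \<le> \<bar>s - t\<bar>" for s t
  proof -
    obtain k where "fold_angle t = \<bar>t - of_int k * (2 * pi)\<bar>"
      unfolding fold_angle_def by (rule arccos_cos_eq_abs_2pi)
    thus ?thesis using le[of s k] by linarith
  qed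
  from this[of s t] this[of t s] show ?thesis by (simp add: abs_le_iff abs_minus_commute)
qed

lemma continuous_on_fold_angle: "continuous_on UNIV fold_angle"
  unfolding fold_angle_def by (intro continuous_intros) auto

lemma fold_angle_measurable [measurable]: "fold_angle \<in> borel_measurable borel"
  by (rule borel_measurable_continuous_onI[OF continuous_on_fold_angle])

lemma ln_2_le_1: "ln 2 \<le> (1::real)"
  using ln_add_one_self_le_self[of 1] by simp

text \<open>Doubling in the angle variable. With the constant written as \<open>2 ^ m\<close>, ball
  masses grow at most like the power \<open>m\<close> of the radius, so \<open>m\<close> is the
  coefficient of all logarithmic terms below.\<close>

locale doubling_measure = finite_measure \<nu> for \<nu> :: "real measure" +
  fixes m :: nat
  assumes sets_nu [measurable_cong, simp]: "sets \<nu> = sets borel"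
    and concentrated: "measure \<nu> {0..pi} = measure \<nu> UNIV"
    and nonzero: "measure \<nu> UNIV > 0"
    and doubling: "\<And>t r. 0 \<le> t \<Longrightarrow> t \<le> pi \<Longrightarrow> r > 0 \<Longrightarrow>
      measure \<nu> (cball t (2 * r)) \<le> 2 ^ m * measure \<nu> (cball t r)"
begin

lemma doubling_pow:
  assumes "0 \<le> t" "t \<le> pi" "r > 0"
  shows "measure \<nu> (cball t (2 ^ k * r)) \<le> 2 ^ (m * k) * measure \<nu> (cball t r)"
proof (induction k)
  case (Suc k)
  have "measure \<nu> (cball t (2 ^ Suc k * r)) = measure \<nu> (cball t (2 * (2 ^ k * r)))" by (simp add: mult.assoc)
  also have "\<dots> \<le> 2 ^ m * measure \<nu> (cball t (2 ^ k * r))" using assms by (intro doubling) auto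
  also have "\<dots> \<le> 2 ^ m * (2 ^ (m * k) * measure \<nu> (cball t r))" by (intro mult_left_mono Suc) auto
  finally show ?case by (simp add: power_add mult_ac)
qed auto

lemma doubling_scale:
  assumes t: "0 \<le> t" "t \<le> pi" "r > 0" and "\<rho> \<ge> 1"
  shows "measure \<nu> (cball t (\<rho> * r)) \<le> (2 * \<rho>) ^ m * measure \<nu> (cball t r)"
proof -
  obtain n :: nat where n: "\<rho> < 2 ^ n" using real_arch_pow[of 2 \<rho>] by auto
  define k where "k = (LEAST n. \<rho> \<le> 2 ^ n)"
  have k: "\<rho> \<le> 2 ^ k" unfolding k_def by (rule LeastI[of _ n]) (use n in simp)
  have k2: "2 ^ k \<le> 2 * \<rho>"
  proof (cases k)
    case 0 thus ?thesis using assms by simp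
  next
    case (Suc j)
    have "\<not> \<rho> \<le> 2 ^ j" unfolding k_def by (rule not_less_Least) (use Suc k_def in simp)
    thus ?thesis using Suc by simp
  qed
  have "measure \<nu> (cball t (\<rho> * r)) \<le> measure \<nu> (cball t (2 ^ k * r))"
    using k assms by (intro finite_measure_mono) (auto intro!: subset_cball mult_right_mono)
  also have "\<dots> \<le> 2 ^ (m * k) * measure \<nu> (cball t r)" by (rule doubling_pow[OF t])
  also have "(2::real) ^ (m * k) = (2 ^ k) ^ m" by (simp add: power_mult[symmetric] mult.commute)
  also have "(2 ^ k) ^ m * measure \<nu> (cball t r) \<le> (2 * \<rho>) ^ m * measure \<nu> (cball t r)"
    using k2 by (intro mult_right_mono power_mono) auto
  finally show ?thesis .
qed

definition V :: "real \<Rightarrow> real \<Rightarrow> real" where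
  "V r t = measure \<nu> (cball (fold_angle t) r)"

lemma V_uminus [simp]: "V r (- t) = V r t" and V_periodic [simp]: "V r (t + 2 * pi) = V r t"
  by (simp_all add: V_def)

lemma V_le: "V r t \<le> measure \<nu> UNIV"
  unfolding V_def by (rule finite_measure_mono) auto

lemma V_shift:
  assumes "r > 0"
  shows "V r t \<le> (2 * (1 + \<bar>s - t\<bar> / r)) ^ m * V r s"
proof -
  have e: "(1 + \<bar>s - t\<bar> / r) * r = r + \<bar>s - t\<bar>" using assms by (simp add: field_simps)
  have "V r t \<le> measure \<nu> (cball (fold_angle s) ((1 + \<bar>s - t\<bar> / r) * r))"
    unfolding V_def
  proof (rule finite_measure_mono)
    have "dist (fold_angle t) (fold_angle s) \<le> \<bar>s - t\<bar>"
      using fold_angle_lipschitz[of s t] by (simp add: dist_real_def abs_minus_commute)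
    thus "cball (fold_angle t) r \<subseteq> cball (fold_angle s) ((1 + \<bar>s - t\<bar> / r) * r)"
      unfolding e subset_iff mem_cball by (metis add.commute add_mono dist_commute dist_triangle_le)
  qed simp
  also have "\<dots> \<le> (2 * (1 + \<bar>s - t\<bar> / r)) ^ m * V r s"
    unfolding V_def using assms fold_angle_bounds by (intro doubling_scale) auto
  finally show ?thesis .
qed

text \<open>A ball of radius \<open>r + pi\<close> around a point of \<open>{0..pi}\<close> carries
  the whole mass. The bound matters because the subharmonicity estimate is applied with
  \<open>- ln V\<close> as part of a bounded potential.\<close>

lemma V_lower:
  assumes "r > 0"
  shows "V r t \<ge> measure \<nu> UNIV / (2 * (1 + pi / r)) ^ m"
proof -
  have e: "(1 + pi / r) * r = r + pi" using assms by (simp add: field_simps)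
  have p: "1 + pi / r \<ge> 1" using assms by simp
  have "measure \<nu> UNIV = measure \<nu> {0..pi}" by (simp add: concentrated)
  also have "\<dots> \<le> measure \<nu> (cball (fold_angle t) ((1 + pi / r) * r))"
    unfolding e using fold_angle_bounds[of t] assms
    by (intro finite_measure_mono) (auto simp: dist_real_def)
  also have "\<dots> \<le> (2 * (1 + pi / r)) ^ m * V r t"
    unfolding V_def using assms fold_angle_bounds p by (intro doubling_scale) auto
  finally have *: "measure \<nu> UNIV \<le> V r t * (2 * (1 + pi / r)) ^ m" by (simp only: mult.commute)
  have "0 < (2 * (1 + pi / r)) ^ m" using p by (intro zero_less_power) auto
  thus ?thesis using * by (simp only: pos_divide_le_eq)
qed

lemma V_pos: "r > 0 \<Longrightarrow> V r t > 0"
  by (rule less_le_trans[OF _ V_lower])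
     (auto intro!: divide_pos_pos zero_less_power mult_pos_pos add_pos_pos nonzero)

lemma measure_cball_measurable [measurable]: "(\<lambda>t. measure \<nu> (cball t r)) \<in> borel_measurable borel"
proof -
  have "(\<lambda>t. emeasure \<nu> (cball t r)) = (\<lambda>t. \<integral>\<^sup>+ s. (if \<bar>s - t\<bar> \<le> r then 1 else 0) \<partial>\<nu>)"
  proof
    fix t
    have "emeasure \<nu> (cball t r) = (\<integral>\<^sup>+ s. indicator (cball t r) s \<partial>\<nu>)" by simp
    also have "\<dots> = (\<integral>\<^sup>+ s. (if \<bar>s - t\<bar> \<le> r then 1 else 0) \<partial>\<nu>)"
      by (intro nn_integral_cong) (auto simp: indicator_def dist_real_def abs_minus_commute)
    finally show "emeasure \<nu> (cball t r) = (\<integral>\<^sup>+ s. (if \<bar>s - t\<bar> \<le> r then 1 else 0) \<partial>\<nu>)" .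
  qed
  moreover have "(\<lambda>t. \<integral>\<^sup>+ s. (if \<bar>s - t\<bar> \<le> r then 1 else 0 :: ennreal) \<partial>\<nu>) \<in> borel_measurable borel"
    by measurable
  ultimately have [measurable]: "(\<lambda>t. emeasure \<nu> (cball t r)) \<in> borel_measurable borel" by simp
  show ?thesis unfolding measure_def by measurable
qed

lemma V_measurable [measurable]: "V r \<in> borel_measurable borel"
  unfolding V_def[abs_def] by measurable

lemma ln_V_bounded:
  assumes "r > 0"
  obtains B where "\<And>t. \<bar>ln (V r t)\<bar> \<le> B"
proof -
  define l where "l = measure \<nu> UNIV / (2 * (1 + pi / r)) ^ m"
  have l: "l > 0" unfolding l_def using assms nonzero
    by (auto intro!: divide_pos_pos zero_less_power mult_pos_pos add_pos_pos)
  have "\<bar>ln (V r t)\<bar> \<le> \<bar>ln l\<bar> + \<bar>ln (measure \<nu> UNIV)\<bar>" for t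
  proof -
    have "ln l \<le> ln (V r t)" using l V_lower[OF assms, of t] by (simp add: l_def)
    moreover have "ln (V r t) \<le> ln (measure \<nu> UNIV)"
      using V_le[of r t] V_pos[OF assms, of t] by simp
    ultimately show ?thesis by linarith
  qed
  thus ?thesis using that by blast
qed

text \<open>Doubling bounds the change of \<open>ln V\<close> by
  \<open>m ln (2 (1 + \<bar>u\<bar> / r))\<close>. The product
  \<open>(1 + Y / r) (1 + \<bar>u\<bar> / Y)\<close> separates the two scales, and
  \<open>(1 + \<bar>u\<bar> / Y)\<^sup>2\<close> is at most 8 times the Poisson denominator, whose
  mean logarithm is known. The 4 rounds up \<open>2 ln 2 + ln 8 / 2\<close>.\<close>

lemma integral_poisson_ln_V:
  assumes r: "r > 0" and Y: "0 < Y"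
  shows "(LINT u|poisson Y. - ln (V r (t + u))) \<le> - ln (V r t) + real m * (4 + ln (1 + Y / r))"
proof -
  interpret poisson: finite_measure "poisson Y" using Y by (rule finite_measure_poisson)
  obtain B where B: "\<And>t. \<bar>ln (V r t)\<bar> \<le> B" using ln_V_bounded[OF r] by blast
  define a where "a = - ln (V r t) + real m * (ln 2 + ln (1 + Y / r) + ln 8 / 2)"
  define h where "h = (\<lambda>u. a + real m / 2 * ln (poisson_denom Y u))"
  have pt: "- ln (V r (t + u)) \<le> h u" if u: "\<bar>u\<bar> \<le> pi" for u
  proof -
    have p: "poisson_denom Y u > 0" using poisson_denom_ge_1[OF Y, of u] by simp
    define x where "x = \<bar>u\<bar> / Y"
    have x: "x \<ge> 0" using Y by (simp add: x_def)
    have "(1 + x)\<^sup>2 \<le> 2 * (1 + x\<^sup>2)"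
      using sum_squares_ge_zero[of "1 - x" 0] by (simp add: power2_eq_square algebra_simps)
    also have "\<dots> \<le> 8 * (1 + u\<^sup>2 / (4 * Y\<^sup>2))" by (simp add: x_def power_divide)
    also have "\<dots> \<le> 8 * poisson_denom Y u" using poisson_denom_ge[OF Y u] by simp
    finally have "ln ((1 + x)\<^sup>2) \<le> ln (8 * poisson_denom Y u)" using x p by simp
    hence lx: "2 * ln (1 + x) \<le> ln 8 + ln (poisson_denom Y u)"
      using x p by (simp add: ln_mult_pos ln_realpow)
    have "1 + \<bar>u\<bar> / r \<le> (1 + Y / r) * (1 + x)"
      using r Y by (simp add: x_def field_simps)
    hence "ln (1 + \<bar>u\<bar> / r) \<le> ln ((1 + Y / r) * (1 + x))"
      using r Y x by (subst ln_le_cancel_iff) (auto intro!: mult_pos_pos add_pos_nonneg)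
    also have "\<dots> = ln (1 + Y / r) + ln (1 + x)"
      using r Y x by (intro ln_mult_pos add_pos_nonneg) auto
    finally have l: "ln (1 + \<bar>u\<bar> / r) \<le> ln (1 + Y / r) + (ln 8 + ln (poisson_denom Y u)) / 2" using lx by (simp add: field_simps)
    have q: "0 < 2 * (1 + \<bar>u\<bar> / r)" using r by (intro mult_pos_pos add_pos_nonneg) auto
    have "V r t \<le> (2 * (1 + \<bar>u\<bar> / r)) ^ m * V r (t + u)"
      using V_shift[OF r, of t "t + u"] by simp
    hence "ln (V r t) \<le> ln ((2 * (1 + \<bar>u\<bar> / r)) ^ m * V r (t + u))"
      using V_pos[OF r] q by (subst ln_le_cancel_iff) auto
    also have "\<dots> = real m * ln (2 * (1 + \<bar>u\<bar> / r)) + ln (V r (t + u))"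
      using V_pos[OF r] q by (subst ln_mult_pos) (auto simp: ln_realpow)
    also have "ln (2 * (1 + \<bar>u\<bar> / r)) = ln 2 + ln (1 + \<bar>u\<bar> / r)"
      using q by (subst ln_mult_pos) auto
    finally have "- ln (V r (t + u)) \<le> - ln (V r t) + real m * (ln 2 + ln (1 + \<bar>u\<bar> / r))" by simp
    also have "\<dots> \<le> - ln (V r t) + real m * (ln 2 + (ln (1 + Y / r) + (ln 8 + ln (poisson_denom Y u)) / 2))"
      using l by (intro add_left_mono mult_left_mono) auto
    also have "\<dots> = h u" by (simp add: h_def a_def algebra_simps add_divide_distrib)
    finally show ?thesis .
  qed
  have i: "integrable (poisson Y) (\<lambda>u. - ln (V r (t + u)))"
    using Y B by (intro integrable_poisson_bounded[where B=B]) auto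
  have ih: "integrable (poisson Y) h" unfolding h_def using integral_poisson_ln_poisson_denom(1)[OF Y] by simp
  have "(LINT u|poisson Y. - ln (V r (t + u))) \<le> (LINT u|poisson Y. h u)"
  proof (rule integral_mono_AE[OF i ih])
    show "AE u in poisson Y. - ln (V r (t + u)) \<le> h u"
      by (rule AE_poisson[OF pt]) (auto simp: h_def)
  qed
  also have "\<dots> = a + real m / 2 * (2 * ln ((2 + Y) / (1 + Y)))"
    unfolding h_def using integral_poisson_ln_poisson_denom[OF Y] Y by (simp add: measure_poisson_UNIV)
  also have "\<dots> = a + real m * ln ((2 + Y) / (1 + Y))" by simp
  also have "\<dots> \<le> a + real m * ln 2"
    using Y by (intro add_left_mono mult_left_mono) (auto simp: field_simps)
  also have "\<dots> = - ln (V r t) + real m * (2 * ln 2 + ln 8 / 2 + ln (1 + Y / r))"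
    by (simp add: a_def algebra_simps)
  also have "\<dots> \<le> - ln (V r t) + real m * (4 + ln (1 + Y / r))"
  proof (intro add_left_mono mult_left_mono add_right_mono)
    have "ln (8::real) = ln (2 ^ 3)" by simp
    also have "\<dots> = 3 * ln 2" by (subst ln_realpow) auto
    finally have "2 * ln 2 + ln 8 / 2 = (7 / 2) * ln (2::real)" by simp
    also have "\<dots> \<le> (7 / 2) * 1" by (intro mult_left_mono ln_2_le_1) auto
    finally show "2 * ln 2 + ln 8 / 2 \<le> (4::real)" by simp
  qed auto
  finally show ?thesis .
qed

end

section \<open>The image of the weight on the half circle and its doubling property\<close>

definition angle_measure :: "(real \<Rightarrow> real) \<Rightarrow> real measure" where
  "angle_measure u = distr (density lebesgue (\<lambda>x. ennreal (indicator {-1..1} x * u x))) borel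
     (\<lambda>x. arccos (max (-1) (min 1 x)))"

text \<open>The clamp to \<open>[-1,1]\<close> makes \<open>arccos\<close> continuous on the whole
  line; the density in \<open>angle_measure\<close> vanishes outside that interval.\<close>

lemma continuous_on_clamped_arccos: "continuous_on UNIV (\<lambda>x. arccos (max (-1) (min 1 x)))"
  by (intro continuous_intros) auto

lemma clamped_arccos_measurable [measurable]:
  "(\<lambda>x. arccos (max (-1) (min 1 x))) \<in> borel_measurable borel"
  by (rule borel_measurable_continuous_onI[OF continuous_on_clamped_arccos])

lemma clamped_arccos_measurable_lebesgue [measurable]:
  "(\<lambda>x. arccos (max (-1) (min 1 x))) \<in> borel_measurable lebesgue"
  using measurable_completion[of "\<lambda>x. arccos (max (-1) (min 1 x))" lborel borel] by simp

lemma sets_angle_measure [simp, measurable_cong]: "sets (angle_measure u) = sets borel"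
  by (simp add: angle_measure_def)

lemma space_angle_measure [simp]: "space (angle_measure u) = UNIV"
  by (simp add: angle_measure_def)

lemma weight_nonneg_on: "weight u \<Longrightarrow> J \<subseteq> {-1..1} \<Longrightarrow> 0 \<le> indicator J x * u x"
  by (cases "x \<in> J") (auto simp: weight_def)

lemma weight_integrable_on:
  assumes "weight u" "J \<in> sets lebesgue" "J \<subseteq> {-1..1}"
  shows "set_integrable lebesgue J u"
proof (rule set_integrable_subset)
  show "set_integrable lebesgue {-1..1} u" using assms by (simp add: weight_def)
qed (use assms in auto)

lemma weight_integral_nonneg:
  assumes "weight u" "J \<subseteq> {-1..1}"
  shows "0 \<le> (LINT x:J|lebesgue. u x)"
  unfolding set_lebesgue_integral_def real_scaleR_def
  by (rule Bochner_Integration.integral_nonneg) (rule weight_nonneg_on[OF assms])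

lemma weight_measurable:
  assumes "weight u"
  shows "(\<lambda>x. indicator {-1..1} x * u x) \<in> borel_measurable lebesgue"
    and "integrable lebesgue (\<lambda>x. indicator {-1..1} x * u x)"
    and "0 \<le> indicator {-1..1} x * u x"
proof -
  show "integrable lebesgue (\<lambda>x. indicator {-1..1} x * u x)"
    using assms by (simp add: weight_def set_integrable_def)
  thus "(\<lambda>x. indicator {-1..1} x * u x) \<in> borel_measurable lebesgue"
    by (rule borel_measurable_integrable)
  show "0 \<le> indicator {-1..1} x * u x" using weight_nonneg_on[OF assms] by blast
qed

lemma nn_integral_angle_measure:
  assumes "weight u" and [measurable]: "G \<in> borel_measurable borel"
  shows "(\<integral>\<^sup>+ t. G t \<partial>angle_measure u)
     = (\<integral>\<^sup>+ x. ennreal (indicator {-1..1} x * u x) * G (arccos x) \<partial>lebesgue)"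
proof -
  note [measurable] = weight_measurable(1)[OF assms(1)]
  have "(\<integral>\<^sup>+ t. G t \<partial>angle_measure u)
     = (\<integral>\<^sup>+ x. ennreal (indicator {-1..1} x * u x) * G (arccos (max (-1) (min 1 x))) \<partial>lebesgue)"
    unfolding angle_measure_def by (subst nn_integral_distr) (auto simp: nn_integral_density)
  also have "\<dots> = (\<integral>\<^sup>+ x. ennreal (indicator {-1..1} x * u x) * G (arccos x) \<partial>lebesgue)"
    by (intro nn_integral_cong) (auto simp: indicator_def max_def min_def)
  finally show ?thesis .
qed

lemma emeasure_angle_measure:
  assumes u: "weight u" and [measurable]: "S \<in> sets borel"
    and J: "J \<in> sets lebesgue" "J \<subseteq> {-1..1}" "\<And>x. x \<in> {-1..1} \<Longrightarrow> arccos x \<in> S \<longleftrightarrow> x \<in> J"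
  shows "emeasure (angle_measure u) S = ennreal (LINT x:J|lebesgue. u x)"
proof -
  have "emeasure (angle_measure u) S = (\<integral>\<^sup>+ t. indicator S t \<partial>angle_measure u)" by simp
  also have "\<dots> = (\<integral>\<^sup>+ x. ennreal (indicator {-1..1} x * u x) * indicator S (arccos x) \<partial>lebesgue)"
    by (rule nn_integral_angle_measure[OF u]) auto
  also have "\<dots> = (\<integral>\<^sup>+ x. ennreal (indicator J x * u x) \<partial>lebesgue)"
    using J by (intro nn_integral_cong) (auto simp: indicator_def)
  also have "\<dots> = ennreal (LINT x|lebesgue. indicator J x * u x)"
  proof (rule nn_integral_eq_integral)
    show "integrable lebesgue (\<lambda>x. indicator J x * u x)"
      using weight_integrable_on[OF u J(1,2)] by (simp add: set_integrable_def)
    show "AE x in lebesgue. 0 \<le> indicator J x * u x"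
      by (intro AE_I2 weight_nonneg_on u J)
  qed
  finally show ?thesis by (simp add: set_lebesgue_integral_def)
qed

lemma finite_measure_angle_measure: "weight u \<Longrightarrow> finite_measure (angle_measure u)"
  using emeasure_angle_measure[of u UNIV "{-1..1}"] by (intro finite_measureI) auto

lemma measure_angle_measure:
  assumes u: "weight u" and "S \<in> sets borel"
    and J: "J \<in> sets lebesgue" "J \<subseteq> {-1..1}" "\<And>x. x \<in> {-1..1} \<Longrightarrow> arccos x \<in> S \<longleftrightarrow> x \<in> J"
  shows "measure (angle_measure u) S = (LINT x:J|lebesgue. u x)"
proof -
  have "0 \<le> (LINT x:J|lebesgue. u x)"
    by (intro weight_integral_nonneg u J)
  thus ?thesis using emeasure_angle_measure[OF assms] by (simp add: measure_def)
qed

lemma weight_integral_mono: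
  assumes u: "weight u" and J: "J \<in> sets lebesgue" "J' \<in> sets lebesgue" "J \<subseteq> J'" "J' \<subseteq> {-1..1}"
  shows "(LINT x:J|lebesgue. u x) \<le> (LINT x:J'|lebesgue. u x)"
  unfolding set_lebesgue_integral_def
proof (rule integral_mono)
  show "integrable lebesgue (\<lambda>x. indicator J x *\<^sub>R u x)" "integrable lebesgue (\<lambda>x. indicator J' x *\<^sub>R u x)"
    using weight_integrable_on[OF u, of J] weight_integrable_on[OF u, of J'] J by (auto simp: set_integrable_def)
  show "indicator J x *\<^sub>R u x \<le> indicator J' x *\<^sub>R u x" for x
    using weight_nonneg_on[OF u J(4), of x] J(3) by (cases "x \<in> J") auto
qed

text \<open>
  Growth is only linear in \<open>k\<close> because a doubled interval cut off at \<open>\<plusminus>1\<close> is no longer concentric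
  with the original one.
\<close>

lemma doubling_iterate:
  assumes u: "weight u" and L: "L \<ge> 0"
    and dbl: "\<And>c r. r > 0 \<Longrightarrow> {c - r..c + r} \<subseteq> {-1..1} \<Longrightarrow>
        (LINT x:{c - 2 * r..c + 2 * r} \<inter> {-1..1}|lebesgue. u x) \<le> L * (LINT x:{c - r..c + r}|lebesgue. u x)"
    and ab: "-1 \<le> a" "a < b" "b \<le> 1"
  shows "(LINT x:{a - real k * (b - a) / 2..b + real k * (b - a) / 2} \<inter> {-1..1}|lebesgue. u x)
     \<le> L ^ k * (LINT x:{a..b}|lebesgue. u x)"
proof (induction k)
  case 0
  have "{a - real 0 * (b - a) / 2..b + real 0 * (b - a) / 2} \<inter> {-1..1} = {a..b}" using ab by auto
  thus ?case by (simp only: power_0 mult_1_left order_refl)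
next
  case (Suc k)
  define l where "l = b - a"
  define a' where "a' = max (-1) (a - real k * l / 2)"
  define b' where "b' = min 1 (b + real k * l / 2)"
  have l: "l > 0" using ab by (simp add: l_def)
  have kl: "real k * l / 2 \<ge> 0" using l by simp
  have a': "a' \<le> a" "-1 \<le> a'" "a' \<le> a - real k * l / 2 \<or> a' = -1" and b': "b \<le> b'" "b' \<le> 1" "b + real k * l / 2 \<le> b' \<or> b' = 1"
    using kl ab by (auto simp: a'_def b'_def)
  define c where "c = (a' + b') / 2"
  define r where "r = (b' - a') / 2"
  have r: "r > 0" "c - r = a'" "c + r = b'" using a' b' ab by (auto simp: r_def c_def field_simps)
  \<comment> \<open>One doubling of the current interval moves each end outwards by
    \<open>r\<close>, hence by at least \<open>l / 2\<close>, and ends already cut off at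
    \<open>-1\<close> or \<open>1\<close> need not move.\<close>
  have r2: "l / 2 \<le> r" using a' b' by (simp add: r_def l_def)
  have e: "c - 2 * r = a' - r" "c + 2 * r = b' + r" using r(2,3) by auto
  have s: "real (Suc k) * l / 2 = real k * l / 2 + l / 2" by (simp add: field_simps)
  have "(LINT x:{a - real (Suc k) * l / 2..b + real (Suc k) * l / 2} \<inter> {-1..1}|lebesgue. u x)
      \<le> (LINT x:{c - 2 * r..c + 2 * r} \<inter> {-1..1}|lebesgue. u x)"
  proof (rule weight_integral_mono[OF u])
    have "a' - r \<le> x" if "a - real (Suc k) * l / 2 \<le> x" "-1 \<le> x" for x
    proof (cases "a' = -1")
      case True thus ?thesis using that r(1) by linarith
    next
      case False
      hence "a' \<le> a - real k * l / 2" using a' by auto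
      thus ?thesis using that(1) r2 unfolding s by linarith
    qed
    moreover have "x \<le> b' + r" if "x \<le> b + real (Suc k) * l / 2" "x \<le> 1" for x
    proof (cases "b' = 1")
      case True thus ?thesis using that r(1) by linarith
    next
      case False
      hence "b + real k * l / 2 \<le> b'" using b' by auto
      thus ?thesis using that(1) r2 unfolding s by linarith
    qed
    ultimately show "{a - real (Suc k) * l / 2..b + real (Suc k) * l / 2} \<inter> {-1..1} \<subseteq> {c - 2 * r..c + 2 * r} \<inter> {-1..1}"
      unfolding e by auto
  qed auto
  also have "\<dots> \<le> L * (LINT x:{c - r..c + r}|lebesgue. u x)"
    using r a' b' by (intro dbl) auto
  also have "{c - r..c + r} = {a - real k * l / 2..b + real k * l / 2} \<inter> {-1..1}"
    unfolding r(2,3) by (auto simp: a'_def b'_def)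
  also have "L * (LINT x:\<dots>|lebesgue. u x) \<le> L * (L ^ k * (LINT x:{a..b}|lebesgue. u x))"
    using Suc L unfolding l_def by (intro mult_left_mono) auto
  finally show ?case by (simp add: l_def mult.assoc)
qed

text \<open>The cosine maps an arc of radius \<open>r\<close> at \<open>t\<close> to an interval of
  length comparable with \<open>r sin t + r\<^sup>2\<close>; this is the lower half of that
  statement. In \<open>2 sin (t + r / 2) sin (r / 2)\<close> the first sine is bounded below using
  \<open>sin t + cos t \<ge> 1\<close>.\<close>

lemma cos_diff_lower:
  assumes "0 \<le> t" "t \<le> pi / 2" "0 \<le> r" "r \<le> pi / 2"
  shows "cos t - cos (t + r) \<ge> (r * sin t + r\<^sup>2) / 16"
proof -
  have s: "sin (r / 2) \<ge> r / 4" using sin_ge_half[of "r / 2"] assms by simp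
  have sc: "sin t \<ge> 0" "cos t \<ge> 0" using assms by (auto intro!: sin_ge_zero cos_ge_zero)
  have c: "cos (r / 2) \<ge> 1 / 2"
  proof -
    have "cos (pi / 3) \<le> cos (r / 2)" using assms by (intro cos_monotone_0_pi_le) auto
    thus ?thesis by (simp add: cos_60)
  qed
  have "(sin t + cos t)\<^sup>2 = 1 + 2 * sin t * cos t"
    by (simp add: power2_sum)
  hence "1\<^sup>2 \<le> (sin t + cos t)\<^sup>2" using sc by simp
  hence sum: "1 \<le> sin t + cos t" using sc by (intro power2_le_imp_le[of 1]) auto
  have r4: "r / 4 \<le> 1 / 2" using assms pi_less_4 by simp
  have "sin t * (1 / 2) + cos t * (r / 4) \<le> sin t * cos (r / 2) + cos t * sin (r / 2)"
    using s c sc by (intro add_mono mult_left_mono) auto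
  also have "\<dots> = sin (t + r / 2)" by (simp add: sin_add)
  finally have low: "sin t * (1 / 2) + cos t * (r / 4) \<le> sin (t + r / 2)" .
  have "r / 4 * 1 \<le> r / 4 * (sin t + cos t)" using sum assms by (intro mult_left_mono) auto
  also have "\<dots> = sin t * (r / 4) + cos t * (r / 4)" by (simp add: algebra_simps)
  also have "\<dots> \<le> sin t * (1 / 2) + cos t * (r / 4)" using r4 sc by (intro add_right_mono mult_left_mono) auto
  finally have 1: "r / 4 \<le> sin (t + r / 2)" using low by simp
  have "0 \<le> cos t * (r / 4)" using sc assms by simp
  hence 2: "sin t / 2 \<le> sin (t + r / 2)" using low by simp
  have 3: "sin t / 4 + r / 8 \<le> sin (t + r / 2)" using 1 2 by (simp add: field_simps)
  have 0: "cos x - cos y = 2 * sin ((x + y) / 2) * sin ((y - x) / 2)" for x y :: real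
    using cos_diff_cos[of x y] by simp
  have "cos t - cos (t + r) = 2 * sin (t + r / 2) * sin (r / 2)"
    using 0[of t "t + r"] by (simp add: add_divide_distrib)
  moreover have "2 * (sin t / 4 + r / 8) * (r / 4) \<le> 2 * sin (t + r / 2) * sin (r / 2)"
    using 3 s sc assms by (intro mult_mono) auto
  moreover have "(r * sin t + r\<^sup>2) / 16 \<le> 2 * (sin t / 4 + r / 8) * (r / 4)"
  proof -
    have e: "2 * (sin t / 4 + r / 8) * (r / 4) = (2 * (r * sin t) + r\<^sup>2) / 16"
      by (simp add: field_simps power2_eq_square)
    have "r * sin t \<ge> 0" using sc assms by simp
    thus ?thesis unfolding e by (intro divide_right_mono) auto
  qed
  ultimately show ?thesis by linarith
qed

text \<open>The matching upper half, from the same product formula.\<close>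

lemma cos_diff_upper:
  assumes "0 \<le> t" "t \<le> pi" "\<bar>s - t\<bar> \<le> d"
  shows "\<bar>cos s - cos t\<bar> \<le> d * (sin t + d / 2)"
proof -
  have st: "sin t \<ge> 0" using assms by (intro sin_ge_zero)
  define e where "e = (s - t) / 2"
  have "\<bar>sin (t + e)\<bar> \<le> \<bar>sin t * cos e\<bar> + \<bar>cos t * sin e\<bar>" by (simp add: sin_add)
  also have "\<dots> \<le> sin t * 1 + 1 * \<bar>e\<bar>"
    using st abs_sin_x_le_abs_x[of e] unfolding abs_mult by (intro add_mono mult_mono) auto
  finally have 1: "\<bar>sin (t + e)\<bar> \<le> sin t + d / 2" using assms by (simp add: e_def)
  have 2: "\<bar>sin e\<bar> \<le> d / 2" using abs_sin_x_le_abs_x[of e] assms by (simp add: e_def)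
  have 0: "cos x - cos y = 2 * sin ((x + y) / 2) * sin ((y - x) / 2)" for x y :: real
    using cos_diff_cos[of x y] by simp
  have "cos s - cos t = 2 * sin (t + e) * sin (- e)"
  proof -
    have "(s + t) / 2 = t + e" "(t - s) / 2 = - e" by (simp_all add: e_def field_simps)
    thus ?thesis using 0[of s t] by (simp only:)
  qed
  hence "\<bar>cos s - cos t\<bar> = 2 * (\<bar>sin (t + e)\<bar> * \<bar>sin e\<bar>)" by (simp add: abs_mult)
  also have "\<dots> \<le> 2 * ((sin t + d / 2) * (d / 2))"
    using 1 2 st assms by (intro mult_left_mono mult_mono) auto
  also have "\<dots> = d * (sin t + d / 2)" by (simp add: algebra_simps)
  finally show ?thesis .
qed

text \<open>The arc of radius \<open>r\<close> becomes an interval \<open>[a,b]\<close> containing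
  \<open>cos t\<close> with \<open>b - a \<ge> (r sin t + r\<^sup>2) / 16\<close>, and the doubled
  arc stays within \<open>2 (r sin t + r\<^sup>2)\<close> of \<open>cos t\<close>. So finitely many
  doublings of \<open>[a,b]\<close>, in number independent of \<open>t\<close> and \<open>r\<close>,
  cover it.\<close>

lemma doubling_measure_angle_measure:
  assumes u: "doubling_weight u" and nz: "measure (angle_measure u) UNIV > 0"
  obtains m where "doubling_measure (angle_measure u) m"
proof -
  define \<nu> where "\<nu> = angle_measure u"
  have w: "weight u" using u by (simp add: doubling_weight_def)
  interpret finite_measure \<nu> unfolding \<nu>_def using w by (rule finite_measure_angle_measure)
  obtain L0 where L0: "\<And>c r. r > 0 \<Longrightarrow> {c - r..c + r} \<subseteq> {-1..1} \<Longrightarrow>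
        (LINT x:{c - 2 * r..c + 2 * r} \<inter> {-1..1}|lebesgue. u x) \<le> L0 * (LINT x:{c - r..c + r}|lebesgue. u x)"
    using u unfolding doubling_weight_def by blast
  define L where "L = max 1 L0"
  have L: "L \<ge> 1" by (simp add: L_def)
  have nn: "0 \<le> (LINT x:J|lebesgue. u x)" if "J \<subseteq> {-1..1}" for J
    by (intro weight_integral_nonneg w that)
  have dbl: "(LINT x:{c - 2 * r..c + 2 * r} \<inter> {-1..1}|lebesgue. u x) \<le> L * (LINT x:{c - r..c + r}|lebesgue. u x)"
    if "r > 0" "{c - r..c + r} \<subseteq> {-1..1}" for c r
  proof -
    have "L0 * (LINT x:{c - r..c + r}|lebesgue. u x) \<le> L * (LINT x:{c - r..c + r}|lebesgue. u x)"
      using nn that by (intro mult_right_mono) (auto simp: L_def)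
    thus ?thesis using L0[OF that] by simp
  qed
  have arc: "arccos x \<in> cball t r \<longleftrightarrow> x \<in> {cos (min pi (t + r))..cos (max 0 (t - r))}"
    if t: "0 \<le> t" "t \<le> pi" "r > 0" and x: "x \<in> {-1..1}" for t r x
  proof -
    define s where "s = arccos x"
    have s: "0 \<le> s" "s \<le> pi" "cos s = x"
      using x arccos_lbound[of x] arccos_ubound[of x] by (auto simp: s_def)
    have "s \<in> cball t r \<longleftrightarrow> max 0 (t - r) \<le> s \<and> s \<le> min pi (t + r)"
      using s by (auto simp: dist_real_def)
    also have "\<dots> \<longleftrightarrow> cos s \<le> cos (max 0 (t - r)) \<and> cos (min pi (t + r)) \<le> cos s"
      using s t by (subst (1 2) cos_mono_le_eq) auto
    finally show ?thesis using s by (auto simp: s_def)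
  qed
  have nu_cball: "measure \<nu> (cball t r) = (LINT x:{cos (min pi (t + r))..cos (max 0 (t - r))}|lebesgue. u x)"
    if t: "0 \<le> t" "t \<le> pi" "r > 0" for t r
    unfolding \<nu>_def using arc[OF t] by (intro measure_angle_measure[OF w]) auto
  \<comment> \<open>The 64 is the number of half lengths:
    \<open>2 (r sin t + r\<^sup>2) \<le> 32 (b - a) = 64 (b - a) / 2\<close>, and each doubling
    gains one half length at either end.\<close>
  have small: "measure \<nu> (cball t (2 * r)) \<le> L ^ 64 * measure \<nu> (cball t r)"
    if t: "0 \<le> t" "t \<le> pi" "0 < r" "r \<le> pi / 2" for t r
  proof -
    define a where "a = cos (min pi (t + r))"
    define b where "b = cos (max 0 (t - r))"
    have ct: "a \<le> cos t" "cos t \<le> b" unfolding a_def b_def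
      using t by (auto intro!: cos_monotone_0_pi_le)
    have st: "sin t \<ge> 0" using t by (intro sin_ge_zero)
    have len: "(r * sin t + r\<^sup>2) / 16 \<le> b - a"
    proof (cases "t \<le> pi / 2")
      case True
      have "cos t - cos (t + r) \<ge> (r * sin t + r\<^sup>2) / 16" using True t by (intro cos_diff_lower) auto
      moreover have "a = cos (t + r)" using True t by (simp add: a_def)
      ultimately show ?thesis using ct by linarith
    next
      case False
      have "cos (pi - t) - cos ((pi - t) + r) \<ge> (r * sin (pi - t) + r\<^sup>2) / 16"
        using False t by (intro cos_diff_lower) auto
      moreover have "(pi - t) + r = pi - (t - r)" by simp
      ultimately have "cos (t - r) - cos t \<ge> (r * sin t + r\<^sup>2) / 16" by simp
      moreover have "b = cos (t - r)" using False t by (simp add: b_def)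
      ultimately show ?thesis using ct by linarith
    qed
    have "0 < r * sin t + r\<^sup>2" using st t by (intro add_nonneg_pos) auto
    hence ab: "a < b" using len by simp
    have "measure \<nu> (cball t (2 * r)) = (LINT x:{cos (min pi (t + 2 * r))..cos (max 0 (t - 2 * r))}|lebesgue. u x)"
      using t by (intro nu_cball) auto
    also have "\<dots> \<le> (LINT x:{a - real 64 * (b - a) / 2..b + real 64 * (b - a) / 2} \<inter> {-1..1}|lebesgue. u x)"
    proof (rule weight_integral_mono[OF w])
      show "{cos (min pi (t + 2 * r))..cos (max 0 (t - 2 * r))} \<subseteq> {a - real 64 * (b - a) / 2..b + real 64 * (b - a) / 2} \<inter> {-1..1}"
      proof
        fix x assume x: "x \<in> {cos (min pi (t + 2 * r))..cos (max 0 (t - 2 * r))}"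
        hence x1: "x \<in> {-1..1}" by (auto intro: order_trans[OF _ cos_le_one] order_trans[OF cos_ge_minus_one])
        hence "arccos x \<in> cball t (2 * r)" using x arc[of t "2 * r" x] t by auto
        hence "\<bar>cos (arccos x) - cos t\<bar> \<le> 2 * r * (sin t + 2 * r / 2)"
          using t by (intro cos_diff_upper) (auto simp: dist_real_def abs_minus_commute)
        hence "\<bar>x - cos t\<bar> \<le> 2 * (r * sin t + r\<^sup>2)" using x1 by (simp add: power2_eq_square algebra_simps)
        also have "\<dots> \<le> real 64 * (b - a) / 2" using len by simp
        finally have "\<bar>x - cos t\<bar> \<le> real 64 * (b - a) / 2" .
        moreover have "x \<in> {a - K..b + K}" if "\<bar>x - cos t\<bar> \<le> K" for K
          using that ct by (auto simp: abs_le_iff)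
        ultimately show "x \<in> {a - real 64 * (b - a) / 2..b + real 64 * (b - a) / 2} \<inter> {-1..1}"
          using x1 by blast
      qed
    qed auto
    also have "\<dots> \<le> L ^ 64 * (LINT x:{a..b}|lebesgue. u x)"
      using ab L by (intro doubling_iterate[OF w _ dbl]) (auto simp: a_def b_def)
    also have "(LINT x:{a..b}|lebesgue. u x) = measure \<nu> (cball t r)"
      using t nu_cball[of t r] by (simp add: a_def b_def)
    finally show ?thesis .
  qed
  have conc: "measure \<nu> {0..pi} = measure \<nu> UNIV"
  proof -
    have "measure \<nu> {0..pi} = (LINT x:{-1..1}|lebesgue. u x)"
      unfolding \<nu>_def by (intro measure_angle_measure[OF w]) (auto intro: arccos_lbound arccos_ubound)
    moreover have "measure \<nu> UNIV = (LINT x:{-1..1}|lebesgue. u x)"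
      unfolding \<nu>_def by (intro measure_angle_measure[OF w]) auto
    ultimately show ?thesis by simp
  qed
  obtain m :: nat where m: "L ^ 64 < 2 ^ m" using real_arch_pow[of 2 "L ^ 64"] by auto
  have sets: "sets \<nu> = sets borel" by (simp add: \<nu>_def)
  have L64: "measure \<nu> (cball t (2 * r)) \<le> L ^ 64 * measure \<nu> (cball t r)"
    if t: "0 \<le> t" "t \<le> pi" "0 < r" for t r
  proof (cases "r \<le> pi / 2")
    case True thus ?thesis using small t by blast
  next
    \<comment> \<open>A ball of radius \<open>pi\<close> around \<open>t\<close> already carries all
      the mass, so the radius \<open>pi / 2\<close> decides.\<close>
    case False
    have "measure \<nu> (cball t (2 * r)) \<le> measure \<nu> UNIV"
      using sets by (intro finite_measure_mono) auto
    also have "\<dots> \<le> measure \<nu> (cball t (2 * (pi / 2)))"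
      unfolding conc[symmetric] using t sets by (intro finite_measure_mono) (auto simp: dist_real_def)
    also have "\<dots> \<le> L ^ 64 * measure \<nu> (cball t (pi / 2))" using t by (intro small) auto
    also have "\<dots> \<le> L ^ 64 * measure \<nu> (cball t r)"
      using False L sets by (intro mult_left_mono finite_measure_mono) (auto intro!: subset_cball)
    finally show ?thesis .
  qed
  have "doubling_measure \<nu> m"
  proof
    show "measure \<nu> (cball t (2 * r)) \<le> 2 ^ m * measure \<nu> (cball t r)"
      if t: "0 \<le> t" "t \<le> pi" "0 < r" for t r
    proof -
      have "L ^ 64 * measure \<nu> (cball t r) \<le> 2 ^ m * measure \<nu> (cball t r)"
        using m by (intro mult_right_mono) auto
      thus ?thesis using L64[OF t] by simp
    qed
  qed (use sets conc nz in \<open>auto simp: \<nu>_def\<close>)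
  thus ?thesis using that by (simp add: \<nu>_def)
qed

section \<open>The weighted Bernstein inequality on the half circle\<close>

text \<open>\<open>F y - \<Lambda> n y\<close> is positive near 0 and, for large \<open>n\<close>,
  negative at a fixed small \<open>x0\<close>. The intermediate value theorem gives a root below
  \<open>x0\<close>, where \<open>F\<close> exceeds \<open>R\<close>.\<close>

lemma (in weight_factor) truncation_level:
  assumes lim: "filterlim F at_top (at_right 0)" and "\<Lambda> > 0" "\<epsilon> > 0"
  shows "eventually (\<lambda>n. \<exists>y. 0 < y \<and> y < \<epsilon> \<and> y \<le> A \<and> F y = \<Lambda> * real n * y \<and> R < F y) sequentially"
proof -
  have "eventually (\<lambda>x. R < F x) (at_right 0)" using lim by (simp add: filterlim_at_top_dense)
  then obtain r where r: "r > 0" "\<And>x. 0 < x \<Longrightarrow> x < r \<Longrightarrow> R < F x"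
    unfolding eventually_at_right_field by auto
  define x0 where "x0 = min (r / 2) (min (\<epsilon> / 2) A)"
  have x0: "0 < x0" "x0 < r" "x0 < \<epsilon>" "x0 \<le> A" using r assms params by (auto simp: x0_def min_def)
  have "eventually (\<lambda>n. real n > F x0 / (\<Lambda> * x0)) sequentially"
    by (intro eventually_gt_at_top filterlim_at_top_dense[THEN iffD1, rule_format] filterlim_real_sequentially)
  thus ?thesis
  proof eventually_elim
    case (elim n)
    hence Fx0: "F x0 < \<Lambda> * real n * x0" using x0 assms by (simp add: pos_divide_less_eq mult_ac)
    have "eventually (\<lambda>x. \<Lambda> * real n * x0 < F x) (at_right 0)" using lim by (simp add: filterlim_at_top_dense)
    then obtain q where q: "q > 0" "\<And>x. 0 < x \<Longrightarrow> x < q \<Longrightarrow> \<Lambda> * real n * x0 < F x"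
      unfolding eventually_at_right_field by auto
    define x1 where "x1 = min (q / 2) x0"
    have x1: "0 < x1" "x1 < q" "x1 \<le> x0" using q x0 by (auto simp: x1_def min_def)
    have "\<Lambda> * real n * x1 \<le> \<Lambda> * real n * x0" using x1 assms by (intro mult_left_mono) auto
    hence Fx1: "\<Lambda> * real n * x1 < F x1" using q(2)[of x1] x1 by linarith
    have "\<exists>y\<ge>x1. y \<le> x0 \<and> F y - \<Lambda> * real n * y = 0"
    proof (rule IVT2')
      show "continuous_on {x1..x0} (\<lambda>y. F y - \<Lambda> * real n * y)"
        using x0 x1 by (intro continuous_intros continuous_on_subset[OF F_cont]) auto
    qed (use Fx0 Fx1 x1 in auto)
    then obtain y where "x1 \<le> y" "y \<le> x0" "F y = \<Lambda> * real n * y" by auto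
    thus ?case using x0 x1 r(2)[of y] by (intro exI[of _ y]) auto
  qed
qed

locale Omega_doubling = doubling_measure \<nu> m for \<nu> m +
  fixes p :: real and I :: "nat set" and A a1 a2 b D c :: "nat \<Rightarrow> real"
    and F F' F'' g g' g'' :: "nat \<Rightarrow> real \<Rightarrow> real"
  assumes p_pos: "p > 0" and I_finite: "finite I"
    and wf: "\<And>i. i \<in> I \<Longrightarrow> weight_factor (A i) (a1 i) (a2 i) (b i) (D i) (c i) (F i) (F' i) (F'' i) (g i) (g' i) (g'' i)"
    and g_periodic: "\<And>i t. i \<in> I \<Longrightarrow> g i (t + 2 * pi) = g i t"
    and g_simple: "\<And>i t. i \<in> I \<Longrightarrow> g i t = 0 \<Longrightarrow> g' i t \<noteq> 0"
    and F_lim: "\<And>i. i \<in> I \<Longrightarrow> filterlim (F i) at_top (at_right 0)"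
    and even: "\<And>i t. i \<in> I \<Longrightarrow>
      (if g i (- t) = 0 then 0 else exp (- F i \<bar>g i (- t)\<bar>)) = (if g i t = 0 then 0 else exp (- F i \<bar>g i t\<bar>))"
begin

definition w :: "nat \<Rightarrow> real \<Rightarrow> real" where
  "w i t = (if g i t = 0 then 0 else exp (- F i \<bar>g i t\<bar>))"

definition W :: "real \<Rightarrow> real" where
  "W t = (\<Prod>i\<in>I. w i t)"

abbreviation Phi :: "nat \<Rightarrow> real \<Rightarrow> real \<Rightarrow> real" where
  "Phi i y t \<equiv> weight_factor.\<Phi> (F i) (g i) y t"

definition pot :: "(nat \<Rightarrow> real) \<Rightarrow> real \<Rightarrow> real" where
  "pot y t = (\<Sum>i\<in>I. Phi i (y i) t)"

definition \<psi> :: "nat \<Rightarrow> (nat \<Rightarrow> real) \<Rightarrow> real \<Rightarrow> real" where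
  "\<psi> n y t = pot y t - ln (V (1 / real n) t)"

definition h :: "nat \<Rightarrow> (nat \<Rightarrow> real) \<Rightarrow> complex poly \<Rightarrow> real \<Rightarrow> real" where
  "h n y P t = norm (pcos P t) powr p * exp (- \<psi> n y t)"

abbreviation h_mass :: "nat \<Rightarrow> (nat \<Rightarrow> real) \<Rightarrow> complex poly \<Rightarrow> ennreal" where
  "h_mass n y P \<equiv> (\<integral>\<^sup>+ t. indicator {0..pi} t * ennreal (h n y P t) \<partial>lborel)"

abbreviation p_norm :: "complex poly \<Rightarrow> ennreal" where
  "p_norm P \<equiv> (\<integral>\<^sup>+ s. ennreal (norm (pcos P s) powr p * W s) \<partial>\<nu>)"

text \<open>The equation gives all truncated factors, whatever their \<open>F i\<close>, the common
  slope scale \<open>F i (y i) / y i = \<Lambda> n\<close>. The bound \<open>n \<ge> 4\<close> keeps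
  the height \<open>2 / n\<close> at most \<open>1/2\<close>.\<close>

definition admissible :: "real \<Rightarrow> nat \<Rightarrow> (nat \<Rightarrow> real) \<Rightarrow> bool" where
  "admissible \<Lambda> n y \<longleftrightarrow> \<Lambda> > 0 \<and> n \<ge> 4 \<and>
     (\<forall>i\<in>I. 0 < y i \<and> y i \<le> A i \<and> F i (y i) = \<Lambda> * real n * y i)"

definition C1 :: real where
  "C1 = (\<Sum>i\<in>I. weight_factor.CP (A i) (a1 i) (b i) (D i) (c i))"

definition C2 :: real where
  "C2 = (\<Sum>i\<in>I. a1 i * D i)"

lemma C2_nonneg: "C2 \<ge> 0"
proof -
  have "a1 i * D i \<ge> 0" if "i \<in> I" for i
    using weight_factor.params[OF wf[OF that]] by auto
  thus ?thesis unfolding C2_def by (rule sum_nonneg)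
qed

lemma w_bounds: "0 \<le> w i t"
  by (simp add: w_def)

lemma w_le_1: "i \<in> I \<Longrightarrow> w i t \<le> 1"
  using weight_factor.F_pos[OF wf, of i "\<bar>g i t\<bar>"] weight_factor.g_bound[OF wf, of i t] by (auto simp: w_def)

lemma W_bounds: "0 \<le> W t" "W t \<le> 1"
  unfolding W_def by (auto intro!: prod_nonneg prod_le_1 w_bounds w_le_1)

lemma w_measurable [measurable]:
  assumes "i \<in> I" shows "w i \<in> borel_measurable borel"
proof -
  have g [measurable]: "g i \<in> borel_measurable borel" by (rule weight_factor.g_measurable[OF wf[OF assms]])
  have "(\<lambda>x. indicator {0<..A i} x *\<^sub>R F i x) \<in> borel_measurable borel"
    by (rule borel_measurable_continuous_on_indicator[OF _ weight_factor.F_cont[OF wf[OF assms]]]) simp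
  hence [measurable]: "(\<lambda>x. indicator {0<..A i} x * F i x) \<in> borel_measurable borel" by simp
  have "w i = (\<lambda>t. if g i t = 0 then 0 else exp (- (\<lambda>x. indicator {0<..A i} x * F i x) \<bar>g i t\<bar>))"
    using weight_factor.g_bound[OF wf[OF assms]] by (auto simp: w_def indicator_def fun_eq_iff)
  also have "\<dots> \<in> borel_measurable borel" by measurable
  finally show ?thesis .
qed

lemma W_measurable [measurable]: "W \<in> borel_measurable borel"
  unfolding W_def[abs_def] by measurable

section \<open>The truncated potential and its averages at a fixed admissible level\<close>

context
  fixes \<Lambda> :: real and n :: nat and y :: "nat \<Rightarrow> real"
  assumes adm: "admissible \<Lambda> n y"
begin

lemma y: "i \<in> I \<Longrightarrow> 0 < y i" "i \<in> I \<Longrightarrow> y i \<le> A i" "i \<in> I \<Longrightarrow> F i (y i) = \<Lambda> * real n * y i"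
  "i \<in> I \<Longrightarrow> F i (y i) / y i = \<Lambda> * real n" "\<Lambda> > 0" "n \<ge> 4"
  using adm unfolding admissible_def by auto

lemma n_pos: "real n > 0" "1 / real n > 0" "real n \<ge> 4"
  using y(6) by auto

lemma pot_nonneg: "pot y t \<ge> 0"
  unfolding pot_def by (intro sum_nonneg weight_factor.\<Phi>_nonneg[OF wf] y)

lemma pot_le: "pot y t \<le> (\<Sum>i\<in>I. F i (y i))"
  unfolding pot_def by (intro sum_mono weight_factor.\<Phi>_le[OF wf] y)

lemma pot_measurable [measurable]: "pot y \<in> borel_measurable borel"
proof -
  have "Phi i (y i) \<in> borel_measurable borel" if "i \<in> I" for i
    using weight_factor.\<Phi>_measurable[OF wf] y that by blast
  thus ?thesis unfolding pot_def[abs_def] by measurable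
qed

lemma psi_measurable [measurable]: "\<psi> n y \<in> borel_measurable borel"
  unfolding \<psi>_def[abs_def] by measurable

lemma psi_bounded: obtains B where "\<And>t. \<bar>\<psi> n y t\<bar> \<le> B"
proof -
  obtain B where B: "\<And>t. \<bar>ln (V (1 / real n) t)\<bar> \<le> B" using ln_V_bounded n_pos(2) by blast
  have "\<bar>\<psi> n y t\<bar> \<le> (\<Sum>i\<in>I. F i (y i)) + B" for t
    using pot_nonneg[of t] pot_le[of t] B[of t] by (simp add: \<psi>_def)
  thus ?thesis using that by blast
qed

lemma exp_psi: "exp (- \<psi> n y t) = exp (- pot y t) * V (1 / real n) t"
  using V_pos[OF n_pos(2), of t] by (simp add: \<psi>_def exp_diff exp_minus field_simps)

lemma pot_lipschitz: "\<bar>pot y s - pot y t\<bar> \<le> C2 * \<Lambda> * real n * \<bar>s - t\<bar>"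
proof -
  have "\<bar>pot y s - pot y t\<bar> \<le> (\<Sum>i\<in>I. \<bar>Phi i (y i) s - Phi i (y i) t\<bar>)"
    unfolding pot_def sum_subtractf[symmetric] by (rule sum_abs)
  also have "\<dots> \<le> (\<Sum>i\<in>I. a1 i * D i * (F i (y i) / y i) * \<bar>s - t\<bar>)"
    by (intro sum_mono weight_factor.\<Phi>_lipschitz[OF wf] y)
  also have "\<dots> = (\<Sum>i\<in>I. a1 i * D i * (\<Lambda> * real n * \<bar>s - t\<bar>))"
    by (intro sum.cong refl) (simp only: y(4) mult.assoc)
  finally show ?thesis by (simp add: C2_def sum_distrib_right mult.assoc)
qed

text \<open>Evenness is known for the factor of the weight, a function of \<open>cos t\<close>,
  whereas \<open>g i\<close> need not be even. It passes to the truncation because the latter is the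
  minimum of \<open>F i \<bar>g i\<bar>\<close> and \<open>F i (y i)\<close>.\<close>

lemma Phi_even: "i \<in> I \<Longrightarrow> Phi i (y i) (- t) = Phi i (y i) t"
proof -
  assume i: "i \<in> I"
  interpret wf: weight_factor "A i" "a1 i" "a2 i" "b i" "D i" "c i" "F i" "F' i" "F'' i" "g i" "g' i" "g'' i"
    using wf[OF i] .
  have min: "wf.\<Phi> (y i) s = (if g i s = 0 then F i (y i) else min (F i \<bar>g i s\<bar>) (F i (y i)))" for s
  proof (cases "g i s = 0")
    case True thus ?thesis using y i by (simp add: wf.\<Phi>_def)
  next
    case False
    have "F i \<bar>g i s\<bar> \<le> F i (y i)" if "y i \<le> \<bar>g i s\<bar>"
      using that y i wf.g_bound[of s] by (intro wf.F_antimono) auto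
    moreover have "F i (y i) \<le> F i \<bar>g i s\<bar>" if "\<bar>g i s\<bar> \<le> y i"
      using that y i False by (intro wf.F_antimono) auto
    ultimately show ?thesis using False by (auto simp: wf.\<Phi>_def max_def min_def)
  qed
  show ?thesis using even[OF i, of t] unfolding min by (auto split: if_splits)
qed

lemma Phi_periodic: "i \<in> I \<Longrightarrow> Phi i z (t + 2 * pi) = Phi i z t"
  using weight_factor.\<Phi>_def[OF wf] g_periodic by simp

lemma psi_even: "\<psi> n y (- t) = \<psi> n y t" and psi_periodic: "\<psi> n y (t + 2 * pi) = \<psi> n y t"
  using Phi_even Phi_periodic by (auto simp: \<psi>_def pot_def)

lemma h_even: "h n y P (- t) = h n y P t" and h_periodic: "h n y P (t + 2 * pi) = h n y P t"
  by (simp_all add: h_def psi_even psi_periodic)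

lemma h_nonneg: "h n y P t \<ge> 0"
  by (simp add: h_def)

lemma h_measurable [measurable]: "h n y P \<in> borel_measurable borel"
proof -
  have [measurable]: "(\<lambda>t. pcos P t) \<in> borel_measurable borel"
    by (intro borel_measurable_continuous_onI continuous_intros)
  show ?thesis unfolding h_def[abs_def] by measurable
qed

lemma h_bounded: obtains B where "\<And>t. h n y P t \<le> B"
proof -
  obtain M where M: "M \<ge> 0" "\<And>u e. 0 \<le> e \<Longrightarrow> e \<le> 1 \<Longrightarrow> norm (poly P (of_real (cos u) + \<i> * of_real e)) \<le> M"
    using bounded_poly_cos_shift[of P] by blast
  obtain B where B: "\<And>t. \<bar>\<psi> n y t\<bar> \<le> B" using psi_bounded by blast
  have "h n y P t \<le> M powr p * exp B" for t
    unfolding h_def using M(2)[of 0 t] M(1) B[of t] p_pos by (intro mult_mono powr_mono2) auto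
  thus ?thesis using that by blast
qed

lemma h_integrable:
  assumes "Y > 0" shows "integrable (poisson Y) (\<lambda>u. h n y P (t + u))"
proof -
  obtain B where "\<And>t. h n y P t \<le> B" using h_bounded by blast
  thus ?thesis using assms h_nonneg by (intro integrable_poisson_bounded[where B=B]) auto
qed

lemma integral_poisson_psi:
  assumes Y: "0 < Y"
  shows "avg Y (\<psi> n y) t = (\<Sum>i\<in>I. LINT u|poisson Y. Phi i (y i) (t + u))
     + (LINT u|poisson Y. - ln (V (1 / real n) (t + u)))"
proof -
  have i1: "integrable (poisson Y) (\<lambda>u. Phi i (y i) (t + u))" if "i \<in> I" for i
    using weight_factor.\<Phi>_integrable(1)[OF wf] y Y that by blast
  obtain B where B: "\<And>t. \<bar>ln (V (1 / real n) t)\<bar> \<le> B" using ln_V_bounded n_pos(2) by blast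
  have i2: "integrable (poisson Y) (\<lambda>u. - ln (V (1 / real n) (t + u)))"
    using B Y by (intro integrable_poisson_bounded[where B=B]) auto
  have "avg Y (\<psi> n y) t = (LINT u|poisson Y. (\<Sum>i\<in>I. Phi i (y i) (t + u)) + (- ln (V (1 / real n) (t + u))))"
    by (simp add: \<psi>_def pot_def)
  also have "\<dots> = (LINT u|poisson Y. (\<Sum>i\<in>I. Phi i (y i) (t + u))) + (LINT u|poisson Y. - ln (V (1 / real n) (t + u)))"
    using i1 i2 by (intro Bochner_Integration.integral_add Bochner_Integration.integrable_sum) auto
  also have "(LINT u|poisson Y. (\<Sum>i\<in>I. Phi i (y i) (t + u))) = (\<Sum>i\<in>I. LINT u|poisson Y. Phi i (y i) (t + u))"
    using i1 by (intro Bochner_Integration.integral_sum)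
  finally show ?thesis .
qed

lemma integral_poisson_psi_le:
  assumes Y: "0 < Y" "Y \<le> 1"
  shows "avg Y (\<psi> n y) t \<le> \<psi> n y t + C1 * \<Lambda> * real n * Y + real m * (4 + ln (1 + Y * real n))"
proof -
  have "(\<Sum>i\<in>I. LINT u|poisson Y. Phi i (y i) (t + u))
     \<le> (\<Sum>i\<in>I. Phi i (y i) t + weight_factor.CP (A i) (a1 i) (b i) (D i) (c i) * (F i (y i) / y i) * Y)"
    using Y by (intro sum_mono weight_factor.integral_poisson_\<Phi>_le[OF wf] y)
  also have "\<dots> = (\<Sum>i\<in>I. Phi i (y i) t + weight_factor.CP (A i) (a1 i) (b i) (D i) (c i) * (\<Lambda> * real n * Y))"
    by (intro sum.cong refl) (simp only: y(4) mult.assoc)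
  also have "\<dots> = pot y t + C1 * (\<Lambda> * real n * Y)"
    by (simp add: sum.distrib pot_def C1_def sum_distrib_right)
  finally have 1: "(\<Sum>i\<in>I. LINT u|poisson Y. Phi i (y i) (t + u)) \<le> pot y t + C1 * \<Lambda> * real n * Y"
    by (simp add: mult.assoc)
  have 2: "(LINT u|poisson Y. - ln (V (1 / real n) (t + u))) \<le> - ln (V (1 / real n) t) + real m * (4 + ln (1 + Y * real n))"
    using integral_poisson_ln_V[OF n_pos(2) Y(1), of t] by simp
  show ?thesis unfolding integral_poisson_psi[OF Y(1)] using 1 2 by (simp add: \<psi>_def)
qed

lemma majorant:
  assumes "0 < Y" "\<bar>Im z\<bar> \<le> ln (1 + Y)" "degree P \<le> n"
  shows "norm (poly P (cos z)) powr p \<le> exp (2 * real n * p * Y) *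
           exp (avg Y (\<psi> n y) (Re z)) * avg Y (h n y P) (Re z)"
proof -
  obtain B where B: "\<And>t. \<bar>\<psi> n y t\<bar> \<le> B" using psi_bounded by blast
  show ?thesis unfolding h_def using assms p_pos B
    by (intro weighted_subharmonic) auto
qed

lemma integral_poisson_h_nonneg: "avg Y (h n y P) t \<ge> 0"
  by (intro Bochner_Integration.integral_nonneg h_nonneg)

lemma integral_poisson_h_measurable [measurable]:
  assumes "Y > 0" shows "(\<lambda>t. LINT u|poisson Y. h n y P (t + u)) \<in> borel_measurable borel"
proof -
  interpret poisson: finite_measure "poisson Y" using assms by (rule finite_measure_poisson)
  show ?thesis by measurable
qed

lemma nn_integral_h_full:
  "(\<integral>\<^sup>+ t. indicator {-pi..pi} t * ennreal (h n y P t) \<partial>lborel)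
    \<le> 2 * h_mass n y P"
proof -
  have "(\<integral>\<^sup>+ t. indicator {-pi..pi} t * ennreal (h n y P t) \<partial>lborel)
    \<le> (\<integral>\<^sup>+ t. indicator {0..pi} t * ennreal (h n y P t) + indicator {0..pi} (- t) * ennreal (h n y P (- t)) \<partial>lborel)"
    by (intro nn_integral_mono) (auto simp: indicator_def h_even)
  also have "\<dots> = h_mass n y P
     + (\<integral>\<^sup>+ t. indicator {0..pi} (- t) * ennreal (h n y P (- t)) \<partial>lborel)"
    by (intro nn_integral_add) auto
  also have "(\<integral>\<^sup>+ t. indicator {0..pi} (- t) * ennreal (h n y P (- t)) \<partial>lborel)
     = h_mass n y P"
    by (subst (2) nn_integral_real_affine[where c="-1" and t=0]) auto
  finally show ?thesis by (simp add: mult_2)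
qed

text \<open>By Fubini and periodicity Poisson averaging preserves the mass on the full circle, which
  by evenness is at most twice that on the half circle.\<close>

lemma nn_integral_mean_h:
  assumes Y: "Y > 0"
  shows "(\<integral>\<^sup>+ t. indicator {0..pi} t * ennreal (avg Y (h n y P) t) \<partial>lborel)
    \<le> 2 * h_mass n y P"
proof -
  interpret poisson: finite_measure "poisson Y" using Y by (rule finite_measure_poisson)
  interpret pair_sigma_finite "poisson Y" "lborel :: real measure" ..
  have "(\<integral>\<^sup>+ t. indicator {0..pi} t * ennreal (avg Y (h n y P) t) \<partial>lborel)
     = (\<integral>\<^sup>+ t. indicator {0..pi} t * (\<integral>\<^sup>+ u. ennreal (h n y P (t + u)) \<partial>poisson Y) \<partial>lborel)"
    using h_nonneg by (subst nn_integral_eq_integral[OF h_integrable[OF Y]]) auto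
  also have "\<dots> \<le> (\<integral>\<^sup>+ t. (\<integral>\<^sup>+ u. indicator {-pi..pi} t * ennreal (h n y P (t + u)) \<partial>poisson Y) \<partial>lborel)"
    by (intro nn_integral_mono) (auto simp: indicator_def)
  also have "\<dots> = (\<integral>\<^sup>+ u. (\<integral>\<^sup>+ t. indicator {-pi..pi} t * ennreal (h n y P (t + u)) \<partial>lborel) \<partial>poisson Y)"
    by (intro Fubini') measurable
  also have "\<dots> = (\<integral>\<^sup>+ u. (\<integral>\<^sup>+ t. indicator {-pi..pi} t * ennreal (h n y P t) \<partial>lborel) \<partial>poisson Y)"
  proof (rule nn_integral_cong_AE)
    show "AE u in poisson Y. (\<integral>\<^sup>+ t. indicator {-pi..pi} t * ennreal (h n y P (t + u)) \<partial>lborel)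
        = (\<integral>\<^sup>+ t. indicator {-pi..pi} t * ennreal (h n y P t) \<partial>lborel)"
    proof (rule AE_poisson)
      fix u assume "\<bar>u\<bar> \<le> pi"
      thus "(\<integral>\<^sup>+ t. indicator {-pi..pi} t * ennreal (h n y P (t + u)) \<partial>lborel)
        = (\<integral>\<^sup>+ t. indicator {-pi..pi} t * ennreal (h n y P t) \<partial>lborel)"
        using h_periodic by (intro nn_integral_periodic_shift) auto
    qed measurable
  qed
  also have "\<dots> = (\<integral>\<^sup>+ t. indicator {-pi..pi} t * ennreal (h n y P t) \<partial>lborel)"
    by (simp add: emeasure_poisson_UNIV Y)
  also note nn_integral_h_full
  finally show ?thesis .
qed

text \<open>Finiteness permits a fraction of this mass to be absorbed into the left side of an
  inequality.\<close>

lemma nn_integral_h_finite: "h_mass n y P < \<infinity>"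
proof -
  obtain B where B: "\<And>t. h n y P t \<le> B" using h_bounded by blast
  have "h_mass n y P \<le> (\<integral>\<^sup>+ t. ennreal B * indicator {0..pi} t \<partial>lborel)"
    using B by (intro nn_integral_mono) (auto simp: indicator_def intro: ennreal_leI)
  also have "\<dots> = ennreal B * ennreal pi" by (subst nn_integral_cmult_indicator) auto
  also have "\<dots> < \<infinity>" by (simp add: ennreal_mult_less_top)
  finally show ?thesis .
qed

lemma W_le: "W s \<le> exp (- pot y s)"
proof -
  have "w i s \<le> exp (- Phi i (y i) s)" if i: "i \<in> I" for i
  proof (cases "g i s = 0")
    case False
    have "Phi i (y i) s \<le> F i \<bar>g i s\<bar>"
      using False y i by (intro weight_factor.\<Phi>_le_at[OF wf]) auto
    thus ?thesis using False by (simp add: w_def)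
  qed (simp add: w_def)
  hence "W s \<le> (\<Prod>i\<in>I. exp (- Phi i (y i) s))"
    unfolding W_def by (intro prod_mono) (auto simp: w_bounds)
  also have "\<dots> = exp (- pot y s)" by (simp add: pot_def exp_sum I_finite flip: sum_negf)
  finally show ?thesis .
qed

lemma W_eq: "(\<And>i. i \<in> I \<Longrightarrow> y i \<le> \<bar>g i s\<bar>) \<Longrightarrow> W s = exp (- pot y s)"
proof -
  assume *: "\<And>i. i \<in> I \<Longrightarrow> y i \<le> \<bar>g i s\<bar>"
  have "w i s = exp (- Phi i (y i) s)" if i: "i \<in> I" for i
    using *[OF i] y(1)[OF i] weight_factor.\<Phi>_def[OF wf[OF i]] by (auto simp: w_def max_def)
  hence "W s = (\<Prod>i\<in>I. exp (- Phi i (y i) s))" unfolding W_def by (intro prod.cong) auto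
  also have "\<dots> = exp (- pot y s)" by (simp add: pot_def exp_sum I_finite flip: sum_negf)
  finally show ?thesis .
qed

end

text \<open>Height \<open>2 / n\<close>, because \<open>1 / n \<le> ln (1 + 2 / n)\<close> for
  \<open>n \<ge> 4\<close>: the complex disc of radius \<open>1 / n\<close> around \<open>t\<close>
  then lies in the strip where the majorant holds.\<close>

definition H :: "nat \<Rightarrow> (nat \<Rightarrow> real) \<Rightarrow> complex poly \<Rightarrow> real \<Rightarrow> real" where
  "H n y P t = avg (2 / real n) (h n y P) t"

text \<open>The 5 comes from Harnack's inequality and \<open>4 p\<close> from the growth
  \<open>2 n p Y\<close> at \<open>Y = 2 / n\<close>. The terms \<open>2 C1 \<Lambda>\<close> and
  \<open>m (4 + ln 3)\<close> come from averaging \<open>\<psi>\<close>, and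
  \<open>C2 \<Lambda>\<close> and \<open>m ln 4\<close> from moving \<open>\<psi>\<close> by at most
  \<open>1 / n\<close>.\<close>

definition CA :: "real \<Rightarrow> real" where
  "CA \<Lambda> = 5 * exp (4 * p + 2 * C1 * \<Lambda> + real m * (4 + ln 3) + C2 * \<Lambda> + real m * ln 4)"

lemma CA_pos: "CA \<Lambda> > 0"
  by (simp add: CA_def)

text \<open>The modulus of the derivative of \<open>P (cos s)\<close>; at \<open>x = cos s\<close>
  with \<open>s\<close> in \<open>{0..pi}\<close> it is
  \<open>phi x \<bar>P' x\<bar>\<close>.\<close>

definition deriv_size :: "complex poly \<Rightarrow> real \<Rightarrow> real" where
  "deriv_size P s = \<bar>sin s\<bar> * norm (pcos (pderiv P) s)"

abbreviation deriv_p_norm :: "complex poly \<Rightarrow> ennreal" where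
  "deriv_p_norm P \<equiv> (\<integral>\<^sup>+ s. indicator {0..pi} s * ennreal (deriv_size P s powr p * W s) \<partial>\<nu>)"

lemma deriv_size_le:
  assumes "r > 0" and B: "\<And>z. norm (z - of_real s) = r \<Longrightarrow> norm (poly P (cos z)) \<le> B"
  shows "deriv_size P s \<le> B / r"
proof -
  have d: "((\<lambda>z. poly P (cos z)) has_field_derivative (poly (pderiv P) (cos z) * - sin z)) (at z)" for z :: complex
    by (rule DERIV_chain2[OF poly_DERIV DERIV_cos])
  have "norm ((deriv ^^ 1) (\<lambda>z. poly P (cos z)) (of_real s)) \<le> fact 1 * B / r ^ 1"
  proof (rule Cauchy_inequality[OF _ _ assms(1)])
    show "(\<lambda>z. poly P (cos z)) holomorphic_on ball (of_real s) r"
      using d by (auto simp: holomorphic_on_def field_differentiable_def intro: has_field_derivative_at_within)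
    show "continuous_on (cball (of_real s) r) (\<lambda>z. poly P (cos z))"
      by (intro continuous_intros)
  qed (use B in \<open>auto simp: norm_minus_commute\<close>)
  moreover have "deriv (\<lambda>z. poly P (cos z)) (of_real s) = poly (pderiv P) (cos (of_real s)) * - sin (of_real s)"
    by (rule DERIV_imp_deriv[OF d])
  ultimately show ?thesis
    by (simp add: deriv_size_def norm_mult cos_of_real sin_of_real mult.commute)
qed

lemma deriv_size_measurable [measurable]: "deriv_size P \<in> borel_measurable borel"
  unfolding deriv_size_def[abs_def]
  by (intro borel_measurable_continuous_onI continuous_intros)

section \<open>Estimates at scale \<open>1 / n\<close> and the upper bound for the
  derivative\<close>

context
  fixes \<Lambda> :: real and n :: nat and y :: "nat \<Rightarrow> real" and P :: "complex poly"
  assumes adm: "admissible \<Lambda> n y" and deg: "degree P \<le> n"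
begin

lemma H_nonneg: "H n y P t \<ge> 0"
  unfolding H_def by (rule integral_poisson_h_nonneg[OF adm])

lemma H_measurable [measurable]: "H n y P \<in> borel_measurable borel"
  unfolding H_def[abs_def] using n_pos[OF adm] by (intro integral_poisson_h_measurable[OF adm]) auto

text \<open>The majorant at height \<open>2 / n\<close> around \<open>Re z\<close>, transferred to
  \<open>t\<close>: Harnack's inequality moves the average of \<open>h\<close>, while the Lipschitz
  bound for the potential and doubling for \<open>V\<close> move \<open>\<psi>\<close>.\<close>

lemma local_bound:
  assumes z: "norm (z - of_real t) \<le> 1 / real n"
  shows "norm (poly P (cos z)) powr p \<le> CA \<Lambda> * H n y P t * exp (\<psi> n y t)"
proof -
  define Y where "Y = 2 / real n"
  note n = n_pos[OF adm]
  have Y: "0 < Y" "Y \<le> 1 / 2" using n by (auto simp: Y_def field_simps)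
  have nY: "real n * Y = 2" "Y * real n = 2" using n by (auto simp: Y_def)
  define t' where "t' = Re z"
  have "\<bar>Re (z - of_real t)\<bar> \<le> norm (z - of_real t)" "\<bar>Im (z - of_real t)\<bar> \<le> norm (z - of_real t)"
    by (rule abs_Re_le_cmod abs_Im_le_cmod)+
  hence zt: "\<bar>t' - t\<bar> \<le> 1 / real n" "\<bar>Im z\<bar> \<le> 1 / real n" using z by (auto simp: t'_def)
  \<comment> \<open>\<open>ln (1 + Y) \<ge> Y - Y\<^sup>2 \<ge> Y / 2\<close>, as
    \<open>Y \<le> 1/2\<close>.\<close>
  have ln1: "1 / real n \<le> ln (1 + Y)"
  proof -
    have "Y - Y\<^sup>2 \<le> ln (1 + Y)" using Y by (intro ln_one_plus_pos_lower_bound) auto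
    moreover have "Y * Y \<le> Y * (1 / 2)" using Y by (intro mult_left_mono) auto
    moreover have "1 / real n = Y / 2" by (simp add: Y_def)
    ultimately show ?thesis by (simp add: power2_eq_square)
  qed
  have "norm (poly P (cos z)) powr p \<le> exp (2 * real n * p * Y) *
           exp (avg Y (\<psi> n y) t') * avg Y (h n y P) t'"
    unfolding t'_def using Y zt ln1 deg by (intro majorant[OF adm]) auto
  also have "2 * real n * p * Y = 4 * p" using nY by (simp add: mult.commute mult.left_commute)
  also have "avg Y (h n y P) t' \<le> 5 * H n y P t"
  proof -
    obtain B where B: "\<And>t. h n y P t \<le> B" using h_bounded[OF adm] by blast
    have "\<bar>t' - t\<bar> \<le> Y" using zt n by (simp add: Y_def field_simps)
    hence "(LINT u|poisson Y. h n y P (t + (t' - t) + u)) \<le> 5 * avg Y (h n y P) t"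
      using Y B h_measurable[OF adm] h_periodic[OF adm] h_nonneg[OF adm]
      by (intro integral_poisson_Harnack[where B=B]) auto
    thus ?thesis by (simp add: H_def Y_def)
  qed
  also have "avg Y (\<psi> n y) t' \<le> \<psi> n y t + (2 * C1 * \<Lambda> + real m * (4 + ln 3) + C2 * \<Lambda> + real m * ln 4)"
  proof -
    have "avg Y (\<psi> n y) t' \<le> \<psi> n y t' + C1 * \<Lambda> * real n * Y + real m * (4 + ln (1 + Y * real n))"
      using Y by (intro integral_poisson_psi_le[OF adm]) auto
    also have "\<dots> = \<psi> n y t' + 2 * C1 * \<Lambda> + real m * (4 + ln 3)"
      using nY by (simp add: mult.assoc)
    finally have 1: "avg Y (\<psi> n y) t' \<le> \<psi> n y t' + 2 * C1 * \<Lambda> + real m * (4 + ln 3)" .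
    have "pot y t' - pot y t \<le> C2 * \<Lambda> * real n * \<bar>t' - t\<bar>" using pot_lipschitz[OF adm, of t' t] by simp
    also have "\<dots> \<le> C2 * \<Lambda> * real n * (1 / real n)"
      using zt C2_nonneg y(5)[OF adm] by (intro mult_left_mono) auto
    finally have 2: "pot y t' \<le> pot y t + C2 * \<Lambda>" using n by simp
    have V0: "V (1 / real n) t > 0" "V (1 / real n) t' > 0" using n by (auto intro: V_pos)
    have "V (1 / real n) t \<le> (2 * (1 + \<bar>t' - t\<bar> / (1 / real n))) ^ m * V (1 / real n) t'"
      using n by (intro V_shift) auto
    also have "\<dots> \<le> 4 ^ m * V (1 / real n) t'"
      using zt n V0 by (intro mult_right_mono power_mono) (auto simp: field_simps)
    finally have "ln (V (1 / real n) t) \<le> ln (4 ^ m * V (1 / real n) t')" using V0 by simp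
    also have "\<dots> = real m * ln 4 + ln (V (1 / real n) t')" using V0 by (subst ln_mult_pos) (auto simp: ln_realpow)
    finally have 3: "- ln (V (1 / real n) t') \<le> - ln (V (1 / real n) t) + real m * ln 4" by simp
    show ?thesis using 1 2 3 by (simp add: \<psi>_def)
  qed
  finally have "norm (poly P (cos z)) powr p \<le> exp (4 * p) * exp (\<psi> n y t + (2 * C1 * \<Lambda> + real m * (4 + ln 3) + C2 * \<Lambda> + real m * ln 4)) * (5 * H n y P t)"
    using H_nonneg by (simp add: mult_left_mono mult_right_mono)
  also have "\<dots> = CA \<Lambda> * H n y P t * exp (\<psi> n y t)"
    by (simp add: CA_def exp_add mult_ac)
  finally show ?thesis .
qed

lemma local_bound_root:
  assumes z: "norm (z - of_real t) \<le> 1 / real n"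
  shows "norm (poly P (cos z)) \<le> (CA \<Lambda> * H n y P t * exp (\<psi> n y t)) powr (1 / p)"
proof -
  have "norm (poly P (cos z)) = (norm (poly P (cos z)) powr p) powr (1 / p)"
    using p_pos by (simp add: powr_powr)
  also have "\<dots> \<le> (CA \<Lambda> * H n y P t * exp (\<psi> n y t)) powr (1 / p)"
    using p_pos local_bound[OF z] by (intro powr_mono2) auto
  finally show ?thesis .
qed

text \<open>Cauchy's estimate on the circle of radius \<open>1 / (2 n)\<close> around
  \<open>s\<close>, which stays in the disc of radius \<open>1 / n\<close> around
  \<open>t\<close>.\<close>

lemma local_deriv_bound:
  assumes "\<bar>s - t\<bar> \<le> 1 / (2 * real n)"
  shows "deriv_size P s \<le> 2 * real n * (CA \<Lambda> * H n y P t * exp (\<psi> n y t)) powr (1 / p)"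
proof -
  note n = n_pos[OF adm]
  have "deriv_size P s \<le> (CA \<Lambda> * H n y P t * exp (\<psi> n y t)) powr (1 / p) / (1 / (2 * real n))"
  proof (rule deriv_size_le)
    fix z :: complex assume z: "norm (z - of_real s) = 1 / (2 * real n)"
    have "norm (z - of_real t) \<le> norm (z - of_real s) + norm (of_real (s - t) :: complex)"
      using norm_triangle_ineq[of "z - of_real s" "of_real (s - t)"] by simp
    also have "\<dots> \<le> 1 / (2 * real n) + 1 / (2 * real n)" using z assms by (simp only: norm_of_real)
    also have "\<dots> = 1 / real n" by (simp add: field_simps)
    finally show "norm (poly P (cos z)) \<le> (CA \<Lambda> * H n y P t * exp (\<psi> n y t)) powr (1 / p)"
      by (rule local_bound_root)
  qed (use n in auto)
  thus ?thesis by (simp add: mult_ac)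
qed

text \<open>\<open>W s\<close> is at most the truncated weight, which within \<open>1 / n\<close>
  cancels the potential in \<open>exp \<psi>\<close> up to a constant and leaves
  \<open>1 / V\<close>. The right side depends on \<open>t\<close> only and can be averaged over
  \<open>t\<close>.\<close>

lemma deriv_weighted_bound:
  assumes st: "\<bar>s - t\<bar> \<le> 1 / (2 * real n)"
  shows "deriv_size P s powr p * W s \<le> (2 * real n) powr p * CA \<Lambda> * exp (C2 * \<Lambda>) * (H n y P t / V (1 / real n) t)"
proof -
  note n = n_pos[OF adm]
  have V0: "V (1 / real n) t > 0" using n by (auto intro: V_pos)
  have X0: "0 \<le> CA \<Lambda> * H n y P t * exp (\<psi> n y t)"
    using CA_pos[of \<Lambda>] H_nonneg[of t] by simp
  have "deriv_size P s powr p \<le> (2 * real n * (CA \<Lambda> * H n y P t * exp (\<psi> n y t)) powr (1 / p)) powr p"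
    using p_pos local_deriv_bound[OF st] by (intro powr_mono2) (auto simp: deriv_size_def)
  also have "\<dots> = (2 * real n) powr p * (CA \<Lambda> * H n y P t * exp (\<psi> n y t))"
  proof -
    have R: "(x powr (1 / p)) powr p = x" if "x \<ge> 0" for x using that p_pos by (simp add: powr_powr)
    show ?thesis by (subst powr_mult) (use X0 in \<open>simp_all add: R[OF X0] del: mult_nonneg_nonneg\<close>)
  qed
  finally have 1: "deriv_size P s powr p \<le> (2 * real n) powr p * (CA \<Lambda> * H n y P t * exp (\<psi> n y t))" .
  have "pot y t - pot y s \<le> C2 * \<Lambda> * real n * \<bar>t - s\<bar>" using pot_lipschitz[OF adm, of t s] by simp
  also have "\<dots> \<le> C2 * \<Lambda> * real n * (1 / real n)"
  proof (rule mult_left_mono)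
    have "1 / (2 * real n) \<le> 1 / real n" using n by (simp add: field_simps)
    thus "\<bar>t - s\<bar> \<le> 1 / real n" using st by (simp add: abs_minus_commute)
  qed (use C2_nonneg y(5)[OF adm] in auto)
  finally have "- pot y s \<le> - pot y t + C2 * \<Lambda>" using n by simp
  hence "exp (- pot y s) \<le> exp (- pot y t + C2 * \<Lambda>)" by (subst exp_le_cancel_iff)
  hence "exp (- pot y s) \<le> exp (- pot y t) * exp (C2 * \<Lambda>)" by (simp only: exp_add)
  hence 2: "W s \<le> exp (- pot y t) * exp (C2 * \<Lambda>)" using W_le[OF adm, of s] by (rule order_trans[rotated])
  have "deriv_size P s powr p * W s \<le> ((2 * real n) powr p * (CA \<Lambda> * H n y P t * exp (\<psi> n y t))) * (exp (- pot y t) * exp (C2 * \<Lambda>))"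
    using 1 2 X0 W_bounds by (intro mult_mono) auto
  also have "\<dots> = (2 * real n) powr p * CA \<Lambda> * exp (C2 * \<Lambda>) * (H n y P t * (exp (\<psi> n y t) * exp (- pot y t)))"
    by simp
  also have "exp (\<psi> n y t) * exp (- pot y t) = 1 / V (1 / real n) t"
    using V0 by (simp add: \<psi>_def exp_diff exp_minus)
  finally show ?thesis by simp
qed

lemma upper_estimate:
  "deriv_p_norm P
    \<le> ennreal (4 * real n * ((2 * real n) powr p * CA \<Lambda> * exp (C2 * \<Lambda>)))
       * h_mass n y P"
proof -
  note n = n_pos[OF adm]
  define k where "k = (2 * real n) powr p * CA \<Lambda> * exp (C2 * \<Lambda>)"
  have k: "k \<ge> 0" using CA_pos[of \<Lambda>] by (simp add: k_def)
  define e where "e = 1 / (2 * real n)"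
  have e: "e > 0" "e \<le> 1 / 8" "2 * real n * e = 1" using n by (auto simp: e_def field_simps)
  define N where "N = (\<lambda>s t. indicator {0..pi} s * (indicator {0..pi} t * (if \<bar>s - t\<bar> \<le> e then 1 else 0)) :: ennreal)"
  have [measurable]: "case_prod N \<in> borel_measurable (borel \<Otimes>\<^sub>M borel)" unfolding N_def by measurable
  interpret pair_sigma_finite \<nu> "lborel :: real measure" ..
  have pt: "indicator {0..pi} s * ennreal (deriv_size P s powr p * W s)
      \<le> ennreal (2 * real n) * (\<integral>\<^sup>+ t. N s t * ennreal (k * (H n y P t / V (1 / real n) t)) \<partial>lborel)" for s
  proof (cases "s \<in> {0..pi}")
    case True
    \<comment> \<open>A one-sided interval of length \<open>e\<close> next to \<open>s\<close>,
      chosen on the side where it remains inside \<open>{0..pi}\<close>.\<close>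
    define a where "a = (if s \<le> pi / 2 then s else s - e)"
    have a: "{a..a + e} \<subseteq> {t. 0 \<le> t \<and> t \<le> pi \<and> \<bar>s - t\<bar> \<le> e}"
      using True e pi_gt3 by (auto simp: a_def abs_le_iff split: if_splits)
    have "ennreal (deriv_size P s powr p * W s) = ennreal (2 * real n) * (ennreal (deriv_size P s powr p * W s) * ennreal e)"
      using e W_bounds[of s] by (simp add: ennreal_mult'[symmetric] mult_ac)
    also have "\<dots> \<le> ennreal (2 * real n) * (\<integral>\<^sup>+ t. N s t * ennreal (k * (H n y P t / V (1 / real n) t)) \<partial>lborel)"
    proof (rule mult_left_mono)
      have "ennreal (deriv_size P s powr p * W s) * ennreal e
          = (\<integral>\<^sup>+ t. ennreal (deriv_size P s powr p * W s) * indicator {a..a + e} t \<partial>lborel)"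
        using e by (subst nn_integral_cmult_indicator) auto
      also have "\<dots> \<le> (\<integral>\<^sup>+ t. N s t * ennreal (k * (H n y P t / V (1 / real n) t)) \<partial>lborel)"
      proof (rule nn_integral_mono)
        fix t
        show "ennreal (deriv_size P s powr p * W s) * indicator {a..a + e} t \<le> N s t * ennreal (k * (H n y P t / V (1 / real n) t))"
        proof (cases "t \<in> {a..a + e}")
          case t: True
          hence t': "t \<in> {0..pi}" "\<bar>s - t\<bar> \<le> e" using a by auto
          have "deriv_size P s powr p * W s \<le> k * (H n y P t / V (1 / real n) t)"
            unfolding k_def using t' by (intro deriv_weighted_bound) (simp add: e_def)
          thus ?thesis using t t' True by (simp add: N_def ennreal_leI)
        qed simp
      qed
      finally show "ennreal (deriv_size P s powr p * W s) * ennreal e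
          \<le> (\<integral>\<^sup>+ t. N s t * ennreal (k * (H n y P t / V (1 / real n) t)) \<partial>lborel)" .
    qed simp
    finally show ?thesis using True by simp
  qed simp
  have "deriv_p_norm P
     \<le> (\<integral>\<^sup>+ s. ennreal (2 * real n) * (\<integral>\<^sup>+ t. N s t * ennreal (k * (H n y P t / V (1 / real n) t)) \<partial>lborel) \<partial>\<nu>)"
    by (intro nn_integral_mono pt)
  also have "\<dots> = ennreal (2 * real n) * (\<integral>\<^sup>+ s. (\<integral>\<^sup>+ t. N s t * ennreal (k * (H n y P t / V (1 / real n) t)) \<partial>lborel) \<partial>\<nu>)"
    by (rule nn_integral_cmult) measurable
  also have "\<dots> \<le> ennreal (2 * real n) * (ennreal k * (2 * h_mass n y P))"
  proof (rule mult_left_mono)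
    have "(\<integral>\<^sup>+ s. (\<integral>\<^sup>+ t. N s t * ennreal (k * (H n y P t / V (1 / real n) t)) \<partial>lborel) \<partial>\<nu>)
       = (\<integral>\<^sup>+ t. (\<integral>\<^sup>+ s. N s t * ennreal (k * (H n y P t / V (1 / real n) t)) \<partial>\<nu>) \<partial>lborel)"
      by (rule Fubini'[symmetric]) measurable
    also have "\<dots> \<le> (\<integral>\<^sup>+ t. ennreal k * (indicator {0..pi} t * ennreal (H n y P t)) \<partial>lborel)"
    proof (rule nn_integral_mono)
      fix t
      show "(\<integral>\<^sup>+ s. N s t * ennreal (k * (H n y P t / V (1 / real n) t)) \<partial>\<nu>) \<le> ennreal k * (indicator {0..pi} t * ennreal (H n y P t))"
      proof (cases "t \<in> {0..pi}")
        case True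
        have V0: "V (1 / real n) t > 0" using n by (auto intro: V_pos)
        have ft: "fold_angle t = t" using True by (intro fold_angle_ident) auto
        have e1: "e \<le> 1 / real n" using n by (simp add: e_def field_simps)
        have "(\<integral>\<^sup>+ s. N s t * ennreal (k * (H n y P t / V (1 / real n) t)) \<partial>\<nu>)
           \<le> (\<integral>\<^sup>+ s. ennreal (k * (H n y P t / V (1 / real n) t)) * indicator (cball t (1 / real n)) s \<partial>\<nu>)"
          using e1 by (intro nn_integral_mono) (auto simp: N_def indicator_def dist_real_def abs_minus_commute)
        also have "\<dots> = ennreal (k * (H n y P t / V (1 / real n) t)) * emeasure \<nu> (cball t (1 / real n))"
          by (rule nn_integral_cmult_indicator) simp
        also have "emeasure \<nu> (cball t (1 / real n)) = ennreal (V (1 / real n) t)"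
          by (simp add: V_def ft emeasure_eq_measure)
        also have "ennreal (k * (H n y P t / V (1 / real n) t)) * ennreal (V (1 / real n) t) = ennreal (k * H n y P t)"
          using V0 by (simp add: ennreal_mult''[symmetric])
        also have "\<dots> = ennreal k * (indicator {0..pi} t * ennreal (H n y P t))"
          using True k by (simp add: ennreal_mult')
        finally show ?thesis .
      qed (simp add: N_def)
    qed
    also have "\<dots> = ennreal k * (\<integral>\<^sup>+ t. indicator {0..pi} t * ennreal (H n y P t) \<partial>lborel)"
      by (rule nn_integral_cmult) measurable
    also have "\<dots> \<le> ennreal k * (2 * h_mass n y P)"
      unfolding H_def using n by (intro mult_left_mono nn_integral_mean_h[OF adm]) auto
    finally show "(\<integral>\<^sup>+ s. (\<integral>\<^sup>+ t. N s t * ennreal (k * (H n y P t / V (1 / real n) t)) \<partial>lborel) \<partial>\<nu>)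
       \<le> ennreal k * (2 * h_mass n y P)" .
  qed simp
  also have "\<dots> = ennreal (2 * real n) * ennreal k * ennreal 2 * h_mass n y P"
    by (simp add: mult.assoc)
  also have "ennreal (2 * real n) * ennreal k * ennreal 2 = ennreal (2 * real n * k * 2)"
    using k by (simp only: ennreal_mult'' ennreal_mult' zero_le_numeral)
  also have "2 * real n * k * 2 = 4 * real n * ((2 * real n) powr p * CA \<Lambda> * exp (C2 * \<Lambda>))" by (simp add: k_def)
  finally show ?thesis .
qed

end

end

section \<open>Points near the zeros of the weight\<close>

context Omega_doubling
begin

text \<open>
  Near a zero, the truncated potential at \<open>t\<close> exceeds its Poisson average at height \<open>K * y j\<close>, where
  \<open>y j\<close> is the largest truncation level among the factors vanishing there. \<open>K\<close> depends on the weight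
  only; \<open>\<Lambda>\<close> is chosen after \<open>K\<close> so that the growth of \<open>P\<close> and the variation of \<open>V\<close> are absorbed.
\<close>

lemma bad_points:
  assumes "\<theta> > 0"
  obtains K \<Lambda> \<epsilon> R where "K \<ge> 1" "\<Lambda> > 0" "\<epsilon> > 0" "\<And>n y P t i0. admissible \<Lambda> n y \<Longrightarrow>
    (\<And>i. i \<in> I \<Longrightarrow> y i < \<epsilon> \<and> R < F i (y i)) \<Longrightarrow> degree P \<le> n \<Longrightarrow> t \<in> {0..pi} \<Longrightarrow> i0 \<in> I \<Longrightarrow>
    \<bar>g i0 t\<bar> < 2 * y i0 \<Longrightarrow> \<exists>j\<in>I. h n y P t \<le> \<theta> * avg (K * y j) (h n y P) t"
    "\<And>i y. y < \<epsilon> \<Longrightarrow> K * y \<le> 1"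
proof -
  obtain e where e: "e > 0" "\<And>t. t \<in> {0..pi} \<Longrightarrow> \<exists>z. \<forall>i\<in>I.
     (g i z = 0 \<and> (\<forall>s. \<bar>s - t\<bar> < e \<longrightarrow> e * \<bar>s - z\<bar> \<le> \<bar>g i s\<bar>)) \<or> (\<forall>s. \<bar>s - t\<bar> < e \<longrightarrow> e \<le> \<bar>g i s\<bar>)"
    using zero_structure[OF I_finite compact_Icc, of g g' 0 pi] weight_factor.g_deriv[OF wf] g_simple by blast
  define N where "N = real (card I) + 1"
  have N: "N \<ge> 1" by (simp add: N_def)
  \<comment> \<open>At a bad point \<open>t\<close> the common zero \<open>z\<close> is within
    \<open>2 y j / e\<close>, so \<open>\<bar>g j t\<bar> \<le> \<kappa> j * y j\<close>. By
    \<open>\<Phi>_ge\<close> the potential there is at least \<open>c0\<close> times its maximum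
    \<open>F j (y j)\<close>.\<close>
  define \<kappa> where "\<kappa> = (\<lambda>i. max 1 (2 * D i / e))"
  define c0 where "c0 = Min (insert 1 ((\<lambda>i. \<kappa> i powr - a1 i) ` I))"
  have \<kappa>1: "\<kappa> i \<ge> 1" for i by (simp add: \<kappa>_def)
  have \<kappa>0: "\<kappa> i \<noteq> 0" for i using \<kappa>1[of i] by auto
  have c0: "c0 > 0" unfolding c0_def using I_finite \<kappa>0 by (subst Min_gr_iff) auto
  have c0_le: "c0 \<le> \<kappa> i powr - a1 i" if "i \<in> I" for i
    unfolding c0_def using I_finite that by (intro Min_le) auto
  \<comment> \<open>\<open>q\<close> is a bound for \<open>sqrt (y i / Y)\<close>, which
    \<open>K = 1 / q\<^sup>2\<close> enforces below. At this ratio the average of each factor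
    vanishing at \<open>z\<close> is a small fraction of \<open>c0 F j (y j)\<close>.\<close>
  obtain q where q: "q > 0" "q \<le> 1" "\<And>i. i \<in> I \<Longrightarrow> c i * q + q powr a2 i \<le> c0 / (8 * N)"
  proof -
    have "\<forall>i\<in>I. eventually (\<lambda>q. c i * q + q powr a2 i < c0 / (8 * N)) (at_right 0)"
    proof
      fix i assume "i \<in> I"
      hence a2: "a2 i > 0" using weight_factor.params[OF wf] by auto
      have "((\<lambda>q. q powr a2 i) \<longlongrightarrow> 0 powr a2 i) (at_right 0)"
        using a2 by (intro tendsto_powr'[OF tendsto_ident_at tendsto_const] disjI2 conjI)
          (auto simp: eventually_at_filter)
      hence "((\<lambda>q. q powr a2 i) \<longlongrightarrow> 0) (at_right 0)" by simp
      hence "((\<lambda>q. c i * q + q powr a2 i) \<longlongrightarrow> c i * 0 + 0) (at_right 0)"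
        by (intro tendsto_intros)
      thus "eventually (\<lambda>q. c i * q + q powr a2 i < c0 / (8 * N)) (at_right 0)"
        using c0 N by (intro order_tendstoD(2)) auto
    qed
    hence "eventually (\<lambda>q. \<forall>i\<in>I. c i * q + q powr a2 i < c0 / (8 * N)) (at_right 0)"
      using I_finite by (intro eventually_ball_finite)
    then obtain r where r: "r > 0" "\<And>q. 0 < q \<Longrightarrow> q < r \<Longrightarrow> \<forall>i\<in>I. c i * q + q powr a2 i < c0 / (8 * N)"
      unfolding eventually_at_right_field by auto
    show ?thesis
      using r(2)[of "min 1 (r / 2)"] r(1) by (intro that[of "min 1 (r / 2)"]) (auto intro!: less_imp_le)
  qed
  define K where "K = 1 / q\<^sup>2"
  have K: "K \<ge> 1" using q by (simp add: K_def power_le_one)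
  \<comment> \<open>Since \<open>Y n = K T / \<Lambda>\<close> for
    \<open>T = \<Lambda> n y j\<close>, the two summands bound the growth \<open>2 n p Y\<close> and
    the term \<open>m Y n\<close> from the variation of \<open>V\<close> by \<open>c0 T / 8\<close>
    each.\<close>
  define \<Lambda> where "\<Lambda> = (16 * p + 8 * real m) * K / c0 + 1"
  have pK: "0 \<le> 16 * p * K / c0" "0 \<le> 8 * real m * K / c0" using p_pos K c0 by auto
  have \<Lambda>s: "\<Lambda> = 16 * p * K / c0 + 8 * real m * K / c0 + 1" by (simp add: \<Lambda>_def algebra_simps add_divide_distrib)
  have \<Lambda>: "\<Lambda> > 0" "16 * p * K / c0 \<le> \<Lambda>" "8 * real m * K / c0 \<le> \<Lambda>"
    using pK unfolding \<Lambda>s by linarith+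
  have ratio: "x * K / \<Lambda> \<le> c0 / 8" if "8 * x * K / c0 \<le> \<Lambda>" for x
  proof -
    have "8 * x * K \<le> \<Lambda> * c0" using that c0 by (simp only: pos_divide_le_eq)
    hence "x * K \<le> c0 / 8 * \<Lambda>" by (simp add: mult_ac)
    thus ?thesis using \<Lambda>(1) by (simp only: pos_divide_le_eq)
  qed
  \<comment> \<open>\<open>e / 2\<close> forces \<open>i0\<close> to vanish at \<open>z\<close>,
    \<open>1 / K\<close> keeps the height at most 1, and the last term makes the Poisson tails of
    the factors without zero near \<open>t\<close> negligible.\<close>
  define \<epsilon> where "\<epsilon> = min (e / 2) (min (1 / K) (c0 * e / (64 * K * N)))"
  have \<epsilon>: "\<epsilon> > 0" "\<epsilon> \<le> e / 2" "\<epsilon> \<le> 1 / K" "\<epsilon> \<le> c0 * e / (64 * K * N)"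
    using e c0 K N by (auto simp: \<epsilon>_def)
  define S where "S = (\<Sum>i\<in>I. \<bar>F i e\<bar>)"
  \<comment> \<open>A large lower bound for \<open>T\<close> absorbs the quantities that do not
    scale with \<open>n\<close>: the values \<open>F i e\<close> of the nonvanishing factors, the
    constant \<open>4 m\<close> from \<open>V\<close>, and \<open>ln \<theta>\<close>.\<close>
  define R where "R = 16 * N * S / c0 + 32 * real m / c0 + 2 * \<bar>ln \<theta>\<bar> / c0"
  have S: "S \<ge> 0" by (auto simp: S_def intro: sum_nonneg)
  have Rp: "0 \<le> 16 * N * S / c0" "0 \<le> 32 * real m / c0" "0 \<le> 2 * \<bar>ln \<theta>\<bar> / c0"
    using S c0 N by auto
  have R: "0 \<le> R" "16 * N * S / c0 \<le> R" "32 * real m / c0 \<le> R" "2 * \<bar>ln \<theta>\<bar> / c0 \<le> R"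
    using Rp unfolding R_def by linarith+
  show ?thesis
  proof (rule that[OF K \<Lambda>(1) \<epsilon>(1)])
    show "K * y \<le> 1" if "y < \<epsilon>" for y
    proof -
      have "y \<le> 1 / K" using that \<epsilon> by simp
      thus ?thesis using K by (simp add: field_simps)
    qed
    fix n :: nat and y :: "nat \<Rightarrow> real" and P :: "complex poly" and t :: real and i0 :: nat
    assume adm: "admissible \<Lambda> n y" and yR: "\<And>i. i \<in> I \<Longrightarrow> y i < \<epsilon> \<and> R < F i (y i)"
      and deg: "degree P \<le> n" and t: "t \<in> {0..pi}" and i0: "i0 \<in> I" "\<bar>g i0 t\<bar> < 2 * y i0"
    note n = n_pos[OF adm] and y = y[OF adm]
    obtain z where z: "\<And>i. i \<in> I \<Longrightarrow>
     (g i z = 0 \<and> (\<forall>s. \<bar>s - t\<bar> < e \<longrightarrow> e * \<bar>s - z\<bar> \<le> \<bar>g i s\<bar>)) \<or> (\<forall>s. \<bar>s - t\<bar> < e \<longrightarrow> e \<le> \<bar>g i s\<bar>)"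
      using e(2)[OF t] by blast
    define J where "J = {i \<in> I. g i z = 0 \<and> (\<forall>s. \<bar>s - t\<bar> < e \<longrightarrow> e * \<bar>s - z\<bar> \<le> \<bar>g i s\<bar>)}"
    have J: "finite J" "J \<subseteq> I" using I_finite by (auto simp: J_def)
    have "\<not> e \<le> \<bar>g i0 t\<bar>" using i0 yR[of i0] \<epsilon> by auto
    hence i0J: "i0 \<in> J" using z[OF i0(1)] e i0 by (auto simp: J_def)
    have "Max (y ` J) \<in> y ` J" using J i0J by (intro Max_in) auto
    then obtain j where j: "j \<in> J" "y j = Max (y ` J)" by auto
    have jmax: "y i \<le> y j" if "i \<in> J" for i unfolding j(2) using J that by (intro Max_ge) auto
    have jI: "j \<in> I" using j J by auto
    \<comment> \<open>The common unit for all terms of the exponent; it equals the maximum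
      \<open>F j (y j)\<close> of the dominating factor.\<close>
    define T where "T = \<Lambda> * real n * y j"
    have T: "T > R" "T = F j (y j)" using yR[OF jI] y(3)[OF jI] by (auto simp: T_def)
    have T0: "T > 0" using T R by simp
    define Y where "Y = K * y j"
    have Y: "0 < Y" "y j \<le> Y" "Y \<le> 1"
    proof -
      show "0 < Y" using K y(1)[OF jI] by (simp add: Y_def)
      have "1 * y j \<le> K * y j" using K y(1)[OF jI] by (intro mult_right_mono) auto
      thus "y j \<le> Y" by (simp add: Y_def)
      have "y j \<le> 1 / K" using yR[OF jI] \<epsilon> by simp
      thus "Y \<le> 1" using K by (simp add: Y_def field_simps)
    qed
    have pot_low: "c0 * T \<le> pot y t"
    proof -
      have "e * \<bar>t - z\<bar> \<le> \<bar>g i0 t\<bar>" using i0J e by (auto simp: J_def)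
      also have "\<dots> \<le> 2 * y j" using i0 jmax[OF i0J] by simp
      finally have tz: "\<bar>t - z\<bar> \<le> 2 * y j / e" using e by (simp add: field_simps)
      have Dj: "D j \<ge> 1" using weight_factor.params[OF wf[OF jI]] by auto
      have "\<bar>g j t - g j z\<bar> \<le> D j * \<bar>t - z\<bar>" by (rule weight_factor.g_lipschitz[OF wf[OF jI]])
      also have "\<dots> \<le> D j * (2 * y j / e)" using tz Dj by (intro mult_left_mono) auto
      also have "\<dots> = (2 * D j / e) * y j" by simp
      also have "\<dots> \<le> \<kappa> j * y j" using y(1)[OF jI] by (intro mult_right_mono) (auto simp: \<kappa>_def)
      finally have "\<bar>g j t\<bar> \<le> \<kappa> j * y j" using j by (simp add: J_def)
      hence "\<kappa> j powr - a1 j * F j (y j) \<le> Phi j (y j) t"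
        using y(1,2)[OF jI] \<kappa>1 by (intro weight_factor.\<Phi>_ge[OF wf[OF jI]]) auto
      moreover have "c0 * T \<le> \<kappa> j powr - a1 j * F j (y j)"
        unfolding T(2)[symmetric] using c0_le[OF jI] T0 by (intro mult_right_mono) auto
      moreover have "Phi j (y j) t \<le> pot y t"
        unfolding pot_def using I_finite jI weight_factor.\<Phi>_nonneg[OF wf] y
        by (intro member_le_sum[of j I "\<lambda>i. Phi i (y i) t"]) auto
      ultimately show ?thesis by linarith
    qed
    \<comment> \<open>Maximality of \<open>y j\<close> enters here: for another factor vanishing at
      \<open>z\<close> both \<open>y i / Y \<le> q\<^sup>2\<close> and
      \<open>F i (y i) \<le> T\<close> follow from \<open>y i \<le> y j\<close>.\<close>
    have Phi_up: "avg Y (Phi i (y i)) t \<le> c0 * T / (8 * N)" if i: "i \<in> I" for i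
    proof (cases "i \<in> J")
      case True
      define x where "x = sqrt (y i / Y)"
      have "y i / Y \<le> y j / Y" using jmax[OF True] Y by (intro divide_right_mono) auto
      also have "\<dots> = q\<^sup>2" using y(1)[OF jI] q by (simp add: Y_def K_def)
      finally have "x \<le> q" unfolding x_def using q by (intro real_le_lsqrt) (auto simp: y i Y less_imp_le)
      have x0: "x \<ge> 0" using y(1)[OF i] Y by (simp add: x_def)
      have pi: "c i \<ge> 0" "a2 i > 0" using weight_factor.params[OF wf[OF i]] by auto
      have FT: "F i (y i) \<le> T" "0 \<le> F i (y i)"
      proof -
        show "F i (y i) \<le> T" unfolding T_def y(3)[OF i] using jmax[OF True] \<Lambda> n by (intro mult_left_mono) auto
        show "0 \<le> F i (y i)" using yR[OF i] R by simp
      qed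
      have "y i \<le> Y" using jmax[OF True] Y by simp
      hence "avg Y (Phi i (y i)) t \<le> F i (y i) * (c i * x + x powr a2 i)"
        unfolding x_def using y(1,2)[OF i] Y by (intro weight_factor.integral_poisson_\<Phi>_le_scale[OF wf[OF i]]) auto
      also have "\<dots> \<le> T * (c i * q + q powr a2 i)"
        using FT pi x0 \<open>x \<le> q\<close> T0
        by (intro mult_mono[of "F i (y i)" T] add_mono powr_mono2 mult_left_mono add_nonneg_nonneg mult_nonneg_nonneg) auto
      also have "\<dots> \<le> T * (c0 / (8 * N))" using q(3)[OF i] T0 by (intro mult_left_mono) auto
      finally show ?thesis by (simp add: mult.commute)
    next
      case False
      hence away: "\<And>s. \<bar>s - t\<bar> < e \<Longrightarrow> e \<le> \<bar>g i s\<bar>" using z[OF i] i by (auto simp: J_def)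
      have eA: "e \<le> A i" using away[of t] e weight_factor.g_bound[OF wf[OF i], of t] by simp
      have "avg Y (Phi i (y i)) t \<le> F i e + F i (y i) * (4 * Y / e)"
        using y(1,2)[OF i] Y e(1) eA by (intro weight_factor.integral_poisson_\<Phi>_le_away[OF wf[OF i]] away) auto
      also have "F i (y i) * (4 * Y / e) = T * (4 * K / e * y i)"
        unfolding y(3)[OF i] by (simp add: T_def Y_def)
      also have "\<dots> \<le> T * (c0 / (16 * N))"
      proof (rule mult_left_mono)
        have "4 * K / e * y i \<le> 4 * K / e * (c0 * e / (64 * K * N))"
          using yR[OF i] \<epsilon> K e by (intro mult_left_mono) auto
        also have "\<dots> = c0 / (16 * N)" using K e by simp
        finally show "4 * K / e * y i \<le> c0 / (16 * N)" .
      qed (use T0 in simp)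
      also have "F i e \<le> T * (c0 / (16 * N))"
      proof -
        have "F i e \<le> S" unfolding S_def using I_finite i
          by (intro order_trans[OF abs_ge_self member_le_sum[of i I "\<lambda>i. \<bar>F i e\<bar>"]]) auto
        moreover have "16 * N * S / c0 \<le> T" using R T by simp
        hence "16 * N * S \<le> T * c0" using c0 by (simp only: pos_divide_le_eq)
        hence "S * (16 * N) \<le> T * c0" by (simp only: mult_ac)
        hence "S \<le> T * c0 / (16 * N)" using N by (subst pos_le_divide_eq) auto
        hence "S \<le> T * (c0 / (16 * N))" by (simp only: times_divide_eq_right)
        ultimately show ?thesis by simp
      qed
      finally have "avg Y (Phi i (y i)) t \<le> T * (c0 / (16 * N)) + T * (c0 / (16 * N))" by simp
      also have "\<dots> = c0 * T / (8 * N)" using N by (simp add: mult_2[symmetric])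
      finally show ?thesis .
    qed
    have sum_up: "(\<Sum>i\<in>I. LINT u|poisson Y. Phi i (y i) (t + u)) \<le> c0 * T / 8"
    proof -
      have "(\<Sum>i\<in>I. LINT u|poisson Y. Phi i (y i) (t + u)) \<le> (\<Sum>i\<in>I. c0 * T / (8 * N))"
        by (intro sum_mono Phi_up)
      also have "\<dots> = (c0 * T / 8) * (real (card I) / N)" by simp
      also have "\<dots> \<le> (c0 * T / 8) * 1"
        using c0 T0 by (intro mult_left_mono) (auto simp: N_def)
      finally show ?thesis by simp
    qed
    have Yn: "Y * real n = K * T / \<Lambda>" using \<Lambda> by (simp add: Y_def T_def)
    have V_up: "(LINT u|poisson Y. - ln (V (1 / real n) (t + u))) \<le> - ln (V (1 / real n) t) + c0 * T / 8 + c0 * T / 8"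
    proof -
      have "ln (1 + Y * real n) \<le> Y * real n" using Y n by (intro ln_add_one_self_le_self) auto
      hence "real m * (4 + ln (1 + Y * real n)) \<le> real m * (4 + K * T / \<Lambda>)"
        unfolding Yn by (intro mult_left_mono) auto
      also have "\<dots> = 4 * real m + (real m * K / \<Lambda>) * T" by (simp add: algebra_simps)
      also have "\<dots> \<le> c0 * T / 8 + (c0 / 8) * T"
      proof (intro add_mono mult_right_mono)
        have "32 * real m / c0 \<le> T" using R T by simp
        hence "32 * real m \<le> T * c0" using c0 by (simp only: pos_divide_le_eq)
        thus "4 * real m \<le> c0 * T / 8" by (simp add: mult.commute)
        show "real m * K / \<Lambda> \<le> c0 / 8" using ratio[of "real m"] \<Lambda>(3) by simp
      qed (use T0 in simp)
      finally have "real m * (4 + ln (1 + Y * real n)) \<le> c0 * T / 8 + c0 * T / 8" by simp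
      thus ?thesis using integral_poisson_ln_V[OF n(2) Y(1), of t] by simp
    qed
    have p_up: "2 * real n * p * Y \<le> c0 * T / 8"
    proof -
      have "2 * real n * p * Y = (2 * p * K / \<Lambda>) * T"
      proof -
        have "2 * real n * p * Y = 2 * p * (Y * real n)" by simp
        thus ?thesis unfolding Yn by simp
      qed
      also have "\<dots> \<le> (c0 / 8) * T"
      proof (rule mult_right_mono)
        show "2 * p * K / \<Lambda> \<le> c0 / 8" using ratio[of "2 * p"] \<Lambda>(2) by simp
      qed (use T0 in simp)
      finally show ?thesis by simp
    qed
    \<comment> \<open>Four errors of size \<open>c0 T / 8\<close> against a potential of at least
      \<open>c0 T\<close> leave \<open>- c0 T / 2\<close>, and \<open>R\<close> was chosen to bring
      this below \<open>ln \<theta>\<close>.\<close>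
    have expo: "2 * real n * p * Y + avg Y (\<psi> n y) t - \<psi> n y t \<le> ln \<theta>"
    proof -
      have "2 * real n * p * Y + avg Y (\<psi> n y) t - \<psi> n y t
         \<le> c0 * T / 8 + c0 * T / 8 + c0 * T / 8 + c0 * T / 8 - c0 * T"
      proof -
        have "d + (a + b) - (e - l) \<le> c + c + c + c - k"
          if "a \<le> c" "b \<le> - l + c + c" "d \<le> c" "k \<le> e" for a b c d e l k :: real
          using that by linarith
        from this[OF sum_up V_up p_up pot_low] show ?thesis
          unfolding integral_poisson_psi[OF adm Y(1)] unfolding \<psi>_def .
      qed
      also have "\<dots> = - (c0 * T / 2)" by simp
      also have "\<dots> \<le> - \<bar>ln \<theta>\<bar>"
      proof -
        have "2 * \<bar>ln \<theta>\<bar> / c0 \<le> T" using R T by simp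
        hence "2 * \<bar>ln \<theta>\<bar> \<le> T * c0" using c0 by (simp only: pos_divide_le_eq)
        thus ?thesis by (simp add: mult.commute)
      qed
      also have "\<dots> \<le> ln \<theta>" by simp
      finally show ?thesis .
    qed
    have "norm (poly P (cos (of_real t))) powr p \<le> exp (2 * real n * p * Y) *
           exp (avg Y (\<psi> n y) (Re (of_real t))) * avg Y (h n y P) (Re (of_real t))"
      using Y deg by (intro majorant[OF adm]) auto
    hence "norm (pcos P t) powr p \<le> exp (2 * real n * p * Y + avg Y (\<psi> n y) t) * avg Y (h n y P) t"
      by (simp add: cos_of_real exp_add)
    hence "h n y P t \<le> exp (2 * real n * p * Y + avg Y (\<psi> n y) t) * avg Y (h n y P) t * exp (- \<psi> n y t)"
      unfolding h_def by (rule mult_right_mono) simp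
    also have "\<dots> = exp (2 * real n * p * Y + avg Y (\<psi> n y) t - \<psi> n y t) * avg Y (h n y P) t"
      by (simp add: exp_diff exp_minus field_simps)
    also have "\<dots> \<le> exp (ln \<theta>) * avg Y (h n y P) t"
      using expo integral_poisson_h_nonneg[OF adm] by (intro mult_right_mono) auto
    finally show "\<exists>j\<in>I. h n y P t \<le> \<theta> * avg (K * y j) (h n y P) t"
      using jI assms by (auto simp: Y_def)
  qed
qed

section \<open>Good points, and the return from the averaged to the given weight\<close>

context
  fixes \<Lambda> \<delta> :: real and n :: nat and y :: "nat \<Rightarrow> real" and P :: "complex poly"
  assumes adm: "admissible \<Lambda> n y" and deg: "degree P \<le> n" and \<delta>: "\<delta> > 0"
    and Dy: "\<And>i. i \<in> I \<Longrightarrow> D i \<le> real n * y i"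
begin

text \<open>At a good point the derivative is at most
  \<open>2 n (CA / \<delta>) powr (1 / p)\<close> times the value, so over a distance
  \<open>\<kappa> / n\<close> the function changes by at most half its value. The bound
  \<open>1/2\<close> keeps within the range of \<open>local_deriv_bound\<close>.\<close>

definition \<kappa> :: real where
  "\<kappa> = min (1 / 2) (1 / (4 * (CA \<Lambda> / \<delta>) powr (1 / p)))"

lemma \<kappa>: "0 < \<kappa>" "\<kappa> \<le> 1 / 2" "4 * (CA \<Lambda> / \<delta>) powr (1 / p) * \<kappa> \<le> 1"
proof -
  have B: "(CA \<Lambda> / \<delta>) powr (1 / p) > 0" using CA_pos[of \<Lambda>] \<delta> by simp
  show "0 < \<kappa>" "\<kappa> \<le> 1 / 2" using B by (auto simp: \<kappa>_def)
  have "4 * (CA \<Lambda> / \<delta>) powr (1 / p) * \<kappa> \<le> 4 * (CA \<Lambda> / \<delta>) powr (1 / p) * (1 / (4 * (CA \<Lambda> / \<delta>) powr (1 / p)))"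
    using B by (intro mult_left_mono) (auto simp: \<kappa>_def)
  thus "4 * (CA \<Lambda> / \<delta>) powr (1 / p) * \<kappa> \<le> 1" using B by simp
qed

text \<open>At a good point \<open>H\<close> is at most \<open>h / \<delta>\<close>, and
  \<open>h exp \<psi>\<close> is \<open>\<bar>f t\<bar>^p\<close>; the local derivative bound thus
  becomes a bound by the value at \<open>t\<close> itself.\<close>

lemma good_point_values:
  assumes good: "\<delta> * H n y P t \<le> h n y P t" and s: "\<bar>s - t\<bar> \<le> \<kappa> / real n"
  shows "norm (pcos P t) \<le> 2 * norm (pcos P s)"
proof -
  note n = n_pos[OF adm]
  define f where "f = (\<lambda>z::complex. poly P (cos z))"
  define M where "M = (CA \<Lambda> / \<delta>) powr (1 / p) * norm (pcos P t)"
  have M: "(CA \<Lambda> * H n y P t * exp (\<psi> n y t)) powr (1 / p) \<le> M"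
  proof -
    have "CA \<Lambda> * H n y P t * exp (\<psi> n y t) = CA \<Lambda> / \<delta> * ((\<delta> * H n y P t) * exp (\<psi> n y t))" using \<delta> by simp
    also have "\<dots> \<le> CA \<Lambda> / \<delta> * (h n y P t * exp (\<psi> n y t))"
      using good \<delta> CA_pos[of \<Lambda>] by (intro mult_left_mono mult_right_mono) auto
    also have "h n y P t * exp (\<psi> n y t) = norm (pcos P t) powr p"
      by (simp add: h_def mult.assoc exp_minus)
    finally have "(CA \<Lambda> * H n y P t * exp (\<psi> n y t)) powr (1 / p) \<le> (CA \<Lambda> / \<delta> * norm (pcos P t) powr p) powr (1 / p)"
      using p_pos CA_pos[of \<Lambda>] H_nonneg[OF adm, of P t] deg by (intro powr_mono2) auto
    also have "\<dots> = M"
      unfolding M_def using CA_pos[of \<Lambda>] \<delta> p_pos by (subst powr_mult) (auto simp: powr_powr)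
    finally show ?thesis .
  qed
  have "norm (f (of_real s) - f (of_real t)) \<le> 2 * real n * M * norm (of_real s - of_real t :: complex)"
  proof (rule field_differentiable_bound[of "closed_segment (of_real s) (of_real t)"])
    fix z :: complex assume "z \<in> closed_segment (of_real s) (of_real t)"
    then obtain r where r: "r \<in> closed_segment s t" "z = of_real r"
      by (auto simp: closed_segment_of_real)
    have "\<bar>r - t\<bar> \<le> \<bar>s - t\<bar>" using r(1) by (auto simp: closed_segment_eq_real_ivl split: if_splits)
    also have "\<dots> \<le> 1 / (2 * real n)" using s \<kappa> n by (simp add: field_simps)
    finally have "deriv_size P r \<le> 2 * real n * (CA \<Lambda> * H n y P t * exp (\<psi> n y t)) powr (1 / p)"
      by (intro local_deriv_bound[OF adm deg])
    also have "\<dots> \<le> 2 * real n * M" using M n by (intro mult_left_mono) auto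
    finally show "norm (poly (pderiv P) (cos z) * - sin z) \<le> 2 * real n * M"
      by (simp add: r(2) deriv_size_def norm_mult cos_of_real sin_of_real mult.commute)
    show "(f has_field_derivative (poly (pderiv P) (cos z) * - sin z)) (at z within closed_segment (of_real s) (of_real t))"
      unfolding f_def
      by (rule has_field_derivative_at_within, rule DERIV_chain2[OF poly_DERIV DERIV_cos])
  qed auto
  also have "norm (of_real s - of_real t :: complex) = \<bar>s - t\<bar>" by (metis norm_of_real of_real_diff)
  also have "2 * real n * M * \<bar>s - t\<bar> \<le> 2 * real n * M * (\<kappa> / real n)"
    using s n CA_pos[of \<Lambda>] \<delta> by (intro mult_left_mono) (auto simp: M_def)
  also have "\<dots> = (4 * (CA \<Lambda> / \<delta>) powr (1 / p) * \<kappa>) * (norm (pcos P t) / 2)"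
    using n by (simp add: M_def)
  also have "\<dots> \<le> 1 * (norm (pcos P t) / 2)"
    using \<kappa>(3) by (intro mult_right_mono) auto
  finally have "norm (f (of_real s) - f (of_real t)) \<le> norm (pcos P t) / 2" by simp
  moreover have "norm (f (of_real t)) \<le> norm (f (of_real s)) + norm (f (of_real s) - f (of_real t))"
    by (metis norm_triangle_sub norm_minus_commute)
  ultimately show ?thesis by (simp add: f_def cos_of_real field_simps)
qed

text \<open>The factors are the loss in \<open>\<bar>f\<bar>\<close>, the variation of the potential
  within \<open>1 / n\<close>, and the doubling cost of shrinking the radius from
  \<open>1 / n\<close> to \<open>\<kappa> / n\<close>.\<close>

definition CL :: real where
  "CL = 2 powr p * exp (C2 * \<Lambda>) * (2 / \<kappa>) ^ m"

lemma CL_pos: "CL > 0"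
  using \<kappa>(1) by (simp add: CL_def)

text \<open>On the arc of radius \<open>\<kappa> / n\<close> both \<open>\<bar>f\<bar>\<close> and
  the weight are comparable with their values at \<open>t\<close>, and by doubling the arc has
  \<nu>-mass comparable with \<open>V (1 / n) t\<close>.\<close>

lemma good_point_bound:
  assumes t: "t \<in> {0..pi}" and good: "\<delta> * H n y P t \<le> h n y P t" and gy: "\<And>i. i \<in> I \<Longrightarrow> 2 * y i \<le> \<bar>g i t\<bar>"
  shows "ennreal (h n y P t) \<le> ennreal CL *
    (\<integral>\<^sup>+ s. (if \<bar>s - t\<bar> \<le> \<kappa> / real n then 1 else 0) * ennreal (norm (pcos P s) powr p * W s) \<partial>\<nu>)"
proof -
  note n = n_pos[OF adm]
  define k where "k = 2 powr p * exp (C2 * \<Lambda>)"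
  have k: "k > 0" by (simp add: k_def)
  have V0: "V (1 / real n) t > 0" using n by (auto intro: V_pos)
  have pt: "h n y P t / (k * V (1 / real n) t) \<le> norm (pcos P s) powr p * W s"
    if s: "\<bar>s - t\<bar> \<le> \<kappa> / real n" for s
  proof -
    have s1: "\<bar>s - t\<bar> \<le> 1 / real n" using s \<kappa> n by (simp add: field_simps)
    have "norm (pcos P t) powr p \<le> (2 * norm (pcos P s)) powr p"
      using good_point_values[OF good s] p_pos by (intro powr_mono2) auto
    also have "\<dots> = 2 powr p * norm (pcos P s) powr p" by (subst powr_mult) auto
    finally have f: "norm (pcos P t) powr p \<le> 2 powr p * norm (pcos P s) powr p" .
    \<comment> \<open>From \<open>\<bar>g i t\<bar> \<ge> 2 y i\<close> and
      \<open>D i \<le> n y i\<close> the arc stays in \<open>\<bar>g i\<bar> \<ge> y i\<close>,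
      where the truncated and the given weight agree.\<close>
    have Ws: "W s = exp (- pot y s)"
    proof (rule W_eq[OF adm])
      fix i assume i: "i \<in> I"
      have "\<bar>g i s - g i t\<bar> \<le> D i * \<bar>s - t\<bar>" by (rule weight_factor.g_lipschitz[OF wf[OF i]])
      also have "\<dots> \<le> D i * (1 / real n)"
        using s1 weight_factor.params[OF wf[OF i]] by (intro mult_left_mono) auto
      also have "\<dots> \<le> y i" using Dy[OF i] n by (simp add: field_simps)
      finally show "y i \<le> \<bar>g i s\<bar>" using gy[OF i] by linarith
    qed
    have "pot y s - pot y t \<le> C2 * \<Lambda> * real n * \<bar>s - t\<bar>" using pot_lipschitz[OF adm, of s t] by simp
    also have "\<dots> \<le> C2 * \<Lambda> * real n * (1 / real n)"
      using s1 C2_nonneg y(5)[OF adm] by (intro mult_left_mono) auto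
    finally have "- pot y t \<le> C2 * \<Lambda> + (- pot y s)" using n by simp
    hence "exp (- pot y t) \<le> exp (C2 * \<Lambda> + (- pot y s))" by (subst exp_le_cancel_iff)
    hence e: "exp (- pot y t) \<le> exp (C2 * \<Lambda>) * W s" by (simp only: exp_add Ws)
    have "h n y P t = norm (pcos P t) powr p * exp (- pot y t) * V (1 / real n) t"
      by (simp add: h_def exp_psi[OF adm])
    also have "\<dots> \<le> (2 powr p * norm (pcos P s) powr p) * (exp (C2 * \<Lambda>) * W s) * V (1 / real n) t"
      using f e V0 by (intro mult_right_mono mult_mono) auto
    also have "\<dots> = (norm (pcos P s) powr p * W s) * (k * V (1 / real n) t)" by (simp add: k_def)
    finally show ?thesis using k V0 by (simp add: pos_divide_le_eq)
  qed
  define v where "v = measure \<nu> (cball t (\<kappa> / real n))"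
  have v: "V (1 / real n) t \<le> (2 / \<kappa>) ^ m * v"
  proof -
    have ft: "fold_angle t = t" using t by (intro fold_angle_ident) auto
    have "measure \<nu> (cball t (1 / \<kappa> * (\<kappa> / real n))) \<le> (2 * (1 / \<kappa>)) ^ m * measure \<nu> (cball t (\<kappa> / real n))"
      using t \<kappa> n by (intro doubling_scale) (auto simp: field_simps)
    thus ?thesis using \<kappa>(1) by (simp add: V_def ft v_def)
  qed
  have "h n y P t = CL * (h n y P t / (k * V (1 / real n) t) * (V (1 / real n) t / (2 / \<kappa>) ^ m))"
    using k V0 \<kappa>(1) by (simp add: CL_def k_def)
  also have "\<dots> \<le> CL * (h n y P t / (k * V (1 / real n) t) * v)"
  proof (intro mult_left_mono)
    have "0 < (2 / \<kappa>) ^ m" using \<kappa>(1) by simp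
    thus "V (1 / real n) t / (2 / \<kappa>) ^ m \<le> v" using v by (simp only: pos_divide_le_eq mult.commute)
  qed (use k V0 CL_pos h_nonneg[OF adm] in auto)
  finally have "ennreal (h n y P t) \<le> ennreal (CL * (h n y P t / (k * V (1 / real n) t) * v))" by (rule ennreal_leI)
  also have "\<dots> = ennreal CL * (ennreal (h n y P t / (k * V (1 / real n) t)) * ennreal v)"
  proof -
    have *: "ennreal (CL * (a * v)) = ennreal CL * (ennreal a * ennreal v)" if "a \<ge> 0" for a
      using that CL_pos by (simp add: ennreal_mult')
    show ?thesis using k V0 h_nonneg[OF adm, of P t] by (intro *) auto
  qed
  also have "\<dots> \<le> ennreal CL *
    (\<integral>\<^sup>+ s. (if \<bar>s - t\<bar> \<le> \<kappa> / real n then 1 else 0) * ennreal (norm (pcos P s) powr p * W s) \<partial>\<nu>)"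
  proof (rule mult_left_mono)
    have "ennreal (h n y P t / (k * V (1 / real n) t)) * ennreal v
       = (\<integral>\<^sup>+ s. ennreal (h n y P t / (k * V (1 / real n) t)) * indicator (cball t (\<kappa> / real n)) s \<partial>\<nu>)"
      by (subst nn_integral_cmult_indicator) (auto simp: v_def emeasure_eq_measure)
    also have "\<dots> \<le> (\<integral>\<^sup>+ s. (if \<bar>s - t\<bar> \<le> \<kappa> / real n then 1 else 0) * ennreal (norm (pcos P s) powr p * W s) \<partial>\<nu>)"
    proof (rule nn_integral_mono)
      fix s
      show "ennreal (h n y P t / (k * V (1 / real n) t)) * indicator (cball t (\<kappa> / real n)) s
        \<le> (if \<bar>s - t\<bar> \<le> \<kappa> / real n then 1 else 0) * ennreal (norm (pcos P s) powr p * W s)"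
        using ennreal_leI[OF pt[of s]] by (auto simp: indicator_def dist_real_def abs_minus_commute)
    qed
    finally show "ennreal (h n y P t / (k * V (1 / real n) t)) * ennreal v
      \<le> (\<integral>\<^sup>+ s. (if \<bar>s - t\<bar> \<le> \<kappa> / real n then 1 else 0) * ennreal (norm (pcos P s) powr p * W s) \<partial>\<nu>)" .
  qed simp
  finally show ?thesis .
qed

text \<open>\<open>G\<close> sums the averages at all heights with respect to which a point can be
  bad, and its mass is at most \<open>2 (card I + 1)\<close> times that of \<open>h\<close>. With
  this \<delta> the points where \<open>h \<le> \<delta> G\<close> carry at most a quarter of the
  mass. All other points are good and far from the zeros.\<close>

lemma lower_estimate:
  fixes K :: real
  assumes K: "K \<ge> 1" and \<delta>N: "\<delta> = 1 / (8 * (real (card I) + 1))"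
    and bad: "\<And>t i0. t \<in> {0..pi} \<Longrightarrow> i0 \<in> I \<Longrightarrow> \<bar>g i0 t\<bar> < 2 * y i0 \<Longrightarrow>
      \<exists>j\<in>I. h n y P t \<le> \<delta> / 2 * avg (K * y j) (h n y P) t"
  shows "h_mass n y P
    \<le> ennreal (4 * CL * \<kappa> / real n) * p_norm P"
proof -
  note n = n_pos[OF adm]
  note [measurable] = h_measurable[OF adm, of P] H_measurable[OF adm deg]
  have [measurable]: "(\<lambda>t. pcos P t) \<in> borel_measurable borel"
    by (intro borel_measurable_continuous_onI continuous_intros)
  have Ky: "K * y j > 0" if "j \<in> I" for j using K y(1)[OF adm that] by simp
  define E where "E = (\<lambda>j t. LINT u|poisson (K * y j). h n y P (t + u))"
  have E0: "E j t \<ge> 0" for j t unfolding E_def by (rule integral_poisson_h_nonneg[OF adm])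
  have [measurable]: "E j \<in> borel_measurable borel" if "j \<in> I" for j
    unfolding E_def using integral_poisson_h_measurable[OF adm Ky[OF that]] by simp
  define G where "G = (\<lambda>t. H n y P t + (\<Sum>j\<in>I. E j t))"
  have H0: "H n y P t \<ge> 0" for t by (rule H_nonneg[OF adm deg])
  have G0: "G t \<ge> 0" for t unfolding G_def by (intro add_nonneg_nonneg H0 sum_nonneg E0)
  define X where "X = h_mass n y P"
  define N where "N = (\<lambda>s t. (indicator {0..pi} t * (if \<bar>s - t\<bar> \<le> \<kappa> / real n then 1 else 0)) :: ennreal)"
  have [measurable]: "case_prod N \<in> borel_measurable (borel \<Otimes>\<^sub>M borel)" unfolding N_def by measurable
  define f where "f = (\<lambda>s. ennreal (norm (pcos P s) powr p * W s))"
  have [measurable]: "f \<in> borel_measurable borel" unfolding f_def by measurable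
  interpret pair_sigma_finite \<nu> "lborel :: real measure" ..
  have pt: "indicator {0..pi} t * ennreal (h n y P t)
     \<le> ennreal \<delta> * (indicator {0..pi} t * ennreal (G t)) + ennreal CL * (\<integral>\<^sup>+ s. N s t * f s \<partial>\<nu>)" for t
  proof (cases "t \<in> {0..pi} \<and> h n y P t > \<delta> * G t")
    case True
    hence t: "t \<in> {0..pi}" "\<delta> * G t < h n y P t" by auto
    have HG: "H n y P t \<le> G t" unfolding G_def using E0 by (simp add: sum_nonneg)
    have "\<delta> * H n y P t \<le> \<delta> * G t" using HG \<delta> by (intro mult_left_mono) auto
    hence good: "\<delta> * H n y P t \<le> h n y P t" using t by simp
    have gy: "2 * y i \<le> \<bar>g i t\<bar>" if i: "i \<in> I" for i
    proof (rule ccontr)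
      assume "\<not> 2 * y i \<le> \<bar>g i t\<bar>"
      then obtain j where j: "j \<in> I" "h n y P t \<le> \<delta> / 2 * E j t"
        using bad[OF t(1) i] unfolding E_def by auto
      have "E j t \<le> (\<Sum>j\<in>I. E j t)" using j I_finite E0 by (intro member_le_sum) auto
      hence "E j t \<le> G t" using H0[of t] by (simp add: G_def)
      hence "\<delta> / 2 * E j t \<le> \<delta> / 2 * G t" using \<delta> by (intro mult_left_mono) auto
      also have "\<dots> \<le> \<delta> * G t" using \<delta> G0[of t] by (intro mult_right_mono) auto
      finally show False using j t by simp
    qed
    have "ennreal (h n y P t) \<le> ennreal CL * (\<integral>\<^sup>+ s. N s t * f s \<partial>\<nu>)"
      using good_point_bound[OF t(1) good gy] t(1) by (simp add: N_def f_def)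
    thus ?thesis using t(1) by (simp add: add_increasing)
  next
    case False
    show ?thesis
    proof (cases "t \<in> {0..pi}")
      case True
      hence "h n y P t \<le> \<delta> * G t" using False by auto
      hence "ennreal (h n y P t) \<le> ennreal \<delta> * ennreal (G t)"
        using \<delta> by (simp add: ennreal_mult'[symmetric] ennreal_leI)
      thus ?thesis using True by (simp add: add_increasing2)
    qed simp
  qed
  have intG: "(\<integral>\<^sup>+ t. indicator {0..pi} t * ennreal (G t) \<partial>lborel) \<le> ennreal (2 * (real (card I) + 1)) * X"
  proof -
    have "(\<integral>\<^sup>+ t. indicator {0..pi} t * ennreal (G t) \<partial>lborel)
      = (\<integral>\<^sup>+ t. indicator {0..pi} t * ennreal (H n y P t) + (\<Sum>j\<in>I. indicator {0..pi} t * ennreal (E j t)) \<partial>lborel)"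
      unfolding G_def
      by (intro nn_integral_cong, subst ennreal_plus)
         (auto simp: H0 E0 sum_nonneg sum_ennreal[symmetric] distrib_left sum_distrib_left simp del: sum_ennreal)
    also have "\<dots> = (\<integral>\<^sup>+ t. indicator {0..pi} t * ennreal (H n y P t) \<partial>lborel)
       + (\<integral>\<^sup>+ t. (\<Sum>j\<in>I. indicator {0..pi} t * ennreal (E j t)) \<partial>lborel)"
      by (intro nn_integral_add) measurable
    also have "(\<integral>\<^sup>+ t. (\<Sum>j\<in>I. indicator {0..pi} t * ennreal (E j t)) \<partial>lborel)
       = (\<Sum>j\<in>I. \<integral>\<^sup>+ t. indicator {0..pi} t * ennreal (E j t) \<partial>lborel)"
      by (intro nn_integral_sum) measurable
    also have "(\<integral>\<^sup>+ t. indicator {0..pi} t * ennreal (H n y P t) \<partial>lborel)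
       + (\<Sum>j\<in>I. \<integral>\<^sup>+ t. indicator {0..pi} t * ennreal (E j t) \<partial>lborel) \<le> 2 * X + (\<Sum>j\<in>I. 2 * X)"
      unfolding X_def E_def H_def using n Ky
      by (intro add_mono sum_mono nn_integral_mean_h[OF adm]) auto
    also have "\<dots> = ennreal (2 * (real (card I) + 1)) * X"
    proof -
      have "ennreal (2 * (real (card I) + 1)) = 2 * (of_nat (card I) + 1)"
        by (simp add: ennreal_mult' ennreal_plus ennreal_of_nat_eq_real_of_nat)
      thus ?thesis by (simp add: distrib_left distrib_right mult_ac)
    qed
    finally show ?thesis .
  qed
  define Q where "Q = ennreal CL * (\<integral>\<^sup>+ t. \<integral>\<^sup>+ s. N s t * f s \<partial>\<nu> \<partial>lborel)"
  have "X \<le> (\<integral>\<^sup>+ t. ennreal \<delta> * (indicator {0..pi} t * ennreal (G t)) + ennreal CL * (\<integral>\<^sup>+ s. N s t * f s \<partial>\<nu>) \<partial>lborel)"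
    unfolding X_def by (intro nn_integral_mono pt)
  also have "\<dots> = (\<integral>\<^sup>+ t. ennreal \<delta> * (indicator {0..pi} t * ennreal (G t)) \<partial>lborel)
     + (\<integral>\<^sup>+ t. ennreal CL * (\<integral>\<^sup>+ s. N s t * f s \<partial>\<nu>) \<partial>lborel)"
    unfolding G_def by (intro nn_integral_add) measurable
  also have "(\<integral>\<^sup>+ t. ennreal CL * (\<integral>\<^sup>+ s. N s t * f s \<partial>\<nu>) \<partial>lborel) = Q"
    unfolding Q_def by (intro nn_integral_cmult) measurable
  also have "(\<integral>\<^sup>+ t. ennreal \<delta> * (indicator {0..pi} t * ennreal (G t)) \<partial>lborel)
     = ennreal \<delta> * (\<integral>\<^sup>+ t. indicator {0..pi} t * ennreal (G t) \<partial>lborel)"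
    unfolding G_def by (intro nn_integral_cmult) measurable
  also have "\<dots> + Q \<le> ennreal \<delta> * (ennreal (2 * (real (card I) + 1)) * X) + Q"
    by (intro add_right_mono mult_left_mono intG) simp
  also have "ennreal \<delta> * (ennreal (2 * (real (card I) + 1)) * X) = ennreal (1 / 4) * X"
  proof -
    have "ennreal \<delta> * ennreal (2 * (real (card I) + 1)) = ennreal (\<delta> * (2 * (real (card I) + 1)))"
      using \<delta> by (simp add: ennreal_mult')
    also have "\<delta> * (2 * (real (card I) + 1)) = 1 / 4"
    proof -
      have "real (card I) + 1 \<noteq> 0" by (metis of_nat_0_le_iff add_nonneg_eq_0_iff zero_le_one zero_neq_one)
      thus ?thesis unfolding \<delta>N by (simp add: field_simps)
    qed
    finally show ?thesis by (simp add: mult.assoc[symmetric])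
  qed
  finally have XQ: "X \<le> ennreal (1 / 4) * X + Q" .
  \<comment> \<open>From \<open>X \<le> X / 4 + Q\<close>; the subtraction is legitimate because
    \<open>X\<close> is finite.\<close>
  have "X \<le> 2 * Q"
  proof (cases "Q = \<infinity>")
    case True thus ?thesis by (simp add: ennreal_mult_eq_top_iff)
  next
    case False
    then obtain q where q: "Q = ennreal q" "q \<ge> 0" by (cases Q) auto
    have "X \<noteq> \<infinity>" using nn_integral_h_finite[OF adm, of P] by (simp add: X_def)
    then obtain x where x: "X = ennreal x" "x \<ge> 0" by (cases X) auto
    have "ennreal x \<le> ennreal (1 / 4 * x + q)"
      using XQ x q by (simp only: x q ennreal_mult'[symmetric] ennreal_plus[symmetric] mult_nonneg_nonneg)
    hence "x \<le> 1 / 4 * x + q" using x q by (subst (asm) ennreal_le_iff) auto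
    hence "x \<le> 2 * q" using x q by simp
    hence "ennreal x \<le> ennreal (2 * q)" by (rule ennreal_leI)
    thus ?thesis using x q by (simp add: ennreal_mult')
  qed
  also have "Q \<le> ennreal CL * (ennreal (2 * \<kappa> / real n) * (\<integral>\<^sup>+ s. f s \<partial>\<nu>))"
    unfolding Q_def
  proof (rule mult_left_mono)
    have "(\<integral>\<^sup>+ t. \<integral>\<^sup>+ s. N s t * f s \<partial>\<nu> \<partial>lborel) = (\<integral>\<^sup>+ s. \<integral>\<^sup>+ t. N s t * f s \<partial>lborel \<partial>\<nu>)"
      by (rule Fubini') measurable
    also have "\<dots> \<le> (\<integral>\<^sup>+ s. ennreal (2 * \<kappa> / real n) * f s \<partial>\<nu>)"
    proof (rule nn_integral_mono)
      fix s
      have "(\<integral>\<^sup>+ t. N s t * f s \<partial>lborel) \<le> (\<integral>\<^sup>+ t. f s * indicator {s - \<kappa> / real n..s + \<kappa> / real n} t \<partial>lborel)"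
        by (intro nn_integral_mono) (auto simp: N_def indicator_def abs_le_iff)
      also have "\<dots> = f s * ennreal (2 * \<kappa> / real n)"
        using \<kappa> n by (subst nn_integral_cmult_indicator) auto
      finally show "(\<integral>\<^sup>+ t. N s t * f s \<partial>lborel) \<le> ennreal (2 * \<kappa> / real n) * f s" by (simp add: mult.commute)
    qed
    also have "\<dots> = ennreal (2 * \<kappa> / real n) * (\<integral>\<^sup>+ s. f s \<partial>\<nu>)"
      by (rule nn_integral_cmult) measurable
    finally show "(\<integral>\<^sup>+ t. \<integral>\<^sup>+ s. N s t * f s \<partial>\<nu> \<partial>lborel) \<le> ennreal (2 * \<kappa> / real n) * (\<integral>\<^sup>+ s. f s \<partial>\<nu>)" .
  qed simp
  finally have "X \<le> 2 * (ennreal CL * (ennreal (2 * \<kappa> / real n) * (\<integral>\<^sup>+ s. f s \<partial>\<nu>)))"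
    by (simp add: mult_left_mono)
  also have "\<dots> = (ennreal 2 * ennreal CL * ennreal (2 * \<kappa> / real n)) * (\<integral>\<^sup>+ s. f s \<partial>\<nu>)"
    by (simp add: mult.assoc)
  also have "ennreal 2 * ennreal CL * ennreal (2 * \<kappa> / real n) = ennreal (2 * CL * (2 * \<kappa> / real n))"
    using CL_pos \<kappa> by (simp only: ennreal_mult' ennreal_mult'' zero_le_numeral less_imp_le mult_nonneg_nonneg)
  also have "2 * CL * (2 * \<kappa> / real n) = 4 * CL * \<kappa> / real n" by simp
  finally show ?thesis by (simp add: X_def f_def)
qed

end

end

section \<open>Assembly for large degrees and extension to all degrees\<close>

context Omega_doubling
begin

text \<open>The upper estimate costs \<open>n\<close> times \<open>n powr p\<close> and the lower
  one gains \<open>1 / n\<close>, because the auxiliary mass is an integral in \<open>dt\<close> of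
  arc masses at scale \<open>1 / n\<close>. The remaining constants do not depend on
  \<open>n\<close>.\<close>

theorem weighted_Bernstein:
  "\<exists>C\<ge>0. \<forall>n\<ge>1. \<forall>P. degree P \<le> n \<longrightarrow>
     deriv_p_norm P
     \<le> ennreal (C * real n powr p) * p_norm P"
proof -
  define \<delta> where "\<delta> = 1 / (8 * (real (card I) + 1))"
  have \<delta>: "\<delta> > 0" by (simp add: \<delta>_def add_nonneg_pos)
  obtain K \<Lambda> \<epsilon> R where K: "K \<ge> 1" and \<Lambda>: "\<Lambda> > 0" and \<epsilon>: "\<epsilon> > 0"
    and bad: "\<And>n y P t i0. admissible \<Lambda> n y \<Longrightarrow>
    (\<And>i. i \<in> I \<Longrightarrow> y i < \<epsilon> \<and> R < F i (y i)) \<Longrightarrow> degree P \<le> n \<Longrightarrow> t \<in> {0..pi} \<Longrightarrow> i0 \<in> I \<Longrightarrow>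
    \<bar>g i0 t\<bar> < 2 * y i0 \<Longrightarrow> \<exists>j\<in>I. h n y P t \<le> \<delta> / 2 * avg (K * y j) (h n y P) t"
    using bad_points[of "\<delta> / 2"] \<delta> by (metis half_gt_zero)
  \<comment> \<open>The second entry makes \<open>\<Lambda> n y i = F i (y i)\<close> exceed
    \<open>\<Lambda> D i\<close>, which is the condition \<open>D i \<le> n y i\<close>.\<close>
  define R' where "R' = max R (\<Lambda> * (\<Sum>i\<in>I. D i))"
  have "\<forall>i\<in>I. eventually (\<lambda>n. \<exists>y. 0 < y \<and> y < \<epsilon> \<and> y \<le> A i \<and> F i y = \<Lambda> * real n * y \<and> R' < F i y) sequentially"
    using weight_factor.truncation_level[OF wf F_lim \<Lambda> \<epsilon>] by blast
  hence "eventually (\<lambda>n. \<forall>i\<in>I. \<exists>y. 0 < y \<and> y < \<epsilon> \<and> y \<le> A i \<and> F i y = \<Lambda> * real n * y \<and> R' < F i y) sequentially"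
    using I_finite by (intro eventually_ball_finite)
  then obtain n1 where n1: "\<And>n. n \<ge> n1 \<Longrightarrow> \<forall>i\<in>I. \<exists>y. 0 < y \<and> y < \<epsilon> \<and> y \<le> A i \<and> F i y = \<Lambda> * real n * y \<and> R' < F i y"
    unfolding eventually_sequentially by blast
  define n0 where "n0 = max 4 n1"
  define c1 where "c1 = CA \<Lambda> * exp (C2 * \<Lambda>)"
  define c2 where "c2 = 4 * CL \<Lambda> \<delta> * \<kappa> \<Lambda> \<delta>"
  have c: "c1 \<ge> 0" using CA_pos[of \<Lambda>] by (simp add: c1_def)
  have main: "deriv_p_norm P
     \<le> ennreal (4 * c1 * c2 * (2 * real n) powr p) * p_norm P
     \<and> c2 \<ge> 0"
    if n: "n \<ge> n0" and deg: "degree P \<le> n" for n P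
  proof -
    have "\<forall>i\<in>I. \<exists>y. 0 < y \<and> y < \<epsilon> \<and> y \<le> A i \<and> F i y = \<Lambda> * real n * y \<and> R' < F i y"
      using n by (intro n1) (simp add: n0_def)
    then obtain y where y: "\<And>i. i \<in> I \<Longrightarrow> 0 < y i \<and> y i < \<epsilon> \<and> y i \<le> A i \<and> F i (y i) = \<Lambda> * real n * y i \<and> R' < F i (y i)"
      by metis
    have adm: "admissible \<Lambda> n y" using y n \<Lambda> by (auto simp: admissible_def n0_def)
    have yR: "y i < \<epsilon> \<and> R < F i (y i)" if "i \<in> I" for i
      using y[OF that] by (simp add: R'_def)
    have Dy: "D i \<le> real n * y i" if i: "i \<in> I" for i
    proof -
      have "D i \<le> (\<Sum>i\<in>I. D i)"
        using i I_finite weight_factor.params[OF wf] by (intro member_le_sum) (auto intro: order_trans[of 0 1])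
      hence "\<Lambda> * D i \<le> \<Lambda> * (\<Sum>i\<in>I. D i)" using \<Lambda> by (intro mult_left_mono) auto
      also have "\<dots> \<le> \<Lambda> * (real n * y i)" using y[OF i] by (simp add: R'_def mult.assoc)
      finally show ?thesis using \<Lambda> by simp
    qed
    have npos: "real n > 0" using n by (auto simp: n0_def)
    define X where "X = h_mass n y P"
    define Q where "Q = p_norm P"
    have up: "deriv_p_norm P
       \<le> ennreal (4 * real n * ((2 * real n) powr p * CA \<Lambda> * exp (C2 * \<Lambda>))) * X"
      unfolding X_def by (rule upper_estimate[OF adm deg])
    have low: "X \<le> ennreal (4 * CL \<Lambda> \<delta> * \<kappa> \<Lambda> \<delta> / real n) * Q"
      unfolding X_def Q_def using K \<delta>_def bad[OF adm yR deg]
      by (intro lower_estimate[OF adm deg \<delta> Dy]) auto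
    have "c2 \<ge> 0"
      using CL_pos[OF adm deg \<delta> Dy] \<kappa>(1)[OF adm deg \<delta> Dy] by (simp add: c2_def)
    have "deriv_p_norm P
       \<le> ennreal (4 * real n * ((2 * real n) powr p * CA \<Lambda> * exp (C2 * \<Lambda>))) * (ennreal (c2 / real n) * Q)"
      by (rule order_trans[OF up mult_left_mono]) (use low in \<open>auto simp: c2_def\<close>)
    also have "\<dots> = ennreal (4 * real n * ((2 * real n) powr p * CA \<Lambda> * exp (C2 * \<Lambda>)) * (c2 / real n)) * Q"
      using \<open>c2 \<ge> 0\<close> by (subst ennreal_mult'') (auto simp: mult.assoc)
    also have "4 * real n * ((2 * real n) powr p * CA \<Lambda> * exp (C2 * \<Lambda>)) * (c2 / real n) = 4 * c1 * c2 * (2 * real n) powr p"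
      using npos by (simp add: c1_def)
    finally show ?thesis using \<open>c2 \<ge> 0\<close> by (simp add: Q_def)
  qed
  \<comment> \<open>The zero polynomial at \<open>n0\<close> serves as a sample: the facts on
    \<open>CL\<close> and \<open>\<kappa>\<close> are available once an admissible level
    exists.\<close>
  have c2: "c2 \<ge> 0" using main[of n0 0] by simp
  define C where "C = 4 * c1 * c2 * (2 * real n0) powr p"
  show ?thesis
  proof (intro exI[of _ C] conjI allI impI)
    show "C \<ge> 0" using c c2 by (simp add: C_def)
    fix n :: nat and P :: "complex poly" assume n: "n \<ge> 1" and deg: "degree P \<le> n"
    \<comment> \<open>A polynomial of small degree is treated as one of degree at most
      \<open>max n n0 \<le> n0 n\<close>; this costs \<open>n0 powr p\<close>.\<close>
    have N: "max n n0 \<ge> n0" "degree P \<le> max n n0" using deg by auto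
    have "1 * n \<le> n0 * n" "n0 * 1 \<le> n0 * n" using n by (intro mult_le_mono; simp add: n0_def)+
    hence "max n n0 \<le> n0 * n" by simp
    hence "real (max n n0) \<le> real n0 * real n" by (metis of_nat_le_iff of_nat_mult)
    hence "(2 * real (max n n0)) powr p \<le> (2 * real n0 * real n) powr p"
      using p_pos by (intro powr_mono2) auto
    also have "\<dots> = (2 * real n0) powr p * real n powr p" by (subst powr_mult) auto
    finally have "4 * c1 * c2 * (2 * real (max n n0)) powr p \<le> 4 * c1 * c2 * ((2 * real n0) powr p * real n powr p)"
      using c c2 by (intro mult_left_mono) auto
    hence le: "4 * c1 * c2 * (2 * real (max n n0)) powr p \<le> C * real n powr p" by (simp add: C_def mult.assoc)
    have "deriv_p_norm P
      \<le> ennreal (4 * c1 * c2 * (2 * real (max n n0)) powr p) * p_norm P"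
      using main[OF N] by blast
    also have "\<dots> \<le> ennreal (C * real n powr p) * p_norm P"
      using le by (intro mult_right_mono ennreal_leI) auto
    finally show "deriv_p_norm P
      \<le> ennreal (C * real n powr p) * p_norm P" .
  qed
qed

end

section \<open>Transfer to the interval by the substitution \<open>x = cos t\<close>\<close>

lemma set_integral_angle_measure:
  fixes f :: "real \<Rightarrow> real"
  assumes u: "weight u" and [measurable]: "G \<in> borel_measurable borel"
    and f: "\<And>x. x \<in> {-1..1} \<Longrightarrow> f x = G (arccos x)" and G: "\<And>t. 0 \<le> G t" "\<And>t. G t \<le> B"
  shows "ennreal (LINT x:{-1..1}|lebesgue. f x * u x) = (\<integral>\<^sup>+ t. ennreal (G t) \<partial>angle_measure u)"
proof -
  note [measurable] = weight_measurable(1)[OF u]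
  have e: "indicator {-1..1} x * (f x * u x)
      = G (arccos (max (-1) (min 1 x))) * (indicator {-1..1} x * u x)" for x
    using f[of x] by (auto simp: indicator_def max_def min_def)
  have nn: "0 \<le> indicator {-1..1} x * (f x * u x)" for x
    unfolding e by (rule mult_nonneg_nonneg[OF G(1) weight_measurable(3)[OF u]])
  have [measurable]: "(\<lambda>x. G (arccos (max (-1) (min 1 x)))) \<in> borel_measurable lebesgue"
    by (rule measurable_compose[OF clamped_arccos_measurable_lebesgue]) measurable
  have "integrable lebesgue (\<lambda>x. B * (indicator {-1..1} x * u x))"
    using weight_measurable(2)[OF u] by (rule integrable_mult_right)
  hence int: "integrable lebesgue (\<lambda>x. indicator {-1..1} x * (f x * u x))"
  proof (rule Bochner_Integration.integrable_bound)
    show "(\<lambda>x. indicator {-1..1} x * (f x * u x)) \<in> borel_measurable lebesgue"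
      unfolding e by measurable
    show "AE x in lebesgue. norm (indicator {-1..1} x * (f x * u x)) \<le> norm (B * (indicator {-1..1} x * u x))"
    proof (rule AE_I2)
      fix x
      have "G (arccos (max (-1) (min 1 x))) * (indicator {-1..1} x * u x) \<le> B * (indicator {-1..1} x * u x)"
        using G weight_measurable(3)[OF u, of x] by (intro mult_right_mono) auto
      thus "norm (indicator {-1..1} x * (f x * u x)) \<le> norm (B * (indicator {-1..1} x * u x))"
        using nn[of x] unfolding e by (simp add: abs_of_nonneg)
    qed
  qed
  have "ennreal (LINT x:{-1..1}|lebesgue. f x * u x) = (\<integral>\<^sup>+ x. ennreal (indicator {-1..1} x * (f x * u x)) \<partial>lebesgue)"
    unfolding set_lebesgue_integral_def real_scaleR_def
    using nn by (intro nn_integral_eq_integral[symmetric] int) auto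
  also have "\<dots> = (\<integral>\<^sup>+ x. ennreal (indicator {-1..1} x * u x) * ennreal (G (arccos x)) \<partial>lebesgue)"
  proof (rule nn_integral_cong)
    fix x
    show "ennreal (indicator {-1..1} x * (f x * u x)) = ennreal (indicator {-1..1} x * u x) * ennreal (G (arccos x))"
      using f[of x] G(1)[of "arccos x"] weight_measurable(3)[OF u, of x]
      by (cases "x \<in> {-1..1}") (auto simp: ennreal_mult'[symmetric] mult.commute)
  qed
  also have "\<dots> = (\<integral>\<^sup>+ t. ennreal (G t) \<partial>angle_measure u)"
    by (rule nn_integral_angle_measure[OF u, symmetric]) measurable
  finally show ?thesis .
qed

theorem theorem7p1:
  fixes p :: real and s :: nat and \<omega>s :: "nat \<Rightarrow> real \<Rightarrow> real" and \<omega> u :: "real \<Rightarrow> real"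
  assumes "0 < p"
    and "1 \<le> s"
    and "\<And>i. i \<in> {1..s} \<Longrightarrow> (\<lambda>t. \<omega>s i (cos t)) \<in> Omega_class"
    and "\<And>x. x \<in> {-1..1} \<Longrightarrow> \<omega> x = (\<Prod>i=1..s. \<omega>s i x)"
    and "doubling_weight u"
  shows "\<exists>C::real. \<forall>n\<ge>1. \<forall>P :: complex poly. degree P \<le> n \<longrightarrow>
    (LINT x:{-1..1}|lebesgue.
       phi x powr p * cmod (poly (pderiv P) (complex_of_real x)) powr p * (\<omega> x * u x))
    \<le> C * real n powr p *
    (LINT x:{-1..1}|lebesgue. cmod (poly P (complex_of_real x)) powr p * (\<omega> x * u x))"
proof -
  have u: "weight u" using assms(5) by (simp add: doubling_weight_def)
  define I where "I = {1..s}"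
  have "\<forall>i\<in>I. \<exists>A a1 a2 b D c F F' F'' g g' g''.
    weight_factor A a1 a2 b D c F F' F'' g g' g'' \<and> (\<forall>t. g (t + 2 * pi) = g t) \<and> (\<forall>t. g t = 0 \<longrightarrow> g' t \<noteq> 0) \<and>
    filterlim F at_top (at_right 0) \<and> (\<forall>t. \<omega>s i (cos t) = (if g t = 0 then 0 else exp (- F \<bar>g t\<bar>)))"
  proof
    fix i assume "i \<in> I"
    hence i: "i \<in> {1..s}" by (simp add: I_def)
    show "\<exists>A a1 a2 b D c F F' F'' g g' g''.
      weight_factor A a1 a2 b D c F F' F'' g g' g'' \<and> (\<forall>t. g (t + 2 * pi) = g t) \<and> (\<forall>t. g t = 0 \<longrightarrow> g' t \<noteq> 0) \<and>
      filterlim F at_top (at_right 0) \<and> (\<forall>t. \<omega>s i (cos t) = (if g t = 0 then 0 else exp (- F \<bar>g t\<bar>)))"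
      by (rule Omega_class_weight_factor[OF assms(3)[OF i]]) (intro exI conjI allI impI; assumption)
  qed
  then obtain A a1 a2 b D c F F' F'' g g' g'' where
    "\<forall>i\<in>I. weight_factor (A i) (a1 i) (a2 i) (b i) (D i) (c i) (F i) (F' i) (F'' i) (g i) (g' i) (g'' i) \<and>
      (\<forall>t. g i (t + 2 * pi) = g i t) \<and> (\<forall>t. g i t = 0 \<longrightarrow> g' i t \<noteq> 0) \<and>
      filterlim (F i) at_top (at_right 0) \<and>
      (\<forall>t. \<omega>s i (cos t) = (if g i t = 0 then 0 else exp (- F i \<bar>g i t\<bar>)))"
    unfolding bchoice_iff by (elim exE) (rule that)
  hence wf: "\<And>i. i \<in> I \<Longrightarrow> weight_factor (A i) (a1 i) (a2 i) (b i) (D i) (c i) (F i) (F' i) (F'' i) (g i) (g' i) (g'' i)"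
    and per: "\<And>i t. i \<in> I \<Longrightarrow> g i (t + 2 * pi) = g i t"
    and simple: "\<And>i t. i \<in> I \<Longrightarrow> g i t = 0 \<Longrightarrow> g' i t \<noteq> 0"
    and lim: "\<And>i. i \<in> I \<Longrightarrow> filterlim (F i) at_top (at_right 0)"
    and w: "\<And>i t. i \<in> I \<Longrightarrow> \<omega>s i (cos t) = (if g i t = 0 then 0 else exp (- F i \<bar>g i t\<bar>))"
    by blast+
  define \<nu> where "\<nu> = angle_measure u"
  \<comment> \<open>The image measure lives on \<open>{0..pi}\<close>, so the restriction in
    \<open>deriv_p_norm\<close> can be removed.\<close>
  have AE\<nu>: "(\<integral>\<^sup>+ t. indicator {0..pi} t * G t \<partial>\<nu>) = (\<integral>\<^sup>+ t. G t \<partial>\<nu>)" if [measurable]: "G \<in> borel_measurable borel" for G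
    unfolding \<nu>_def
    by (subst (1 2) nn_integral_angle_measure[OF u])
       (auto intro!: nn_integral_cong simp: indicator_def arccos_lbound arccos_ubound)
  show ?thesis
  proof (cases "measure \<nu> UNIV > 0")
    case True
    then obtain m where dm: "doubling_measure \<nu> m"
      unfolding \<nu>_def using doubling_measure_angle_measure[OF assms(5)] by blast
    interpret Omega_doubling \<nu> m p I A a1 a2 b D c F F' F'' g g' g''
    proof (intro Omega_doubling.intro Omega_doubling_axioms.intro)
      show "finite I" by (simp add: I_def)
      show "(if g i (- t) = 0 then 0 else exp (- F i \<bar>g i (- t)\<bar>)) = (if g i t = 0 then 0 else exp (- F i \<bar>g i t\<bar>))"
        if "i \<in> I" for i t
        using w[OF that, of t] w[OF that, of "- t"] by simp
    qed (rule dm assms(1) wf per simple lim; assumption?)+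
    have Wcos: "W t = \<omega> (cos t)" for t
    proof -
      have "\<omega> (cos t) = (\<Prod>i\<in>I. \<omega>s i (cos t))" using assms(4)[of "cos t"] by (simp add: I_def)
      also have "\<dots> = W t" unfolding W_def using w by (intro prod.cong refl) (simp add: w_def)
      finally show ?thesis by simp
    qed
    have W: "\<omega> x = W (arccos x)" if "x \<in> {-1..1}" for x
      using that Wcos[of "arccos x"] by simp
    obtain C where C: "C \<ge> 0" "\<And>n P. n \<ge> 1 \<Longrightarrow> degree P \<le> n \<Longrightarrow>
      (\<integral>\<^sup>+ s. indicator {0..pi} s * ennreal (deriv_size P s powr p * W s) \<partial>\<nu>)
     \<le> ennreal (C * real n powr p) * (\<integral>\<^sup>+ s. ennreal (norm (pcos P s) powr p * W s) \<partial>\<nu>)"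
      using weighted_Bernstein by blast
    have nn: "0 \<le> (LINT x:{-1..1}|lebesgue. cmod (poly P (complex_of_real x)) powr p * (\<omega> x * u x))" for P
      unfolding set_lebesgue_integral_def
    proof (intro Bochner_Integration.integral_nonneg)
      fix x :: real
      show "0 \<le> indicator {-1..1} x *\<^sub>R (cmod (poly P (complex_of_real x)) powr p * (\<omega> x * u x))"
        using W[of x] W_bounds(1)[of "arccos x"] u by (auto simp: indicator_def weight_def)
    qed
    show ?thesis
    proof (intro exI[of _ C] allI impI)
      fix n :: nat and P :: "complex poly" assume n: "n \<ge> 1" and deg: "degree P \<le> n"
      have bnd: "\<exists>M. \<forall>t. norm (pcos Q t) \<le> M" for Q :: "complex poly"
      proof -
        obtain M where M: "M \<ge> 0" "\<And>u e. 0 \<le> e \<Longrightarrow> e \<le> 1 \<Longrightarrow> norm (poly Q (of_real (cos u) + \<i> * of_real e)) \<le> M"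
          using bounded_poly_cos_shift[of Q] by blast
        from M(2)[of 0] show ?thesis by auto
      qed
      obtain M where M: "\<And>t. norm (pcos P t) \<le> M" using bnd by blast
      obtain M' where M': "\<And>t. norm (pcos (pderiv P) t) \<le> M'" using bnd by blast
      have [measurable]: "(\<lambda>t. pcos Q t) \<in> borel_measurable borel" for Q
        by (intro borel_measurable_continuous_onI continuous_intros)
      have 1: "ennreal (LINT x:{-1..1}|lebesgue. phi x powr p * cmod (poly (pderiv P) (complex_of_real x)) powr p * (\<omega> x * u x))
        = (\<integral>\<^sup>+ t. ennreal (deriv_size P t powr p * W t) \<partial>\<nu>)"
      proof -
        have "ennreal (LINT x:{-1..1}|lebesgue. (phi x powr p * cmod (poly (pderiv P) (complex_of_real x)) powr p * \<omega> x) * u x)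
          = (\<integral>\<^sup>+ t. ennreal (deriv_size P t powr p * W t) \<partial>\<nu>)"
          unfolding \<nu>_def
        proof (rule set_integral_angle_measure[OF u, where B = "M' powr p"])
          show "phi x powr p * cmod (poly (pderiv P) (complex_of_real x)) powr p * \<omega> x = deriv_size P (arccos x) powr p * W (arccos x)"
            if "x \<in> {-1..1}" for x
          proof -
            have e: "sin (arccos x) = phi x" using that by (simp add: sin_arccos phi_def)
            have "sin (arccos x) \<ge> 0" using that by (intro sin_ge_zero arccos_lbound arccos_ubound) auto
            hence "phi x \<ge> 0" unfolding e .
            with e show ?thesis using that W[OF that] by (simp add: deriv_size_def powr_mult)
          qed
          show "deriv_size P t powr p * W t \<le> M' powr p" for t
          proof -
            have "deriv_size P t \<le> 1 * M'" unfolding deriv_size_def using M'[of t] by (intro mult_mono) auto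
            hence "deriv_size P t powr p * W t \<le> M' powr p * 1"
              using assms(1) W_bounds by (intro mult_mono powr_mono2) (auto simp: deriv_size_def)
            thus ?thesis by simp
          qed
        qed (use W_bounds in auto)
        thus ?thesis by (simp add: mult.assoc)
      qed
      have 2: "ennreal (LINT x:{-1..1}|lebesgue. cmod (poly P (complex_of_real x)) powr p * (\<omega> x * u x))
        = (\<integral>\<^sup>+ t. ennreal (norm (pcos P t) powr p * W t) \<partial>\<nu>)"
      proof -
        have "ennreal (LINT x:{-1..1}|lebesgue. (cmod (poly P (complex_of_real x)) powr p * \<omega> x) * u x)
          = (\<integral>\<^sup>+ t. ennreal (norm (pcos P t) powr p * W t) \<partial>\<nu>)"
          unfolding \<nu>_def
        proof (rule set_integral_angle_measure[OF u, where B = "M powr p"])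
          show "norm (pcos P t) powr p * W t \<le> M powr p" for t
          proof -
            have "norm (pcos P t) powr p * W t \<le> M powr p * 1"
              using assms(1) W_bounds M by (intro mult_mono powr_mono2) auto
            thus ?thesis by simp
          qed
        qed (use W_bounds W in auto)
        thus ?thesis by (simp add: mult.assoc)
      qed
      have "(\<integral>\<^sup>+ t. ennreal (deriv_size P t powr p * W t) \<partial>\<nu>)
         \<le> ennreal (C * real n powr p) * (\<integral>\<^sup>+ t. ennreal (norm (pcos P t) powr p * W t) \<partial>\<nu>)"
        using C(2)[OF n deg] by (subst (asm) AE\<nu>) auto
      hence "ennreal (LINT x:{-1..1}|lebesgue. phi x powr p * cmod (poly (pderiv P) (complex_of_real x)) powr p * (\<omega> x * u x))
        \<le> ennreal (C * real n powr p * (LINT x:{-1..1}|lebesgue. cmod (poly P (complex_of_real x)) powr p * (\<omega> x * u x)))"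
        unfolding 1[symmetric] 2[symmetric] using C(1) by (subst ennreal_mult') auto
      thus "(LINT x:{-1..1}|lebesgue. phi x powr p * cmod (poly (pderiv P) (complex_of_real x)) powr p * (\<omega> x * u x))
        \<le> C * real n powr p * (LINT x:{-1..1}|lebesgue. cmod (poly P (complex_of_real x)) powr p * (\<omega> x * u x))"
        using C(1) nn[of P] by (subst (asm) ennreal_le_iff) auto
    qed
  next
    case False
    \<comment> \<open>A doubling measure is required to have positive mass. If the mass is zero,
      \<open>u\<close> vanishes almost everywhere on \<open>[-1,1]\<close> and both integrals are
      zero.\<close>
    have "emeasure \<nu> UNIV = ennreal (measure \<nu> UNIV)"
      using finite_measure.emeasure_eq_measure[OF finite_measure_angle_measure[OF u]] by (simp add: \<nu>_def)
    hence "emeasure \<nu> UNIV = 0" using False by (simp add: ennreal_neg)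
    hence "(\<integral>\<^sup>+ x. ennreal (indicator {-1..1} x * u x) \<partial>lebesgue) = 0"
      using nn_integral_angle_measure[OF u, of "\<lambda>_. 1"] by (simp add: \<nu>_def)
    hence "AE x in lebesgue. ennreal (indicator {-1..1} x * u x) = 0"
      using weight_measurable(1)[OF u] by (subst (asm) nn_integral_0_iff_AE) auto
    hence ae: "AE x in lebesgue. indicator {-1..1} x * u x = 0"
      by (rule AE_mp) (rule AE_I2, use weight_measurable(3)[OF u] in \<open>auto simp: order_antisym\<close>)
    have zero: "(LINT x:{-1..1}|lebesgue. f x * (\<omega> x * u x)) = 0" for f :: "real \<Rightarrow> real"
      unfolding set_lebesgue_integral_def
    proof (rule integral_eq_zero_AE)
      show "AE x in lebesgue. indicator {-1..1} x *\<^sub>R (f x * (\<omega> x * u x)) = 0"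
        using ae by (rule AE_mp) (auto intro!: AE_I2)
    qed
    show ?thesis unfolding zero by auto
  qed
qed

end
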